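(* Let $G$ be a complex Banach space. Let $U_0$ be an open neighborhood of $0\in\mathbb{C}$ and $g:U_0\to\mathbb{C}$ an analytic function such that $g(\lambda)=\sum_{n=0}^\infty\alpha_n\lambda^n$ for all $\lambda\in U_0$, and let $R>0$ be the radius of convergence of $\sum_{n=0}^\infty\alpha_n\lambda^n$. Let $X$ be a Banach space over $\mathbb{R}$, $D\subseteq X$ an open set, and $\mathcal{T}:D\to B(G)_{\mathbb{R}}$ a Fréchet differentiable mapping such that there exists $r$ with $0<r<R$, $\mathcal{T}(D)\subseteq B_r(\mathbf{0})$, and $\sigma(\mathcal{T}(x))\subseteq U_0$ for all $x\in D$. Then: (1) $g^{\mathbb{R}}\circ\mathcal{T}=\sum_{n=0}^\infty\alpha_n\mathcal{T}^n$, where the series converges absolutely uniformly on $D$ and $\mathcal{T}^n(x)=\mathcal{T}(x)^n$. (2) Set $\widetilde{r}=\sup_{x\in D}\|\mathcal{T}(x)\|$ and write $M=\sup_{x\in D}\|\mathcal{T}^{[1]}(x)\|_{B(X,B(G)_{\mathbb{R}})}\in[0,\infty]$. Then $\widetilde{r}<\infty$ and the following hold. (2a) If $0<\widetilde{r}<R$, then $g^{\mathbb{R}}\circ\mathcal{T}$ is Fréchet differentiable and for all $x\in D$ $$[g^{\mathbb{R}}\circ\mathcal{T}]^{[1]}(x)=\sum_{n=0}^\infty\alpha_nu_n^{[1]}(\mathcal{T}(x))\mathcal{T}^{[1]}(x),$$ with convergence in $B(X,B(G)_{\mathbb{R}})$; if $\mathcal{T}^{[1]}:D\to B(X,B(G)_{\mathbb{R}})$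 is continuous then so is $[g^{\mathbb{R}}\circ\mathcal{T}]^{[1]}$; and if $M<\infty$ the series converges absolutely uniformly on $D$. (2b) If $0<\widetilde{r}<\frac{R}{3}$, then for all $x\in D$ and $h\in X$ $$[g^{\mathbb{R}}\circ\mathcal{T}]^{[1]}(x)=\sum_{p=1}^\infty\frac{1}{p!}g^{(p)}(\mathcal{R}(\mathcal{T}(x)))C(\mathcal{T}(x))^{p-1}\mathcal{T}^{[1]}(x),$$ $$[g^{\mathbb{R}}\circ\mathcal{T}]^{[1]}(x)(h)=\sum_{p=1}^\infty\frac{1}{p!}g^{(p)}(\mathcal{T}(x))C(\mathcal{T}(x))^{p-1}\bigl(\mathcal{T}^{[1]}(x)(h)\bigr);$$ if in addition $M<\infty$, the first series converges absolutely uniformly on $D$ and the second converges absolutely uniformly for $(x,h)\in D\times B_L(\mathbf{0})$ for all $L>0$. (2c) If $0<\widetilde{r}<R$, then for all $x\in D$ and $h\in X$ $$\begin{aligned}[g^{\mathbb{R}}\circ\mathcal{T}]^{[1]}(x)(h)&=\sum_{n=1}^{\infty}n\alpha_n\mathcal{T}^{[1]}(x)(h)\mathcal{T}(x)^{n-1}+\sum_{n=2}^{\infty}\sum_{p=0}^{n-2}(n-p-1)\alpha_n\mathcal{T}(x)^p[\mathcal{T}(x),\mathcal{T}^{[1]}(x)(h)]\mathcal{T}(x)^{n-(2+p)}\\&=\sum_{n=1}^{\infty}n\alpha_n\mathcal{T}^{[1]}(x)(h)\mathcal{T}(x)^{n-1}+\sum_{p=0}^{\infty}\sum_{n=p+2}^{\infty}(n-p-1)\alpha_n\mathcal{T}(x)^p[\mathcal{T}(x),\mathcal{T}^{[1]}(x)(h)]\mathcal{T}(x)^{n-(2+p)};\end{aligned}$$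 if in addition $M<\infty$, all these series converge absolutely uniformly for $(x,h)\in D\times B_L(\mathbf{0})$ for all $L>0$. (2d) If $0<\widetilde{r}<R$, then for all $x\in D$ $$[g^{\mathbb{R}}\circ\mathcal{T}]^{[1]}(x)=\sum_{n=1}^{\infty}n\alpha_n\mathcal{L}(\mathcal{T}(x))^{n-1}\mathcal{T}^{[1]}(x)-\sum_{k=2}^{\infty}\left\{\sum_{n=k}^{\infty}\alpha_n\mathcal{L}(\mathcal{T}(x))^{n-k}\right\}C(\mathcal{T}(x)^{k-1})\mathcal{T}^{[1]}(x);$$ if in addition $M<\infty$, all these series converge absolutely uniformly on $D$. (2e) If $X=\mathbb{R}$ and $0<\widetilde{r}<\frac{R}{3}$, then for all $t\in D$ $$\frac{d\,(g^{\mathbb{R}}\circ\mathcal{T})}{dt}(t)=\sum_{p=1}^\infty\frac{1}{p!}g^{(p)}(\mathcal{T}(t))C(\mathcal{T}(t))^{p-1}\left(\frac{d\mathcal{T}}{dt}(t)\right),$$ and if in addition $\sup_{t\in D}\|\frac{d\mathcal{T}}{dt}(t)\|<\infty$ the series converges absolutely uniformly on $D$.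
   Context: $B(G)$ is the complex unitary Banach algebra of bounded linear operators on $G$ with operator norm. For a complex Banach space $F$, $F_{\mathbb{R}}$ denotes the same space with the same norm regarded as a real Banach space; for a map $f:A\subseteq F\to F'$ between complex Banach spaces, $f^{\mathbb{R}}$ is the same map regarded as a map between $F_{\mathbb{R}}$ and $F'_{\mathbb{R}}$. $\sigma(T)$ is the spectrum of $T\in B(G)$. For $T\in B(G)$ and $g$ analytic on an open set $U\supset\sigma(T)$, $g(T)=\frac{1}{2\pi i}\int_Bg(\lambda)(\lambda\mathbf{1}-T)^{-1}\,d\lambda\in B(G)$, where $B\subset U$ is the boundary of an open set containing $\sigma(T)$ and consists of finitely many (suitably oriented) rectifiable Jordan curves (the analytic functional calculus); $g^{\mathbb{R}}\circ\mathcal{T}$ is the map $x\mapsto g(\mathcal{T}(x))$. $B_r(\mathbf{0})$ is the open ball of radius $r$ about $0$ in the relevant space ($B(G)$ or $X$). $B(X,Y)$ is the Banach space of bounded linear maps with operator norm. $[A,B]=AB-BA$. For $T\in B(G)$ let $\mathcal{R}(T),\mathcal{L}(T),C(T)$ be the bounded operators on $B(G)$ given by $\mathcal{R}(T)(h)=Th$, $\mathcal{L}(T)(h)=hT$, $C(T)(h)=hT-Th$; products and powers of such operators, and juxtaposition with $\mathcal{T}^{[1]}(x)$, denote composition, with zeroth power the identity. For a map $f$ defined on an open subset of a Banach space $F$ with values in a Banach space $F'$, $f^{[1]}$ is its Fréchet differential function, with values in $B(F,F')$. $u_n(T)=T^n$ on $B(G)$ and $u_n^{[1]}$ is its Fréchet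 differential function. $g^{(p)}$ is the $p$-th derivative of the power series $g$, and for $Q$ in a unitary Banach algebra with $\|Q\|<R$, $g^{(p)}(Q)=\sum_{n\ge p}p!\binom{n}{p}\alpha_nQ^{n-p}$ (used for $Q=\mathcal{T}(x)\in B(G)$ and $Q=\mathcal{R}(\mathcal{T}(x))\in B(B(G))$); in formulas evaluated at $h$ or $t$, $g^{(p)}(\mathcal{T}(x))$ acts by left multiplication. A series $\sum_nf_n$ of maps from a set $S$ to a Banach space $Y$ converges absolutely uniformly on $S$ if $\sum_n\sup_{u\in S}\|f_n(u)\|_Y<\infty$. *)

theory Defs
  imports "HOL-Complex_Analysis.Complex_Analysis"
begin

section \<open>Complex normed spaces and complex Banach spaces\<close>

text \<open>
  Every complex normed space here is by construction also a real normed space with the same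
  norm, so \<open>F\<^sub>\<real>\<close> is the type itself, used through its \<^class>\<open>real_normed_vector\<close> structure.
\<close>

class complex_normed_space = real_normed_vector +
  fixes scaleC :: "complex \<Rightarrow> 'a \<Rightarrow> 'a" (infixr "*\<^sub>C" 75)
  assumes scaleC_add_right: "c *\<^sub>C (x + y) = c *\<^sub>C x + c *\<^sub>C y"
    and scaleC_add_left: "(c + d) *\<^sub>C x = c *\<^sub>C x + d *\<^sub>C x"
    and scaleC_scaleC: "c *\<^sub>C (d *\<^sub>C x) = (c * d) *\<^sub>C x"
    and scaleC_one: "1 *\<^sub>C x = x"
    and scaleC_of_real: "complex_of_real r *\<^sub>C x = r *\<^sub>R x"
    and norm_scaleC: "norm (c *\<^sub>C x) = cmod c * norm x"

class complex_banach = complex_normed_space + complete_space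
begin
subclass banach ..
end

instantiation complex :: complex_banach
begin
definition scaleC_complex :: "complex \<Rightarrow> complex \<Rightarrow> complex" where
  "scaleC_complex c x = c * x"
instance
  by standard (simp_all add: scaleC_complex_def algebra_simps norm_mult scaleR_conv_of_real)
end

lemma bounded_linear_scaleC: "bounded_linear (\<lambda>x::'a::complex_normed_space. c *\<^sub>C x)"
proof (rule bounded_linear_intro)
  fix x y :: 'a and r :: real
  show "c *\<^sub>C (x + y) = c *\<^sub>C x + c *\<^sub>C y" by (rule scaleC_add_right)
  show "c *\<^sub>C (r *\<^sub>R x) = r *\<^sub>R (c *\<^sub>C x)"
    by (simp flip: scaleC_of_real add: scaleC_scaleC mult.commute)
  show "norm (c *\<^sub>C x) \<le> norm x * cmod c" by (simp add: norm_scaleC)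
qed

text \<open>Bounded real-linear maps into a complex space: complex multiples are formed pointwise.\<close>

instantiation blinfun :: (real_normed_vector, complex_normed_space) complex_normed_space
begin

lift_definition scaleC_blinfun :: "complex \<Rightarrow> ('a \<Rightarrow>\<^sub>L 'b) \<Rightarrow> 'a \<Rightarrow>\<^sub>L 'b" is "\<lambda>c f x. c *\<^sub>C f x"
  by (rule bounded_linear_compose[OF bounded_linear_scaleC])

instance
proof
  fix c d :: complex and r :: real and f g :: "'a \<Rightarrow>\<^sub>L 'b"
  show "c *\<^sub>C (f + g) = c *\<^sub>C f + c *\<^sub>C g"
    by transfer (simp add: scaleC_add_right)
  show "(c + d) *\<^sub>C f = c *\<^sub>C f + d *\<^sub>C f"
    by transfer (simp add: scaleC_add_left)
  show "c *\<^sub>C (d *\<^sub>C f) = (c * d) *\<^sub>C f"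
    by transfer (simp add: scaleC_scaleC)
  show "1 *\<^sub>C f = f"
    by transfer (simp add: scaleC_one)
  show "complex_of_real r *\<^sub>C f = r *\<^sub>R f"
    by transfer (simp add: scaleC_of_real)
  have le: "norm (a *\<^sub>C h) \<le> cmod a * norm h" for a and h :: "'a \<Rightarrow>\<^sub>L 'b"
  proof (rule norm_blinfun_bound)
    fix x
    have "norm (blinfun_apply (a *\<^sub>C h) x) = cmod a * norm (blinfun_apply h x)"
      by (simp add: scaleC_blinfun.rep_eq norm_scaleC)
    also have "\<dots> \<le> cmod a * (norm h * norm x)"
      by (intro mult_left_mono norm_blinfun) simp
    finally show "norm (blinfun_apply (a *\<^sub>C h) x) \<le> cmod a * norm h * norm x"
      by (simp add: mult.assoc)
  qed simp
  show "norm (c *\<^sub>C f) = cmod c * norm f"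
  proof (cases "c = 0")
    case True
    then show ?thesis using le[of c f] by simp
  next
    case False
    have "f = inverse c *\<^sub>C (c *\<^sub>C f)"
      using False by transfer (simp add: scaleC_scaleC scaleC_one)
    then have "norm f \<le> cmod (inverse c) * norm (c *\<^sub>C f)"
      using le[of "inverse c" "c *\<^sub>C f"] by simp
    then have "cmod c * norm f \<le> norm (c *\<^sub>C f)"
      using False by (simp add: norm_inverse norm_divide field_simps)
    with le[of c f] show ?thesis by simp
  qed
qed

end

instance blinfun :: (real_normed_vector, complex_banach) complex_banach ..


section \<open>The complex unitary Banach algebra \<open>B(G)\<close>\<close>

text \<open>
  Bounded complex-linear operators, with the operator norm inherited from \<^typ>\<open>'a \<Rightarrow>\<^sub>L 'a\<close>.
  The zero space is allowed, so \<open>1 = 0\<close> is not excluded and \<open>'a bop\<close> is not made an instance of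
  \<^class>\<open>real_normed_algebra_1\<close>.
\<close>

typedef (overloaded) 'a bop =
  "{f :: 'a::complex_normed_space \<Rightarrow>\<^sub>L 'a. \<forall>c x. blinfun_apply f (c *\<^sub>C x) = c *\<^sub>C blinfun_apply f x}"
  morphisms blinfun_of_bop Bop
proof
  show "0 \<in> {f :: 'a \<Rightarrow>\<^sub>L 'a. \<forall>c x. blinfun_apply f (c *\<^sub>C x) = c *\<^sub>C blinfun_apply f x}"
    by (simp add: zero_blinfun.rep_eq linear_0[OF bounded_linear.linear[OF bounded_linear_scaleC]])
qed

setup_lifting type_definition_bop

lift_definition bop_apply :: "'a::complex_normed_space bop \<Rightarrow> 'a \<Rightarrow> 'a" is blinfun_apply .

lemma bop_eqI: "(\<And>x. bop_apply S x = bop_apply T x) \<Longrightarrow> S = T"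
  by transfer (rule blinfun_eqI)

lemma scaleC_minus_right: "c *\<^sub>C (- x) = - (c *\<^sub>C x)" for x :: "'a::complex_normed_space"
  by (rule linear_neg[OF bounded_linear.linear[OF bounded_linear_scaleC]])

lemma scaleC_zero_right: "c *\<^sub>C 0 = (0 :: 'a::complex_normed_space)"
  by (rule linear_0[OF bounded_linear.linear[OF bounded_linear_scaleC]])

lemma scaleC_scaleR: "c *\<^sub>C (r *\<^sub>R x) = r *\<^sub>R (c *\<^sub>C x)" for x :: "'a::complex_normed_space"
  by (rule linear_scale[OF bounded_linear.linear[OF bounded_linear_scaleC]])

instantiation bop :: (complex_normed_space) complex_normed_space
begin

lift_definition zero_bop :: "'a bop" is 0
  by (simp add: scaleC_zero_right)
lift_definition plus_bop :: "'a bop \<Rightarrow> 'a bop \<Rightarrow> 'a bop" is "(+)"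
  by (simp add: blinfun.add_left scaleC_add_right)
lift_definition uminus_bop :: "'a bop \<Rightarrow> 'a bop" is uminus
  by (simp add: blinfun.minus_left scaleC_minus_right)
definition minus_bop :: "'a bop \<Rightarrow> 'a bop \<Rightarrow> 'a bop" where
  "minus_bop S T = S + - T"
lift_definition scaleR_bop :: "real \<Rightarrow> 'a bop \<Rightarrow> 'a bop" is "(*\<^sub>R)"
  by (simp add: blinfun.scaleR_left scaleC_scaleR)
lift_definition scaleC_bop :: "complex \<Rightarrow> 'a bop \<Rightarrow> 'a bop" is "(*\<^sub>C)"
  by (simp add: scaleC_blinfun.rep_eq scaleC_scaleC mult.commute)
lift_definition norm_bop :: "'a bop \<Rightarrow> real" is norm .
definition dist_bop :: "'a bop \<Rightarrow> 'a bop \<Rightarrow> real" where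
  "dist_bop S T = norm (S - T)"
definition sgn_bop :: "'a bop \<Rightarrow> 'a bop" where
  "sgn_bop T = inverse (norm T) *\<^sub>R T"
definition uniformity_bop :: "('a bop \<times> 'a bop) filter" where
  [code del]: "uniformity_bop = (INF e\<in>{0 <..}. principal {(S, T). dist S T < e})"
definition open_bop :: "'a bop set \<Rightarrow> bool" where
  [code del]: "open_bop A = (\<forall>S\<in>A. \<forall>\<^sub>F (S', T) in uniformity. S' = S \<longrightarrow> T \<in> A)"

instance
proof
  fix a b :: real and c d :: complex and S T V :: "'a bop"
  show "S + T + V = S + (T + V)" by transfer (rule add.assoc)
  show "S + T = T + S" by transfer (rule add.commute)
  show "0 + S = S" by transfer simp
  show "- S + S = 0" by transfer simp
  show "S - T = S + - T" by (rule minus_bop_def)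
  show "a *\<^sub>R (S + T) = a *\<^sub>R S + a *\<^sub>R T" by transfer (rule scaleR_add_right)
  show "(a + b) *\<^sub>R S = a *\<^sub>R S + b *\<^sub>R S" by transfer (rule scaleR_add_left)
  show "a *\<^sub>R b *\<^sub>R S = (a * b) *\<^sub>R S" by transfer simp
  show "1 *\<^sub>R S = S" by transfer simp
  show "c *\<^sub>C (S + T) = c *\<^sub>C S + c *\<^sub>C T" by transfer (rule scaleC_add_right)
  show "(c + d) *\<^sub>C S = c *\<^sub>C S + d *\<^sub>C S" by transfer (rule scaleC_add_left)
  show "c *\<^sub>C (d *\<^sub>C S) = (c * d) *\<^sub>C S" by transfer (rule scaleC_scaleC)
  show "1 *\<^sub>C S = S" by transfer (rule scaleC_one)
  show "complex_of_real a *\<^sub>C S = a *\<^sub>R S" by transfer (rule scaleC_of_real)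
  show "norm (c *\<^sub>C S) = cmod c * norm S" by transfer (rule norm_scaleC)
  show "dist S T = norm (S - T)" by (rule dist_bop_def)
  show "sgn S = inverse (norm S) *\<^sub>R S" by (rule sgn_bop_def)
  show "uniformity = (INF e\<in>{0<..}. principal {(S :: 'a bop, T). dist S T < e})"
    by (rule uniformity_bop_def)
  show "open A = (\<forall>S\<in>A. \<forall>\<^sub>F (S', T) in uniformity. S' = S \<longrightarrow> T \<in> A)" for A :: "'a bop set"
    by (rule open_bop_def)
  show "(norm S = 0) = (S = 0)" by transfer simp
  show "norm (S + T) \<le> norm S + norm T" by transfer (rule norm_triangle_ineq)
  show "norm (a *\<^sub>R S) = \<bar>a\<bar> * norm S" by transfer simp
qed

end

instantiation bop :: (complex_normed_space) "{real_normed_algebra, monoid_mult}"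
begin

lift_definition times_bop :: "'a bop \<Rightarrow> 'a bop \<Rightarrow> 'a bop" is "(o\<^sub>L)"
  by simp
lift_definition one_bop :: "'a bop" is id_blinfun
  by simp

instance
proof
  fix r :: real and S T V :: "'a bop"
  show "S * T * V = S * (T * V)" by transfer (rule blinfun_eqI, simp)
  show "(S + T) * V = S * V + T * V"
    by transfer (rule bounded_bilinear.add_left[OF bounded_bilinear_blinfun_compose])
  show "S * (T + V) = S * T + S * V"
    by transfer (rule bounded_bilinear.add_right[OF bounded_bilinear_blinfun_compose])
  show "r *\<^sub>R S * T = r *\<^sub>R (S * T)"
    by transfer (rule bounded_bilinear.scaleR_left[OF bounded_bilinear_blinfun_compose])
  show "S * r *\<^sub>R T = r *\<^sub>R (S * T)"
    by transfer (rule bounded_bilinear.scaleR_right[OF bounded_bilinear_blinfun_compose])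
  show "norm (S * T) \<le> norm S * norm T" by transfer (rule norm_blinfun_compose)
  show "1 * S = S" by transfer (rule blinfun_eqI, simp)
  show "S * 1 = S" by transfer (rule blinfun_eqI, simp)
qed

end

lemma bop_apply_simps:
  "bop_apply (S * T) x = bop_apply S (bop_apply T x)"
  "bop_apply 1 x = x"
  "bop_apply (S + T) x = bop_apply S x + bop_apply T x"
  "bop_apply (c *\<^sub>C S) x = c *\<^sub>C bop_apply S x"
  "bop_apply S (c *\<^sub>C x) = c *\<^sub>C bop_apply S x"
  by (transfer; simp add: blinfun.add_left scaleC_blinfun.rep_eq)+

lemma norm_bop_eq_onorm: "norm S = onorm (bop_apply S)"
  by transfer (rule norm_blinfun.rep_eq)

instance bop :: (complex_banach) complex_banach
proof
  fix X :: "nat \<Rightarrow> 'a bop"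
  assume "Cauchy X"
  have dist_eq: "dist S T = dist (blinfun_of_bop S) (blinfun_of_bop T)" for S T :: "'a bop"
  proof -
    have "blinfun_of_bop (S - T) = blinfun_of_bop S - blinfun_of_bop T"
      unfolding minus_bop_def plus_bop.rep_eq uminus_bop.rep_eq by simp
    then show ?thesis
      by (simp only: dist_norm norm_bop.rep_eq)
  qed
  have "Cauchy (\<lambda>n. blinfun_of_bop (X n))"
    using \<open>Cauchy X\<close> unfolding Cauchy_def dist_eq .
  then obtain L where L: "(\<lambda>n. blinfun_of_bop (X n)) \<longlonglongrightarrow> L"
    unfolding Cauchy_convergent_iff convergent_def by (elim exE)
  have lim: "(\<lambda>n. blinfun_apply (blinfun_of_bop (X n)) x) \<longlonglongrightarrow> blinfun_apply L x" for x
    by (rule blinfun.tendsto[OF L tendsto_const])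
  have "blinfun_apply L (c *\<^sub>C x) = c *\<^sub>C blinfun_apply L x" for c x
  proof (rule LIMSEQ_unique[OF lim])
    have "(\<lambda>n. c *\<^sub>C blinfun_apply (blinfun_of_bop (X n)) x) \<longlonglongrightarrow> c *\<^sub>C blinfun_apply L x"
      by (rule bounded_linear.tendsto[OF bounded_linear_scaleC lim])
    moreover have "blinfun_apply (blinfun_of_bop (X n)) (c *\<^sub>C x)
        = c *\<^sub>C blinfun_apply (blinfun_of_bop (X n)) x" for n
      using blinfun_of_bop[of "X n"] by simp
    ultimately show "(\<lambda>n. blinfun_apply (blinfun_of_bop (X n)) (c *\<^sub>C x)) \<longlonglongrightarrow> c *\<^sub>C blinfun_apply L x"
      by simp
  qed
  then have "blinfun_of_bop (Bop L) = L"
    by (intro Bop_inverse) simp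
  then have "X \<longlonglongrightarrow> Bop L"
    using L unfolding tendsto_iff by (simp only: dist_eq)
  then show "convergent X"
    by (rule convergentI)
qed


section \<open>Spectrum and analytic functional calculus\<close>

definition bop_invertible :: "'a::complex_normed_space bop \<Rightarrow> bool" where
  "bop_invertible S \<longleftrightarrow> (\<exists>V. S * V = 1 \<and> V * S = 1)"

definition bop_inverse :: "'a::complex_normed_space bop \<Rightarrow> 'a bop" where
  "bop_inverse S = (THE V. S * V = 1 \<and> V * S = 1)"

definition spectrum :: "'a::complex_normed_space bop \<Rightarrow> complex set" where
  "spectrum T = {z. \<not> bop_invertible (z *\<^sub>C 1 - T)}"

definition rectifiable_path :: "(real \<Rightarrow> complex) \<Rightarrow> bool" where
  "rectifiable_path \<gamma> \<longleftrightarrow> path \<gamma> \<and>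
     bdd_above ((\<lambda>P. \<Sum>K\<in>P. dist (\<gamma> (Inf K)) (\<gamma> (Sup K))) ` {P. P division_of {0..1}})"

text \<open>
  The line integral \<open>\<integral>\<^sub>\<gamma> f(z) dz\<close> along a rectifiable path, for a function with values in a complex
  normed space, as a limit of Riemann--Stieltjes sums over tagged partitions of \<open>[0,1]\<close> whose
  mesh tends to zero.
\<close>

definition has_line_integral ::
    "(complex \<Rightarrow> 'a::complex_normed_space) \<Rightarrow> 'a \<Rightarrow> (real \<Rightarrow> complex) \<Rightarrow> bool" where
  "has_line_integral f I \<gamma> \<longleftrightarrow>
     (\<forall>e>0. \<exists>d>0. \<forall>p. p tagged_division_of {0..1} \<and> (\<lambda>t. ball t d) fine p \<longrightarrow>
        norm ((\<Sum>(t, K)\<in>p. (\<gamma> (Sup K) - \<gamma> (Inf K)) *\<^sub>C f (\<gamma> t)) - I) < e)"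

definition line_integral ::
    "(real \<Rightarrow> complex) \<Rightarrow> (complex \<Rightarrow> 'a::complex_normed_space) \<Rightarrow> 'a" where
  "line_integral \<gamma> f = (THE I. has_line_integral f I \<gamma>)"

text \<open>
  \<open>\<Gamma>\<close> is a finite set of rectifiable Jordan curves constituting the boundary of an open set
  \<open>\<Omega> \<supseteq> K\<close>, where \<open>\<Omega>\<close> together with its boundary lies in \<open>U\<close>. The last two conjuncts say that the
  curves are positively oriented with respect to \<open>\<Omega>\<close>; they also force \<open>\<Omega>\<close> to be bounded.
\<close>

definition spectral_contour ::
    "complex set \<Rightarrow> complex set \<Rightarrow> complex set \<Rightarrow> (real \<Rightarrow> complex) set \<Rightarrow> bool" where
  "spectral_contour U K \<Omega> \<Gamma> \<longleftrightarrow>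
     open \<Omega> \<and> K \<subseteq> \<Omega> \<and> closure \<Omega> \<subseteq> U \<and>
     finite \<Gamma> \<and>
     (\<forall>\<gamma>\<in>\<Gamma>. simple_path \<gamma> \<and> pathfinish \<gamma> = pathstart \<gamma> \<and> rectifiable_path \<gamma>) \<and>
     frontier \<Omega> = (\<Union>\<gamma>\<in>\<Gamma>. path_image \<gamma>) \<and>
     (\<forall>z\<in>\<Omega>. (\<Sum>\<gamma>\<in>\<Gamma>. winding_number \<gamma> z) = 1) \<and>
     (\<forall>z. z \<notin> closure \<Omega> \<longrightarrow> (\<Sum>\<gamma>\<in>\<Gamma>. winding_number \<gamma> z) = 0)"

text \<open>
  The operator \<open>g(T)\<close> for \<open>g\<close> analytic on the open set \<open>U \<supseteq> spectrum T\<close>. The integral does not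
  depend on the contour, so any admissible choice gives the same operator.
\<close>

definition functional_calculus ::
    "complex set \<Rightarrow> (complex \<Rightarrow> complex) \<Rightarrow> 'a::complex_normed_space bop \<Rightarrow> 'a bop" where
  "functional_calculus U g T =
     (SOME S. \<exists>\<Omega> \<Gamma>. spectral_contour U (spectrum T) \<Omega> \<Gamma> \<and>
        S = (1 / (2 * of_real pi * \<i>)) *\<^sub>C
              (\<Sum>\<gamma>\<in>\<Gamma>. line_integral \<gamma> (\<lambda>z. g z *\<^sub>C bop_inverse (z *\<^sub>C 1 - T))))"


section \<open>Multiplication and commutation operators on \<open>B(G)\<close>\<close>

definition Rop :: "'a::complex_normed_space bop \<Rightarrow> 'a bop bop" where
  "Rop T = Bop (Blinfun (\<lambda>h. T * h))"

definition Lop :: "'a::complex_normed_space bop \<Rightarrow> 'a bop bop" where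
  "Lop T = Bop (Blinfun (\<lambda>h. h * T))"

definition Cop :: "'a::complex_normed_space bop \<Rightarrow> 'a bop bop" where
  "Cop T = Lop T - Rop T"

lemma Rop_apply: "bop_apply (Rop T) h = T * h"
proof -
  have "blinfun_of_bop (Rop T) = Blinfun (\<lambda>h. T * h)"
    unfolding Rop_def
    by (rule Bop_inverse)
      (auto simp: bounded_linear_Blinfun_apply bounded_linear_mult_right bop_apply_simps
        intro!: bop_eqI)
  then show ?thesis
    by (simp add: bop_apply.rep_eq bounded_linear_Blinfun_apply bounded_linear_mult_right)
qed

lemma Lop_apply: "bop_apply (Lop T) h = h * T"
proof -
  have "blinfun_of_bop (Lop T) = Blinfun (\<lambda>h. h * T)"
    unfolding Lop_def
    by (rule Bop_inverse)
      (auto simp: bounded_linear_Blinfun_apply bounded_linear_mult_left bop_apply_simps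
        intro!: bop_eqI)
  then show ?thesis
    by (simp add: bop_apply.rep_eq bounded_linear_Blinfun_apply bounded_linear_mult_left)
qed

lemma Cop_apply: "bop_apply (Cop T) h = h * T - T * h"
proof -
  have "bop_apply (S - V) h = bop_apply S h - bop_apply V h" for S V :: "'a bop bop"
  proof -
    have "bop_apply (S - V) h = blinfun_apply (blinfun_of_bop S + - blinfun_of_bop V) h"
      by (simp only: minus_bop_def bop_apply.rep_eq plus_bop.rep_eq uminus_bop.rep_eq)
    then show ?thesis
      by (simp add: bop_apply.rep_eq blinfun.diff_left)
  qed
  then show ?thesis by (simp add: Cop_def Lop_apply Rop_apply)
qed

definition commutator :: "'a::complex_normed_space bop \<Rightarrow> 'a bop \<Rightarrow> 'a bop" where
  "commutator A B = A * B - B * A"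

text \<open>Composition of a bounded operator on \<open>B(G)\<close> with a bounded real-linear map \<open>X \<rightarrow> B(G)\<close>.\<close>

definition bop_comp ::
    "'a::complex_normed_space bop \<Rightarrow> ('x::real_normed_vector \<Rightarrow>\<^sub>L 'a) \<Rightarrow> 'x \<Rightarrow>\<^sub>L 'a"
    (infixr "\<odot>" 70) where
  "A \<odot> f = blinfun_of_bop A o\<^sub>L f"


section \<open>Power series, derivatives, absolutely uniform convergence\<close>

text \<open>
  \<open>g\<^sup>(\<^sup>p\<^sup>)(Q) = \<Sum>n\<ge>p. p! (n choose p) \<alpha>\<^sub>n Q\<^sup>n\<^sup>-\<^sup>p\<close>; the terms with \<open>n < p\<close> vanish because then
  \<open>n choose p = 0\<close>. It is used for \<open>Q \<in> B(G)\<close> as well as for \<open>Q \<in> B(B(G))\<close>.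
\<close>

definition pser_deriv ::
    "(nat \<Rightarrow> complex) \<Rightarrow> nat \<Rightarrow> 'a::complex_normed_space bop \<Rightarrow> 'a bop" where
  "pser_deriv \<alpha> p Q = (\<Sum>n. (fact p * of_nat (n choose p) * \<alpha> n) *\<^sub>C Q ^ (n - p))"

text \<open>The (real) Frechet differential \<open>f\<^sup>[\<^sup>1\<^sup>](x)\<close> as an element of \<open>B(F, F')\<close>.\<close>

definition frechet_diff ::
    "('a::real_normed_vector \<Rightarrow> 'b::real_normed_vector) \<Rightarrow> 'a \<Rightarrow> 'a \<Rightarrow>\<^sub>L 'b" where
  "frechet_diff f x = Blinfun (frechet_derivative f (at x))"

text \<open>Suprema and sums are formed in \<open>[0, \<infinity>]\<close>; the supremum over the empty set is \<open>0\<close>.\<close>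

definition abs_unif_convergent_on ::
    "'s set \<Rightarrow> (nat \<Rightarrow> 's \<Rightarrow> 'b::real_normed_vector) \<Rightarrow> bool" where
  "abs_unif_convergent_on S f \<longleftrightarrow> (\<Sum>n. SUP u\<in>S. ennreal (norm (f n u))) < \<infinity>"

definition admissible_map ::
    "complex set \<Rightarrow> ereal \<Rightarrow> 'x::real_normed_vector set \<Rightarrow> ('x \<Rightarrow> 'g::complex_normed_space bop) \<Rightarrow> bool"
  where
  "admissible_map U R D \<T> \<longleftrightarrow>
     open D \<and> (\<forall>x\<in>D. \<T> differentiable (at x)) \<and>
     (\<exists>r::real. 0 < r \<and> ereal r < R \<and> \<T> ` D \<subseteq> ball 0 r) \<and>
     (\<forall>x\<in>D. spectrum (\<T> x) \<subseteq> U)"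

end

theory Submission
  imports Defs
begin

text \<open>
  Part (1) identifies the functional calculus, a contour integral, with the power series \<open>\<Sum>n. \<alpha> n *\<^sub>C T ^ n\<close>.
  Everything else is termwise differentiation of that power series together with algebra in the
  operators \<open>Rop T\<close> and \<open>Lop T\<close> on \<open>B(G)\<close>.

  \<^bold>\<open>Functional calculus.\<close> Let \<open>R(z)\<close> be the resolvent of \<open>T\<close> and let the contour have winding number \<open>1\<close> around the
  spectrum. The heart of the matter is that the integral \<open>P\<close> of \<open>R\<close> over the contour, divided by
  \<open>2 \<pi> \<i>\<close>, is \<open>1\<close> (\<open>cint_resolvent\<close>). The Cauchy transform of \<open>R\<close> over the contour solves
  \<open>(\<zeta> - T) X(\<zeta>) = P - 1\<close> in the region inside the contour, and \<open>R(\<zeta>) (P - 1)\<close> solves it off the spectrum. The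
  two solutions agree where both are defined, hence form an entire function; it vanishes at infinity
  and therefore everywhere, by a vector-valued Liouville theorem, so that \<open>P = 1\<close>. From
  \<open>z R(z) = 1 + T R(z)\<close> the integral of \<open>z ^ n R(z)\<close> is \<open>T ^ n\<close>, and uniform convergence of the power series on the
  contour gives the claim (\<open>sums_functional_calculus\<close>). Along a curve that is merely rectifiable, the
  integrals that have to be computed, those of monomials and of \<open>1 / (z - \<zeta>)\<close>, are found from primitives
  along the curve (\<open>has_line_integral_primitive\<close>), in the latter case a continuous logarithm, which brings
  in the winding number.

  The functional calculus is defined by choosing some contour, so that a contour has to be exhibited.
  The boundary edges of a union of small squares near the spectrum form a directed graph in which
  every vertex has as many incoming as outgoing edges; such a graph decomposes into Jordan polygons,
  and the winding number of the whole is computed square by square (\<open>spectral_contour_exists\<close>).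

  \<^bold>\<open>Differentiation.\<close> The differential of \<open>T \<mapsto> T ^ n\<close> is \<open>\<Sum>i<n. Rop T ^ i * Lop T ^ (n - 1 - i)\<close>. The operators
  \<open>Rop T\<close> and \<open>Lop T\<close> commute, so this is the difference quotient \<open>(b ^ n - a ^ n) / (b - a)\<close> of two commuting
  elements, and parts (2b), (2c) and (2d) are three ways to write such a quotient: in powers of
  \<open>Cop T = Lop T - Rop T\<close> (\<open>power_dq_binomial\<close>), through the commutator (\<open>power_dq_commutator\<close>), and through differences
  of powers (\<open>power_dq_power_differences\<close>). Weighted with \<open>\<alpha> n\<close> and summed over \<open>n\<close>, each becomes a triangular
  double series with a majorant that depends only on a bound \<open>\<rho>\<close> for \<open>norm T\<close>. Absolute summability of the
  majorant yields the change of the order of summation and the uniformity at once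
  (\<open>summable_triangular\<close>). In (2b) the norms of \<open>Rop T\<close> and \<open>Cop T\<close> are at most \<open>\<rho>\<close> and \<open>2 * \<rho>\<close>, so that the majorant is the
  difference quotient at \<open>\<rho>\<close> and \<open>3 * \<rho>\<close>; this is where the bound \<open>R / 3\<close> comes from. Part (2e) is the second
  formula of (2b) evaluated at \<open>h = 1\<close>.
\<close>

section \<open>The Banach algebra of bounded operators\<close>

lemma bounded_bilinear_scaleC:
  "bounded_bilinear (scaleC :: complex \<Rightarrow> 'a::complex_normed_space \<Rightarrow> 'a)"
proof (rule bounded_bilinear.intro)
  show "\<exists>K. \<forall>a (b::'a). norm (a *\<^sub>C b) \<le> norm a * norm b * K"
    by (rule exI[of _ 1]) (simp add: norm_scaleC)
  show "(r *\<^sub>R a) *\<^sub>C b = r *\<^sub>R (a *\<^sub>C b)" for r a and b :: 'a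
    by (simp add: scaleR_conv_of_real scaleC_scaleC[symmetric] scaleC_of_real)
qed (simp_all add: scaleC_add_left scaleC_add_right scaleC_scaleR)

interpretation scaleC: bounded_bilinear "scaleC :: complex \<Rightarrow> 'a::complex_normed_space \<Rightarrow> 'a"
  by (rule bounded_bilinear_scaleC)

declare scaleC.zero_left [simp] scaleC.zero_right [simp]

lemma bop_apply_linear:
  "bop_apply (S - T) x = bop_apply S x - bop_apply T x"
  "bop_apply (r *\<^sub>R S) x = r *\<^sub>R bop_apply S x"
  "bop_apply S (x + y) = bop_apply S x + bop_apply S y"
  unfolding minus_bop_def
  by (transfer; simp add: blinfun.add_left blinfun.add_right blinfun.minus_left blinfun.scaleR_left
      plus_blinfun.rep_eq)+

lemma norm_bop_apply_le: "norm (bop_apply S x) \<le> norm S * norm x"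
  by transfer (rule norm_blinfun)

lemma norm_bop_leI:
  assumes "0 \<le> b" "\<And>x. norm (bop_apply S x) \<le> b * norm x"
  shows "norm S \<le> b"
  using assms by transfer (rule norm_blinfun_bound)

lemma bounded_bilinear_bop_apply:
  "bounded_bilinear (bop_apply :: 'a::complex_normed_space bop \<Rightarrow> 'a \<Rightarrow> 'a)"
proof (rule bounded_bilinear.intro)
  show "\<exists>K. \<forall>(a::'a bop) b. norm (bop_apply a b) \<le> norm a * norm b * K"
    by (rule exI[of _ 1]) (simp add: norm_bop_apply_le)
  show "bop_apply a (r *\<^sub>R b) = r *\<^sub>R bop_apply a b" for a :: "'a bop" and r b
    using bop_apply_simps(5)[of a "of_real r" b] by (simp add: scaleC_of_real)
qed (simp_all add: bop_apply_simps bop_apply_linear)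

interpretation bop_apply: bounded_bilinear "bop_apply :: 'a::complex_normed_space bop \<Rightarrow> 'a \<Rightarrow> 'a"
  by (rule bounded_bilinear_bop_apply)

lemma scaleC_mult_left: "(c *\<^sub>C S) * T = c *\<^sub>C (S * T)" for S :: "'a::complex_normed_space bop"
  by (rule bop_eqI) (simp add: bop_apply_simps)

lemma scaleC_mult_right: "S * (c *\<^sub>C T) = c *\<^sub>C (S * T)" for S :: "'a::complex_normed_space bop"
  by (rule bop_eqI) (simp add: bop_apply_simps)

lemma norm_one_bop_le: "norm (1 :: 'a::complex_normed_space bop) \<le> 1"
  by (rule norm_bop_leI) (simp_all add: bop_apply_simps)

lemma norm_power_bop_le: "norm (T ^ n) \<le> norm T ^ n" for T :: "'a::complex_normed_space bop"
proof (induction n)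
  case 0
  then show ?case by (simp add: norm_one_bop_le)
next
  case (Suc n)
  have "norm (T ^ Suc n) \<le> norm T * norm (T ^ n)"
    by (simp add: norm_mult_ineq)
  also have "\<dots> \<le> norm T * norm T ^ n"
    by (intro mult_left_mono Suc) simp
  finally show ?case by simp
qed

lemma norm_power_bop_le': "norm T \<le> \<rho> \<Longrightarrow> norm (T ^ n) \<le> \<rho> ^ n" for T :: "'a::complex_normed_space bop"
  by (rule order_trans[OF norm_power_bop_le power_mono]) auto

lemma bop_inverse_eqI:
  assumes "S * V = 1" "V * S = 1"
  shows "bop_inverse S = V"
  unfolding bop_inverse_def
proof (rule the_equality)
  show "S * V = 1 \<and> V * S = 1" using assms by simp
  fix W assume W: "S * W = 1 \<and> W * S = 1"
  have "W = (V * S) * W" using assms by simp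
  also have "\<dots> = V" using W by (simp add: mult.assoc)
  finally show "W = V" .
qed

text \<open>The Neumann series \<open>\<Sum>n. A ^ n\<close> is the inverse of \<open>1 - A\<close>.\<close>

lemma bop_invertible_one_minus:
  fixes A :: "'a::complex_banach bop"
  assumes "norm A < 1"
  shows "bop_invertible (1 - A)"
proof -
  define V where "V = (\<Sum>n. A ^ n)"
  have "summable (\<lambda>n. A ^ n)"
    by (rule summable_comparison_test[of _ "\<lambda>n. norm A ^ n"])
      (use assms norm_power_bop_le in \<open>auto simp: summable_geometric\<close>)
  then have lim: "(\<lambda>n. \<Sum>i<n. A ^ i) \<longlonglongrightarrow> V"
    unfolding V_def by (rule summable_LIMSEQ)
  have pow0: "(\<lambda>n. A ^ n) \<longlonglongrightarrow> 0"
    by (rule Lim_null_comparison[of _ "\<lambda>n. norm A ^ n"])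
      (use assms norm_power_bop_le in \<open>auto intro!: LIMSEQ_realpow_zero always_eventually\<close>)
  then have to1: "(\<lambda>n. 1 - A ^ n) \<longlonglongrightarrow> 1"
    using tendsto_diff[OF tendsto_const[of 1]] by fastforce
  have "(1 - A) * (\<Sum>i<n. A ^ i) = 1 - A ^ n" for n
  proof (induction n)
    case (Suc n)
    have "(1 - A) * (\<Sum>i<Suc n. A ^ i) = (1 - A) * (\<Sum>i<n. A ^ i) + (1 - A) * A ^ n"
      by (simp only: sum.lessThan_Suc distrib_left)
    also have "\<dots> = (1 - A ^ n) + (A ^ n - A * A ^ n)"
      unfolding Suc by (simp add: left_diff_distrib)
    finally show ?case by (simp del: sum.lessThan_Suc)
  qed simp
  then have "(\<lambda>n. (1 - A) * (\<Sum>i<n. A ^ i)) \<longlonglongrightarrow> 1"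
    using to1 by simp
  moreover have "(\<lambda>n. (1 - A) * (\<Sum>i<n. A ^ i)) \<longlonglongrightarrow> (1 - A) * V"
    by (intro tendsto_intros lim)
  ultimately have l: "(1 - A) * V = 1"
    by (rule LIMSEQ_unique[symmetric])
  have "(\<Sum>i<n. A ^ i) * (1 - A) = 1 - A ^ n" for n
  proof (induction n)
    case (Suc n)
    have "(\<Sum>i<Suc n. A ^ i) * (1 - A) = (\<Sum>i<n. A ^ i) * (1 - A) + A ^ n * (1 - A)"
      by (simp only: sum.lessThan_Suc distrib_right)
    also have "\<dots> = (1 - A ^ n) + (A ^ n - A ^ n * A)"
      unfolding Suc by (simp add: right_diff_distrib)
    finally show ?case by (simp add: power_commutes del: sum.lessThan_Suc)
  qed simp
  then have "(\<lambda>n. (\<Sum>i<n. A ^ i) * (1 - A)) \<longlonglongrightarrow> 1"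
    using to1 by simp
  moreover have "(\<lambda>n. (\<Sum>i<n. A ^ i) * (1 - A)) \<longlonglongrightarrow> V * (1 - A)"
    by (intro tendsto_intros lim)
  ultimately have "V * (1 - A) = 1"
    by (rule LIMSEQ_unique[symmetric])
  with l show ?thesis
    unfolding bop_invertible_def by blast
qed

lemma bop_invertible_mult:
  assumes "bop_invertible S" "bop_invertible T"
  shows "bop_invertible (S * T)"
proof -
  obtain V W where V: "S * V = 1" "V * S = 1" and W: "T * W = 1" "W * T = 1"
    using assms unfolding bop_invertible_def by blast
  have "(S * T) * (W * V) = S * (T * W) * V" "(W * V) * (S * T) = W * (V * S) * T"
    by (simp_all only: mult.assoc)
  then show ?thesis
    unfolding bop_invertible_def by (intro exI[of _ "W * V"]) (simp add: V W)
qed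

lemma bop_invertible_scaleC:
  assumes "c \<noteq> 0" "bop_invertible S"
  shows "bop_invertible (c *\<^sub>C S)"
proof -
  obtain V where "S * V = 1" "V * S = 1"
    using assms unfolding bop_invertible_def by blast
  then show ?thesis
    unfolding bop_invertible_def using assms
    by (intro exI[of _ "inverse c *\<^sub>C V"])
      (simp add: scaleC_mult_left scaleC_mult_right scaleC_scaleC scaleC_one)
qed


section \<open>Spectrum and resolvent\<close>

definition resolvent :: "'a::complex_normed_space bop \<Rightarrow> complex \<Rightarrow> 'a bop" where
  "resolvent T z = bop_inverse (z *\<^sub>C 1 - T)"

lemma resolvent_inverse:
  assumes "z \<notin> spectrum T"
  shows "(z *\<^sub>C 1 - T) * resolvent T z = 1" "resolvent T z * (z *\<^sub>C 1 - T) = 1"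
proof -
  obtain V where "(z *\<^sub>C 1 - T) * V = 1" "V * (z *\<^sub>C 1 - T) = 1"
    using assms unfolding spectrum_def bop_invertible_def by blast
  then show "(z *\<^sub>C 1 - T) * resolvent T z = 1" "resolvent T z * (z *\<^sub>C 1 - T) = 1"
    unfolding resolvent_def by (simp_all add: bop_inverse_eqI)
qed

lemma spectrum_bounded:
  fixes T :: "'a::complex_banach bop"
  assumes "z \<in> spectrum T"
  shows "cmod z \<le> norm T"
proof (rule ccontr)
  assume "\<not> cmod z \<le> norm T"
  then have z: "cmod z > norm T" "z \<noteq> 0"
    using norm_ge_zero[of T] by (auto simp del: norm_ge_zero)
  have "bop_invertible (1 - inverse z *\<^sub>C T)"
    by (rule bop_invertible_one_minus) (use z in \<open>simp add: norm_scaleC norm_inverse norm_divide field_simps\<close>)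
  then have "bop_invertible (z *\<^sub>C (1 - inverse z *\<^sub>C T))"
    by (rule bop_invertible_scaleC[OF z(2)])
  also have "z *\<^sub>C (1 - inverse z *\<^sub>C T) = z *\<^sub>C 1 - T"
    using z(2) by (simp add: scaleC.diff_right scaleC_scaleC scaleC_one)
  finally show False using assms unfolding spectrum_def by simp
qed

lemma open_resolvent_set:
  fixes T :: "'a::complex_banach bop"
  shows "open (- spectrum T)"
  unfolding open_dist
proof
  fix z assume "z \<in> - spectrum T"
  then have z: "z \<notin> spectrum T" by simp
  define V where "V = resolvent T z"
  define e where "e = inverse (norm V + 1)"
  have "w \<in> - spectrum T" if "dist w z < e" for w
  proof -
    have "cmod (w - z) * norm V \<le> cmod (w - z) * (norm V + 1)"
      by (simp add: mult_left_mono)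
    also have "\<dots> < 1"
      using that unfolding e_def dist_norm
      by (simp add: inverse_eq_divide pos_less_divide_eq add_nonneg_pos)
    finally have "norm (- ((w - z) *\<^sub>C V)) < 1"
      by (simp add: norm_scaleC)
    then have "bop_invertible (1 - - ((w - z) *\<^sub>C V))"
      by (rule bop_invertible_one_minus)
    moreover have "bop_invertible (z *\<^sub>C 1 - T)"
      using z unfolding spectrum_def by simp
    ultimately have "bop_invertible ((z *\<^sub>C 1 - T) * (1 - - ((w - z) *\<^sub>C V)))"
      by (intro bop_invertible_mult)
    also have "(z *\<^sub>C 1 - T) * (1 - - ((w - z) *\<^sub>C V)) = w *\<^sub>C 1 - T"
    proof -
      have "(z *\<^sub>C 1 - T) * (1 - - ((w - z) *\<^sub>C V)) = (z *\<^sub>C 1 - T) + (w - z) *\<^sub>C 1"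
        using resolvent_inverse(1)[OF z]
        by (simp add: distrib_left scaleC_mult_right V_def del: diff_minus_eq_add add: diff_minus_eq_add[symmetric] right_diff_distrib)
      then show ?thesis by (simp add: scaleC.diff_left)
    qed
    finally show ?thesis unfolding spectrum_def by simp
  qed
  moreover have "e > 0"
    unfolding e_def by (simp add: add_nonneg_pos)
  ultimately show "\<exists>e>0. \<forall>w. dist w z < e \<longrightarrow> w \<in> - spectrum T"
    by blast
qed

lemma compact_spectrum: "compact (spectrum T)" for T :: "'a::complex_banach bop"
proof -
  have "spectrum T \<subseteq> cball 0 (norm T)"
    using spectrum_bounded[of _ T] by auto
  moreover have "closed (spectrum T)"
    using open_resolvent_set[of T] by (simp add: closed_def)
  ultimately show ?thesis
    using bounded_subset[OF bounded_cball] compact_eq_bounded_closed by blast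
qed

lemma resolvent_identity:
  assumes "z \<notin> spectrum T" "w \<notin> spectrum T"
  shows "resolvent T w - resolvent T z = (w - z) *\<^sub>C (- (resolvent T w * resolvent T z))"
proof -
  let ?R = "resolvent T"
  have "(z - w) *\<^sub>C (?R w * ?R z) = ?R w * (((z *\<^sub>C 1 - T) - (w *\<^sub>C 1 - T)) * ?R z)"
    by (simp add: scaleC.diff_left[symmetric] scaleC_mult_left scaleC_mult_right)
  also have "\<dots> = ?R w * ((z *\<^sub>C 1 - T) * ?R z) - (?R w * (w *\<^sub>C 1 - T)) * ?R z"
    by (simp only: left_diff_distrib right_diff_distrib mult.assoc)
  also have "\<dots> = ?R w - ?R z"
    using assms by (simp add: resolvent_inverse)
  finally show ?thesis
    by (simp add: scaleC.minus_right scaleC.diff_left)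
qed

lemma isCont_resolvent:
  fixes T :: "'a::complex_banach bop"
  assumes z: "z \<notin> spectrum T"
  shows "isCont (resolvent T) z"
proof -
  let ?R = "resolvent T"
  have est: "norm (?R w - ?R z) \<le> 2 * cmod (w - z) * norm (?R z) ^ 2"
    if w: "w \<notin> spectrum T" and small: "cmod (w - z) * norm (?R z) \<le> 1 / 2" for w
  proof -
    have "norm (?R w - ?R z) = cmod (w - z) * norm (?R w * ?R z)"
      by (simp add: resolvent_identity[OF z w] norm_scaleC)
    also have "\<dots> \<le> cmod (w - z) * (norm (?R w) * norm (?R z))"
      by (intro mult_left_mono norm_mult_ineq) simp
    finally have 1: "norm (?R w - ?R z) \<le> (cmod (w - z) * norm (?R z)) * norm (?R w)"
      by (simp add: mult_ac)
    also have "\<dots> \<le> 1 / 2 * norm (?R w)"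
      by (rule mult_right_mono[OF small]) simp
    finally have "norm (?R w - ?R z) \<le> norm (?R w) / 2" by simp
    then have "norm (?R w) \<le> 2 * norm (?R z)"
      using norm_triangle_sub[of "?R w" "?R z"] by simp
    then have "(cmod (w - z) * norm (?R z)) * norm (?R w)
        \<le> (cmod (w - z) * norm (?R z)) * (2 * norm (?R z))"
      by (rule mult_left_mono) simp
    with 1 show ?thesis by (simp add: power2_eq_square mult_ac)
  qed
  have "\<forall>\<^sub>F w in at z. w \<in> - spectrum T"
    using open_resolvent_set z by (intro eventually_at_in_open') auto
  moreover have "((\<lambda>w. cmod (w - z) * norm (?R z)) \<longlongrightarrow> cmod (z - z) * norm (?R z)) (at z)"
    by (intro tendsto_intros)
  then have "\<forall>\<^sub>F w in at z. cmod (w - z) * norm (?R z) < 1 / 2"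
    by (rule order_tendstoD) simp
  ultimately have ev: "\<forall>\<^sub>F w in at z. norm (?R w - ?R z) \<le> 2 * cmod (w - z) * norm (?R z) ^ 2"
    by eventually_elim (simp add: est)
  have "((\<lambda>w. 2 * cmod (w - z) * norm (?R z) ^ 2) \<longlongrightarrow> 2 * cmod (z - z) * norm (?R z) ^ 2) (at z)"
    by (intro tendsto_intros)
  then have "((\<lambda>w. ?R w - ?R z) \<longlongrightarrow> 0) (at z)"
    using Lim_null_comparison[OF ev] by simp
  then show ?thesis
    by (simp add: isCont_def LIM_zero_iff)
qed

lemma continuous_on_resolvent:
  fixes T :: "'a::complex_banach bop"
  assumes "A \<inter> spectrum T = {}"
  shows "continuous_on A (resolvent T)"
proof (rule continuous_at_imp_continuous_on, rule ballI)
  fix z assume "z \<in> A"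
  with assms show "isCont (resolvent T) z" by (intro isCont_resolvent) auto
qed

lemma norm_resolvent_le:
  fixes T :: "'a::complex_banach bop"
  assumes "cmod z > norm T"
  shows "norm (resolvent T z) \<le> 1 / (cmod z - norm T)"
proof -
  have "z \<notin> spectrum T"
    using spectrum_bounded assms by fastforce
  then have eq: "z *\<^sub>C resolvent T z = 1 + T * resolvent T z"
    using resolvent_inverse(1)[of z T] by (simp add: left_diff_distrib scaleC_mult_left diff_eq_eq)
  have "cmod z * norm (resolvent T z) = norm (1 + T * resolvent T z)"
    by (simp add: norm_scaleC eq[symmetric])
  also have "\<dots> \<le> 1 + norm T * norm (resolvent T z)"
    by (intro norm_triangle_le add_mono norm_one_bop_le norm_mult_ineq)
  finally show ?thesis
    using assms by (simp add: field_simps)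
qed

text \<open>
  Complex differentiability at \<open>z\<close> in Caratheodory's form: the difference quotient extends
  continuously to \<open>z\<close>.
\<close>

lemma has_derivative_scaleC_Caratheodory:
  fixes f :: "complex \<Rightarrow> 'a::complex_normed_space"
  assumes "open V" "z \<in> V" "\<And>w. w \<in> V \<Longrightarrow> f w - f z = (w - z) *\<^sub>C \<phi> w" "isCont \<phi> z"
  shows "(f has_derivative (\<lambda>h. h *\<^sub>C \<phi> z)) (at z)"
proof -
  have "((\<lambda>w. (1 / norm (w - z)) *\<^sub>R (f w - (f z + (w - z) *\<^sub>C \<phi> z))) \<longlongrightarrow> 0) (at z)"
  proof (rule Lim_null_comparison)
    show "\<forall>\<^sub>F w in at z. norm ((1 / norm (w - z)) *\<^sub>R (f w - (f z + (w - z) *\<^sub>C \<phi> z)))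
        \<le> norm (\<phi> w - \<phi> z)"
      using eventually_at_in_open[OF assms(1,2)]
    proof eventually_elim
      case (elim w)
      then have "f w - (f z + (w - z) *\<^sub>C \<phi> z) = (w - z) *\<^sub>C (\<phi> w - \<phi> z)"
        using assms(3)[of w] by (simp add: scaleC.diff_right algebra_simps)
      then show ?case
        using elim by (simp add: norm_scaleC)
    qed
    show "((\<lambda>w. norm (\<phi> w - \<phi> z)) \<longlongrightarrow> 0) (at z)"
      using assms(4) by (simp add: isCont_def LIM_zero_iff tendsto_norm_zero_iff)
  qed
  then show ?thesis
    unfolding has_derivative_at_within by (auto simp: scaleC.bounded_linear_left inverse_eq_divide diff_diff_eq)
qed

section \<open>Line integrals along rectifiable paths\<close>

text \<open>
  The increment of \<open>\<gamma>\<close> over an interval. The empty set gets increment \<open>0\<close>, so that empty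
  intersections contribute nothing when two partitions are intersected.
\<close>

definition path_increment :: "(real \<Rightarrow> complex) \<Rightarrow> real set \<Rightarrow> complex" where
  "path_increment \<gamma> K = (if K = {} then 0 else \<gamma> (Sup K) - \<gamma> (Inf K))"

definition variation_le :: "(real \<Rightarrow> complex) \<Rightarrow> real \<Rightarrow> bool" where
  "variation_le \<gamma> V \<longleftrightarrow> 0 \<le> V \<and> (\<forall>P. P division_of {0..1} \<longrightarrow> (\<Sum>K\<in>P. cmod (path_increment \<gamma> K)) \<le> V)"

definition line_sum ::
    "(complex \<Rightarrow> 'a::complex_normed_space) \<Rightarrow> (real \<Rightarrow> complex) \<Rightarrow> (real \<times> real set) set \<Rightarrow> 'a" where
  "line_sum f \<gamma> p = (\<Sum>(t, K)\<in>p. path_increment \<gamma> K *\<^sub>C f (\<gamma> t))"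

lemma path_increment_interval:
  "path_increment \<gamma> {a..b} = (if a \<le> b then \<gamma> b - \<gamma> a else 0)"
  by (simp add: path_increment_def)

lemma path_increment_degenerate:
  assumes "box u v = {}"
  shows "path_increment \<gamma> (K \<inter> cbox u v) = 0"
proof -
  have "cbox u v = {} \<or> cbox u v = {u}"
    using assms by (auto simp: box_eq_empty)
  then have "K \<inter> cbox u v = {} \<or> K \<inter> cbox u v = {u}"
    by auto
  then show ?thesis by (auto simp: path_increment_def)
qed

lemma path_increment_interior_empty:
  assumes "K = {a..b} \<or> K = {}" "interior K = {}"
  shows "path_increment \<gamma> K = 0"
  using assms by (cases a b rule: linorder_cases)
    (auto simp: path_increment_def interior_atLeastAtMost_real)

lemma rectifiable_pathD:
  assumes "rectifiable_path \<gamma>"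
  obtains V where "variation_le \<gamma> V"
proof -
  obtain V where V: "\<And>P. P division_of {0..1} \<Longrightarrow> (\<Sum>K\<in>P. dist (\<gamma> (Inf K)) (\<gamma> (Sup K))) \<le> V"
    using assms unfolding rectifiable_path_def bdd_above_def by auto
  have "(\<Sum>K\<in>P. cmod (path_increment \<gamma> K)) \<le> max V 0" if "P division_of {0..1}" for P
  proof -
    have "(\<Sum>K\<in>P. cmod (path_increment \<gamma> K)) = (\<Sum>K\<in>P. dist (\<gamma> (Inf K)) (\<gamma> (Sup K)))"
      using division_ofD(3)[OF that]
      by (intro sum.cong) (auto simp: path_increment_def dist_norm norm_minus_commute)
    with V[OF that] show ?thesis by simp
  qed
  then show ?thesis
    by (intro that[of "max V 0"]) (simp add: variation_le_def)
qed

lemma tagged_division_cell: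
  assumes "p tagged_division_of {0..1}" "(t, K) \<in> p"
  obtains a b where "K = {a..b}" "0 \<le> a" "a \<le> t" "t \<le> b" "b \<le> (1::real)"
proof -
  obtain a b where K: "K = {a..b}"
    using tagged_division_ofD(4)[OF assms] by auto
  moreover have "t \<in> K" "K \<subseteq> {0..1}"
    using tagged_division_ofD(2,3)[OF assms] by auto
  ultimately show ?thesis
    by (intro that[of a b]) auto
qed

lemma variation_le_tagged:
  assumes "variation_le \<gamma> V" "p tagged_division_of {0..1}"
  shows "(\<Sum>(t, K)\<in>p. cmod (path_increment \<gamma> K)) \<le> V"
proof -
  have "(\<Sum>(t, K)\<in>p. cmod (path_increment \<gamma> K)) = (\<Sum>K\<in>snd ` p. cmod (path_increment \<gamma> K))"
    by (rule sum.over_tagged_division_lemma[OF assms(2)])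
      (use path_increment_degenerate[of _ _ _ UNIV] in simp)
  also have "\<dots> \<le> V"
    using assms division_of_tagged_division unfolding variation_le_def by blast
  finally show ?thesis .
qed

text \<open>The increment over \<open>{u..v} \<inter> L\<close> is additive in the interval \<open>L\<close>.\<close>

lemma path_increment_refine:
  assumes p: "p tagged_division_of {0..1}" and uv: "0 \<le> u" "u \<le> v" "v \<le> 1"
  shows "(\<Sum>(t, L)\<in>p. path_increment \<gamma> ({u..v} \<inter> L)) = \<gamma> v - \<gamma> u"
proof -
  have neutral: "path_increment \<gamma> {max u a..min v b} = 0" if "b \<le> a" for a b
  proof -
    have "max u a = min v b" if "max u a \<le> min v b"
      using that \<open>b \<le> a\<close> by linarith
    then show ?thesis by (simp add: path_increment_interval)
  qed
  have coalesce: "path_increment \<gamma> {max u a..min v c} + path_increment \<gamma> {max u c..min v b} =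
      path_increment \<gamma> {max u a..min v b}" if "a < c" "c < b" for a b c
    using that uv by (auto simp: path_increment_interval max_def min_def)
  interpret operative_real plus 0 "\<lambda>L. path_increment \<gamma> ({u..v} \<inter> L)"
    rewrites "comm_monoid_set.F (+) 0 = sum"
    by standard[1] (simp_all add: sum_def neutral coalesce)
  have "(\<Sum>(t, L)\<in>p. path_increment \<gamma> ({u..v} \<inter> L)) = path_increment \<gamma> ({u..v} \<inter> cbox 0 1)"
    using tagged_division[of p 0 1] p by (simp only: box_real)
  also have "{u..v} \<inter> cbox 0 1 = {u..v}"
    using uv by auto
  finally show ?thesis using uv by (simp add: path_increment_interval)
qed

text \<open>
  The intersections of the cells of two partitions form a partition again. A set that arises as an
  intersection in two ways has empty interior, so that its increment vanishes and counting it twice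
  does no harm.
\<close>

lemma variation_le_refine:
  assumes V: "variation_le \<gamma> V" and p: "p tagged_division_of {0..1}" and q: "q tagged_division_of {0..1}"
  shows "(\<Sum>(t, K)\<in>p. \<Sum>(s, L)\<in>q. cmod (path_increment \<gamma> (K \<inter> L))) \<le> V"
proof -
  define P where "P = snd ` p"
  define Q where "Q = snd ` q"
  define g where "g K = cmod (path_increment \<gamma> K)" for K
  note dP = division_of_tagged_division[OF p, folded P_def]
  note dQ = division_of_tagged_division[OF q, folded Q_def]
  have fin: "finite P" "finite Q"
    using dP dQ by auto
  have deg: "g (K \<inter> cbox u v) = 0" if "box u v = {}" for K u v
    using path_increment_degenerate[OF that] by (simp add: g_def)
  have "(\<Sum>(t, K)\<in>p. \<Sum>(s, L)\<in>q. g (K \<inter> L)) = (\<Sum>(t, K)\<in>p. \<Sum>L\<in>Q. g (K \<inter> L))"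
    unfolding Q_def using sum.over_tagged_division_lemma[OF q, of "\<lambda>L. g (_ \<inter> L)"] deg
    by (intro sum.cong) auto
  also have "\<dots> = (\<Sum>K\<in>P. \<Sum>L\<in>Q. g (K \<inter> L))"
    unfolding P_def
    by (rule sum.over_tagged_division_lemma[OF p]) (use deg in \<open>simp add: Int_commute\<close>)
  also have "\<dots> = (\<Sum>x\<in>P \<times> Q. g (fst x \<inter> snd x))"
    by (simp add: sum.cartesian_product case_prod_unfold)
  also have "\<dots> = (\<Sum>K\<in>(\<lambda>x. fst x \<inter> snd x) ` (P \<times> Q). g K)"
  proof (rule sum.reindex_nontrivial[symmetric, unfolded o_def])
    fix x y assume xy: "x \<in> P \<times> Q" "y \<in> P \<times> Q" "x \<noteq> y" "fst x \<inter> snd x = fst y \<inter> snd y"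
    have "interior (fst x) \<inter> interior (fst y) = {} \<or> interior (snd x) \<inter> interior (snd y) = {}"
      using xy division_ofD(5)[OF dP] division_ofD(5)[OF dQ]
      by (metis mem_Times_iff prod_eq_iff)
    moreover have "interior (fst x \<inter> snd x)
        \<subseteq> interior (fst x) \<inter> interior (fst y) \<inter> (interior (snd x) \<inter> interior (snd y))"
      using xy(4) interior_Int[of "fst x" "snd x"] interior_Int[of "fst y" "snd y"] by auto
    ultimately have "interior (fst x \<inter> snd x) = {}"
      by auto
    moreover obtain a b c d where "fst x = {a..b}" "snd x = {c..d}"
      using xy(1) division_ofD(4)[OF dP] division_ofD(4)[OF dQ] by (metis box_real(2) mem_Times_iff)
    ultimately show "g (fst x \<inter> snd x) = 0"
      unfolding g_def by (intro norm_eq_zero[THEN iffD2] path_increment_interior_empty) auto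
  qed (use fin in auto)
  also have "\<dots> = (\<Sum>K\<in>{K \<inter> L |K L. K \<in> P \<and> L \<in> Q \<and> K \<inter> L \<noteq> {}}. g K)"
  proof (rule sum.mono_neutral_right)
    show "{K \<inter> L |K L. K \<in> P \<and> L \<in> Q \<and> K \<inter> L \<noteq> {}} \<subseteq> (\<lambda>x. fst x \<inter> snd x) ` (P \<times> Q)"
      by force
    show "\<forall>K\<in>(\<lambda>x. fst x \<inter> snd x) ` (P \<times> Q) - {K \<inter> L |K L. K \<in> P \<and> L \<in> Q \<and> K \<inter> L \<noteq> {}}. g K = 0"
    proof
      fix K assume K: "K \<in> (\<lambda>x. fst x \<inter> snd x) ` (P \<times> Q) - {K \<inter> L |K L. K \<in> P \<and> L \<in> Q \<and> K \<inter> L \<noteq> {}}"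
      then obtain A B where "A \<in> P" "B \<in> Q" "K = A \<inter> B" by auto
      with K have "K = {}" by blast
      then show "g K = 0" by (simp add: g_def path_increment_def)
    qed
  qed (use fin in auto)
  also have "\<dots> \<le> V"
    using V division_inter[OF dP dQ] unfolding variation_le_def g_def by auto
  finally show ?thesis unfolding g_def .
qed

lemma has_line_integral_line_sum:
  "has_line_integral f I \<gamma> \<longleftrightarrow>
     (\<forall>e>0. \<exists>d>0. \<forall>p. p tagged_division_of {0..1} \<and> (\<lambda>t. ball t d) fine p \<longrightarrow>
        norm (line_sum f \<gamma> p - I) < e)"
proof -
  have "(\<Sum>(t, K)\<in>p. (\<gamma> (Sup K) - \<gamma> (Inf K)) *\<^sub>C f (\<gamma> t)) = line_sum f \<gamma> p"
    if p: "p tagged_division_of {0..1}" for p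
  proof -
    have "K \<noteq> {}" if "(t, K) \<in> p" for t K
      using tagged_division_ofD(2)[OF p that] by auto
    then show ?thesis
      unfolding line_sum_def by (intro sum.cong refl) (auto simp: path_increment_def split: if_splits)
  qed
  then show ?thesis unfolding has_line_integral_def by simp
qed

lemma fine_tagged_division_exists:
  assumes "d > 0"
  obtains p where "p tagged_division_of {0..1::real}" "(\<lambda>t. ball t d) fine p"
proof -
  have "gauge (\<lambda>t::real. ball t d)"
    using assms by (simp add: gauge_def)
  then show ?thesis by (rule fine_division_exists_real) (rule that)
qed

lemma fine_ball_mono:
  assumes "(\<lambda>t. ball t d) fine p" "d \<le> e"
  shows "(\<lambda>t. ball t e) fine p"
proof (rule fineI)
  fix t K assume "(t, K) \<in> p"
  then show "K \<subseteq> ball t e"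
    using order_trans[OF fineD[OF assms(1)] subset_ball[OF assms(2)]] by simp
qed

lemma has_line_integral_unique:
  assumes "has_line_integral f I \<gamma>" "has_line_integral f J \<gamma>"
  shows "I = J"
proof (rule ccontr)
  assume "I \<noteq> J"
  then have e: "norm (I - J) / 2 > 0" by simp
  obtain d1 where d1: "d1 > 0" "\<And>p. p tagged_division_of {0..1} \<Longrightarrow> (\<lambda>t. ball t d1) fine p \<Longrightarrow>
      norm (line_sum f \<gamma> p - I) < norm (I - J) / 2"
    using assms(1) e unfolding has_line_integral_line_sum by meson
  obtain d2 where d2: "d2 > 0" "\<And>p. p tagged_division_of {0..1} \<Longrightarrow> (\<lambda>t. ball t d2) fine p \<Longrightarrow>
      norm (line_sum f \<gamma> p - J) < norm (I - J) / 2"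
    using assms(2) e unfolding has_line_integral_line_sum by meson
  obtain p where p: "p tagged_division_of {0..1::real}" "(\<lambda>t. ball t (min d1 d2)) fine p"
    using fine_tagged_division_exists[of "min d1 d2"] d1 d2 by auto
  have "norm (line_sum f \<gamma> p - I) < norm (I - J) / 2" "norm (line_sum f \<gamma> p - J) < norm (I - J) / 2"
    using d1(2)[OF p(1) fine_ball_mono[OF p(2) min.cobounded1]]
      d2(2)[OF p(1) fine_ball_mono[OF p(2) min.cobounded2]] by auto
  then have "norm (I - J) < norm (I - J)"
    using norm_triangle_ineq4[of "line_sum f \<gamma> p - J" "line_sum f \<gamma> p - I"] by simp
  then show False by simp
qed

lemma line_integral_eqI:
  assumes "has_line_integral f I \<gamma>"
  shows "line_integral \<gamma> f = I"
  unfolding line_integral_def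
proof (rule the_equality)
  show "J = I" if "has_line_integral f J \<gamma>" for J
    by (rule has_line_integral_unique[OF that assms])
qed (rule assms)

text \<open>
  Sums over two fine partitions are compared on the common refinement, where tags of
  overlapping intervals are close to each other.
\<close>

lemma line_sum_Cauchy:
  fixes f :: "complex \<Rightarrow> 'a::complex_normed_space"
  assumes V: "variation_le \<gamma> V" and cont: "continuous_on {0..1} (f \<circ> \<gamma>)" and e: "e > 0"
  shows "\<exists>d>0. \<forall>p q. p tagged_division_of {0..1} \<and> (\<lambda>t. ball t d) fine p \<and>
       q tagged_division_of {0..1} \<and> (\<lambda>t. ball t d) fine q \<longrightarrow>
       norm (line_sum f \<gamma> p - line_sum f \<gamma> q) \<le> e * V"
proof -
  have "uniformly_continuous_on {0..1} (f \<circ> \<gamma>)"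
    using cont by (intro compact_uniformly_continuous) auto
  then obtain d where d: "d > 0" "\<And>s t. s \<in> {0..1} \<Longrightarrow> t \<in> {0..1} \<Longrightarrow> dist s t < d \<Longrightarrow>
      dist (f (\<gamma> s)) (f (\<gamma> t)) < e"
    using e unfolding uniformly_continuous_on_def o_def by meson
  show ?thesis
  proof (intro exI[of _ "d / 2"] conjI allI impI)
    fix p q :: "(real \<times> real set) set"
    assume "p tagged_division_of {0..1} \<and> (\<lambda>t. ball t (d / 2)) fine p \<and>
       q tagged_division_of {0..1} \<and> (\<lambda>t. ball t (d / 2)) fine q"
    then have p: "p tagged_division_of {0..1}" "(\<lambda>t. ball t (d / 2)) fine p"
      and q: "q tagged_division_of {0..1}" "(\<lambda>t. ball t (d / 2)) fine q"
      by simp_all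
    have expand: "line_sum f \<gamma> p' = (\<Sum>(t, K)\<in>p'. \<Sum>(s, L)\<in>q'. path_increment \<gamma> (K \<inter> L) *\<^sub>C f (\<gamma> t))"
      if p': "p' tagged_division_of {0..1}" and q': "q' tagged_division_of {0..1}" for p' q'
    proof -
      have "path_increment \<gamma> K = (\<Sum>(s, L)\<in>q'. path_increment \<gamma> (K \<inter> L))" if tK: "(t, K) \<in> p'" for t K
      proof -
        obtain a b where "K = {a..b}" "0 \<le> a" "a \<le> t" "t \<le> b" "b \<le> 1"
          using tagged_division_cell[OF p' tK] .
        then show ?thesis
          using path_increment_refine[OF q', of a b \<gamma>] by (simp add: path_increment_interval)
      qed
      then show ?thesis
        unfolding line_sum_def
        by (intro sum.cong refl) (auto simp: scaleC.sum_left case_prod_unfold)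
    qed
    have swap: "line_sum f \<gamma> q = (\<Sum>(t, K)\<in>p. \<Sum>(s, L)\<in>q. path_increment \<gamma> (K \<inter> L) *\<^sub>C f (\<gamma> s))"
      unfolding expand[OF q(1) p(1)] case_prod_unfold
      by (subst sum.swap) (simp add: Int_commute)
    have "line_sum f \<gamma> p - line_sum f \<gamma> q =
        (\<Sum>(t, K)\<in>p. \<Sum>(s, L)\<in>q. path_increment \<gamma> (K \<inter> L) *\<^sub>C (f (\<gamma> t) - f (\<gamma> s)))"
      unfolding swap expand[OF p(1) q(1)]
      by (simp add: sum_subtractf[symmetric] case_prod_unfold scaleC.diff_right)
    also have "norm \<dots> \<le> (\<Sum>(t, K)\<in>p. \<Sum>(s, L)\<in>q. e * cmod (path_increment \<gamma> (K \<inter> L)))"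
      unfolding case_prod_unfold
    proof (rule order_trans[OF norm_sum sum_mono], rule order_trans[OF norm_sum sum_mono])
      fix x y assume x: "x \<in> p" and y: "y \<in> q"
      obtain t K s L where xy: "x = (t, K)" "y = (s, L)" by (cases x, cases y)
      show "norm (path_increment \<gamma> (snd x \<inter> snd y) *\<^sub>C (f (\<gamma> (fst x)) - f (\<gamma> (fst y))))
          \<le> e * cmod (path_increment \<gamma> (snd x \<inter> snd y))"
      proof (cases "K \<inter> L = {}")
        case True
        then show ?thesis using xy by (simp add: path_increment_def)
      next
        case False
        then obtain u where "u \<in> K" "u \<in> L" by auto
        moreover have "K \<subseteq> ball t (d / 2)" "L \<subseteq> ball s (d / 2)"
          using p q x y xy unfolding fine_def by auto
        ultimately have "dist t u < d / 2" "dist s u < d / 2" by auto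
        then have "dist t s < d"
          using dist_triangle_half_l by blast
        moreover have "t \<in> {0..1}" "s \<in> {0..1}"
          using tagged_division_ofD(2,3)[OF p(1)] tagged_division_ofD(2,3)[OF q(1)] x y xy by blast+
        ultimately have "norm (f (\<gamma> t) - f (\<gamma> s)) \<le> e"
          using d(2)[of t s] by (simp add: dist_norm)
        then have "cmod (path_increment \<gamma> (K \<inter> L)) * norm (f (\<gamma> t) - f (\<gamma> s))
            \<le> cmod (path_increment \<gamma> (K \<inter> L)) * e"
          by (rule mult_left_mono) simp
        then show ?thesis
          by (simp add: xy norm_scaleC mult.commute)
      qed
    qed
    also have "\<dots> = e * (\<Sum>(t, K)\<in>p. \<Sum>(s, L)\<in>q. cmod (path_increment \<gamma> (K \<inter> L)))"
      by (simp add: sum_distrib_left case_prod_unfold)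
    also have "\<dots> \<le> e * V"
      using variation_le_refine[OF V p(1) q(1)] e by simp
    finally show "norm (line_sum f \<gamma> p - line_sum f \<gamma> q) \<le> e * V" .
  qed (use d(1) in simp)
qed

lemma has_line_integral_exists:
  fixes f :: "complex \<Rightarrow> 'a::complex_banach"
  assumes V: "variation_le \<gamma> V" and \<gamma>: "path \<gamma>" and f: "continuous_on (path_image \<gamma>) f"
  shows "has_line_integral f (line_integral \<gamma> f) \<gamma>"
proof -
  have cont: "continuous_on {0..1} (f \<circ> \<gamma>)"
    using \<gamma> f unfolding path_def path_image_def by (rule continuous_on_compose)
  define W where "W = V + 1"
  have W: "W > 0" "V \<le> W"
    using V by (auto simp: W_def variation_le_def)
  have "\<exists>d>0. \<forall>p q. p tagged_division_of {0..1} \<and> (\<lambda>t. ball t d) fine p \<and>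
       q tagged_division_of {0..1} \<and> (\<lambda>t. ball t d) fine q \<longrightarrow>
       norm (line_sum f \<gamma> p - line_sum f \<gamma> q) < e" if "e > 0" for e
  proof -
    have "e / (2 * W) > 0" using that W by simp
    from line_sum_Cauchy[OF V cont this] obtain d where d: "d > 0"
      "\<forall>p q. p tagged_division_of {0..1} \<and> (\<lambda>t. ball t d) fine p \<and>
       q tagged_division_of {0..1} \<and> (\<lambda>t. ball t d) fine q \<longrightarrow>
       norm (line_sum f \<gamma> p - line_sum f \<gamma> q) \<le> e / (2 * W) * V"
      by (elim exE conjE)
    have "e / (2 * W) * V \<le> e / (2 * W) * W"
      using that W by (intro mult_left_mono) auto
    also have "\<dots> < e" using that W by simp
    finally have less: "e / (2 * W) * V < e" .
    show ?thesis
    proof (intro exI[of _ d] conjI allI impI d(1))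
      fix p q :: "(real \<times> real set) set"
      assume "p tagged_division_of {0..1} \<and> (\<lambda>t. ball t d) fine p \<and>
       q tagged_division_of {0..1} \<and> (\<lambda>t. ball t d) fine q"
      then have "norm (line_sum f \<gamma> p - line_sum f \<gamma> q) \<le> e / (2 * W) * V"
        by (rule d(2)[rule_format])
      with less show "norm (line_sum f \<gamma> p - line_sum f \<gamma> q) < e"
        by (rule le_less_trans[rotated])
    qed
  qed
  from someI_ex[OF this] obtain \<delta> where \<delta>_ex: "e > 0 \<Longrightarrow> \<delta> e > 0 \<and> (\<forall>p q. p tagged_division_of {0..1} \<and>
       (\<lambda>t. ball t (\<delta> e)) fine p \<and> q tagged_division_of {0..1} \<and> (\<lambda>t. ball t (\<delta> e)) fine q \<longrightarrow>
       norm (line_sum f \<gamma> p - line_sum f \<gamma> q) < e)" for e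
    by (rule that)
  have \<delta>: "\<delta> e > 0" if "e > 0" for e
    using \<delta>_ex[OF that] by (rule conjunct1)
  have \<delta>_close: "norm (line_sum f \<gamma> p - line_sum f \<gamma> q) < e"
    if "e > 0" "p tagged_division_of {0..1}" "(\<lambda>t. ball t (\<delta> e)) fine p"
       "q tagged_division_of {0..1}" "(\<lambda>t. ball t (\<delta> e)) fine q" for e p q
    by (rule \<delta>_ex[OF that(1), THEN conjunct2, rule_format]) (intro conjI that)
  \<comment> \<open>A partition that is \<open>\<eta> n\<close>-fine serves for all accuracies \<open>1 / (k + 1)\<close> with \<open>k \<le> n\<close>.\<close>
  define \<eta> where "\<eta> n = Min ((\<lambda>k. \<delta> (inverse (real (Suc k)))) ` {..n})" for n
  have "\<delta> (inverse (real (Suc k))) > 0" for k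
    by (rule \<delta>) simp
  then have \<eta>: "\<eta> n > 0" for n
    unfolding \<eta>_def by (subst Min_gr_iff) auto
  have \<eta>_le: "\<eta> n \<le> \<delta> (inverse (real (Suc k)))" if "k \<le> n" for n k
    unfolding \<eta>_def by (rule Min_le, simp, rule imageI) (use that in simp)
  define P where "P n = (SOME p. p tagged_division_of {0..1::real} \<and> (\<lambda>t. ball t (\<eta> n)) fine p)" for n
  have "\<exists>p. p tagged_division_of {0..1::real} \<and> (\<lambda>t. ball t (\<eta> n)) fine p" for n
    by (rule fine_tagged_division_exists[OF \<eta>[of n]]) (rule exI, rule conjI)
  from someI_ex[OF this, folded P_def]
  have P: "P n tagged_division_of {0..1::real}" "(\<lambda>t. ball t (\<eta> n)) fine P n" for n
    by simp_all
  have close: "norm (line_sum f \<gamma> p - line_sum f \<gamma> (P n)) < inverse (real (Suc k))"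
    if "k \<le> n" "p tagged_division_of {0..1}" "(\<lambda>t. ball t (\<delta> (inverse (real (Suc k))))) fine p" for p k n
    by (rule \<delta>_close[OF _ that(2,3) P(1) fine_ball_mono[OF P(2) \<eta>_le[OF that(1)]]]) simp
  have "Cauchy (\<lambda>n. line_sum f \<gamma> (P n))"
  proof (rule CauchyI)
    fix e :: real assume "e > 0"
    then obtain k where k: "inverse (real (Suc k)) < e"
      using reals_Archimedean by blast
    have "norm (line_sum f \<gamma> (P m) - line_sum f \<gamma> (P n)) < e" if "m \<ge> k" "n \<ge> k" for m n
      using close[OF that(2) P(1) fine_ball_mono[OF P(2) \<eta>_le[OF that(1)]]] k by linarith
    then show "\<exists>M. \<forall>m\<ge>M. \<forall>n\<ge>M. norm (line_sum f \<gamma> (P m) - line_sum f \<gamma> (P n)) < e"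
      by blast
  qed
  then obtain I where I: "(\<lambda>n. line_sum f \<gamma> (P n)) \<longlonglongrightarrow> I"
    using Cauchy_convergent_iff convergent_def by blast
  have "has_line_integral f I \<gamma>"
    unfolding has_line_integral_line_sum
  proof (intro allI impI)
    fix e :: real assume "e > 0"
    then obtain k where k: "inverse (real (Suc k)) < e"
      using reals_Archimedean by blast
    have "norm (line_sum f \<gamma> p - I) < e"
      if "p tagged_division_of {0..1}" "(\<lambda>t. ball t (\<delta> (inverse (real (Suc k))))) fine p" for p
    proof -
      have "(\<lambda>n. norm (line_sum f \<gamma> p - line_sum f \<gamma> (P n))) \<longlonglongrightarrow> norm (line_sum f \<gamma> p - I)"
        by (intro tendsto_intros I)
      then have "norm (line_sum f \<gamma> p - I) \<le> inverse (real (Suc k))"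
        by (rule LIMSEQ_le_const2) (use close[OF _ that] less_imp_le in blast)
      with k show ?thesis by simp
    qed
    then show "\<exists>d>0. \<forall>p. p tagged_division_of {0..1} \<and> (\<lambda>t. ball t d) fine p \<longrightarrow> norm (line_sum f \<gamma> p - I) < e"
      using \<delta>[of "inverse (real (Suc k))"] by auto
  qed
  then show ?thesis by (simp add: line_integral_eqI)
qed

lemma has_line_integral_add:
  assumes "has_line_integral f I \<gamma>" "has_line_integral g J \<gamma>"
  shows "has_line_integral (\<lambda>z. f z + g z) (I + J) \<gamma>"
  unfolding has_line_integral_line_sum
proof (intro allI impI)
  fix e :: real assume "e > 0"
  then have e: "e / 2 > 0" by simp
  obtain d1 where d1: "d1 > 0" "\<And>p. p tagged_division_of {0..1} \<Longrightarrow> (\<lambda>t. ball t d1) fine p \<Longrightarrow>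
      norm (line_sum f \<gamma> p - I) < e / 2"
    using assms(1) e unfolding has_line_integral_line_sum by meson
  obtain d2 where d2: "d2 > 0" "\<And>p. p tagged_division_of {0..1} \<Longrightarrow> (\<lambda>t. ball t d2) fine p \<Longrightarrow>
      norm (line_sum g \<gamma> p - J) < e / 2"
    using assms(2) e unfolding has_line_integral_line_sum by meson
  have "norm (line_sum (\<lambda>z. f z + g z) \<gamma> p - (I + J)) < e"
    if p: "p tagged_division_of {0..1}" "(\<lambda>t. ball t (min d1 d2)) fine p" for p
  proof -
    have "line_sum (\<lambda>z. f z + g z) \<gamma> p - (I + J) = (line_sum f \<gamma> p - I) + (line_sum g \<gamma> p - J)"
      by (simp add: line_sum_def scaleC_add_right sum.distrib case_prod_unfold)
    then have "norm (line_sum (\<lambda>z. f z + g z) \<gamma> p - (I + J))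
        \<le> norm (line_sum f \<gamma> p - I) + norm (line_sum g \<gamma> p - J)"
      using norm_triangle_ineq by metis
    moreover have "norm (line_sum f \<gamma> p - I) < e / 2" "norm (line_sum g \<gamma> p - J) < e / 2"
      using d1(2)[OF p(1) fine_ball_mono[OF p(2) min.cobounded1]]
        d2(2)[OF p(1) fine_ball_mono[OF p(2) min.cobounded2]] by auto
    ultimately show ?thesis by linarith
  qed
  then show "\<exists>d>0. \<forall>p. p tagged_division_of {0..1} \<and> (\<lambda>t. ball t d) fine p \<longrightarrow>
        norm (line_sum (\<lambda>z. f z + g z) \<gamma> p - (I + J)) < e"
    using d1(1) d2(1) by (intro exI[of _ "min d1 d2"]) auto
qed

lemma has_line_integral_linear:
  fixes A :: "'a::complex_normed_space \<Rightarrow> 'b::complex_normed_space"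
  assumes f: "has_line_integral f I \<gamma>" and A: "bounded_linear A" "\<And>c x. A (c *\<^sub>C x) = c *\<^sub>C A x"
  shows "has_line_integral (\<lambda>z. A (f z)) (A I) \<gamma>"
  unfolding has_line_integral_line_sum
proof (intro allI impI)
  fix e :: real assume "e > 0"
  obtain K where K: "K > 0" "\<And>x. norm (A x) \<le> norm x * K"
    using bounded_linear.pos_bounded[OF A(1)] by blast
  then have "e / K > 0" using \<open>e > 0\<close> by simp
  then obtain d where d: "d > 0" "\<And>p. p tagged_division_of {0..1} \<Longrightarrow> (\<lambda>t. ball t d) fine p \<Longrightarrow>
      norm (line_sum f \<gamma> p - I) < e / K"
    using f unfolding has_line_integral_line_sum by meson
  have "norm (line_sum (\<lambda>z. A (f z)) \<gamma> p - A I) < e"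
    if p: "p tagged_division_of {0..1}" "(\<lambda>t. ball t d) fine p" for p
  proof -
    have lin: "linear A" using A(1) by (rule bounded_linear.linear)
    have "line_sum (\<lambda>z. A (f z)) \<gamma> p - A I = A (line_sum f \<gamma> p - I)"
      by (simp add: line_sum_def linear_diff[OF lin] linear_sum[OF lin] A(2) case_prod_unfold)
    then have "norm (line_sum (\<lambda>z. A (f z)) \<gamma> p - A I) \<le> norm (line_sum f \<gamma> p - I) * K"
      using K by simp
    also have "\<dots> < e / K * K"
      using d(2)[OF p] K(1) by (intro mult_strict_right_mono)
    finally show ?thesis using K(1) by simp
  qed
  with d(1) show "\<exists>d>0. \<forall>p. p tagged_division_of {0..1} \<and> (\<lambda>t. ball t d) fine p \<longrightarrow>
        norm (line_sum (\<lambda>z. A (f z)) \<gamma> p - A I) < e" by blast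
qed

lemma has_line_integral_scaleC:
  assumes "has_line_integral f I \<gamma>"
  shows "has_line_integral (\<lambda>z. c *\<^sub>C f z) (c *\<^sub>C I) \<gamma>"
proof (rule has_line_integral_linear[OF assms bounded_linear_scaleC])
  show "c *\<^sub>C (d *\<^sub>C x) = d *\<^sub>C (c *\<^sub>C x)" for d and x :: 'a
    by (simp add: scaleC_scaleC mult.commute)
qed

lemma has_line_integral_cong:
  assumes "has_line_integral f I \<gamma>" "\<And>z. z \<in> path_image \<gamma> \<Longrightarrow> f z = g z"
  shows "has_line_integral g I \<gamma>"
proof -
  have "line_sum f \<gamma> p = line_sum g \<gamma> p" if "p tagged_division_of {0..1}" for p
    unfolding line_sum_def using assms(2) tagged_division_ofD(2,3)[OF that]
    by (intro sum.cong) (auto simp: path_image_def intro!: arg_cong2[of _ _ _ _ scaleC], blast)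
  then show ?thesis
    using assms(1) unfolding has_line_integral_line_sum by simp
qed

lemma has_line_integral_bound:
  assumes f: "has_line_integral f I \<gamma>" and V: "variation_le \<gamma> V"
    and B: "0 \<le> B" "\<And>z. z \<in> path_image \<gamma> \<Longrightarrow> norm (f z) \<le> B"
  shows "norm I \<le> B * V"
proof (rule field_le_epsilon)
  fix e :: real assume "e > 0"
  then obtain d where d: "d > 0" "\<And>p. p tagged_division_of {0..1} \<Longrightarrow> (\<lambda>t. ball t d) fine p \<Longrightarrow>
      norm (line_sum f \<gamma> p - I) < e"
    using f unfolding has_line_integral_line_sum by meson
  obtain p where p: "p tagged_division_of {0..1::real}" "(\<lambda>t. ball t d) fine p"
    using fine_tagged_division_exists[OF d(1)] .
  have "norm (line_sum f \<gamma> p) \<le> (\<Sum>(t, K)\<in>p. B * cmod (path_increment \<gamma> K))"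
    unfolding line_sum_def case_prod_unfold
  proof (rule order_trans[OF norm_sum sum_mono])
    fix x assume "x \<in> p"
    then have "fst x \<in> {0..1}"
      using tagged_division_ofD(2,3)[OF p(1), of "fst x" "snd x"] by auto
    then have "norm (f (\<gamma> (fst x))) \<le> B"
      using B(2) by (auto simp: path_image_def)
    then have "cmod (path_increment \<gamma> (snd x)) * norm (f (\<gamma> (fst x))) \<le> cmod (path_increment \<gamma> (snd x)) * B"
      by (rule mult_left_mono) simp
    then show "norm (path_increment \<gamma> (snd x) *\<^sub>C f (\<gamma> (fst x))) \<le> B * cmod (path_increment \<gamma> (snd x))"
      by (simp add: norm_scaleC mult.commute)
  qed
  also have "\<dots> = B * (\<Sum>(t, K)\<in>p. cmod (path_increment \<gamma> K))"
    by (simp add: sum_distrib_left case_prod_unfold)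
  also have "\<dots> \<le> B * V"
    by (rule mult_left_mono[OF variation_le_tagged[OF V p(1)] B(1)])
  finally show "norm I \<le> B * V + e"
    using d(2)[OF p] norm_triangle_sub[of I "line_sum f \<gamma> p"] by (simp add: norm_minus_commute)
qed

text \<open>
  A primitive along the path: \<open>\<phi>\<close> need only be defined on the parameter interval, which admits
  branches of the logarithm as well as the composition of \<open>\<gamma>\<close> with a primitive of \<open>f\<close>.
\<close>

lemma has_line_integral_primitive:
  fixes f :: "complex \<Rightarrow> 'a::complex_normed_space"
  assumes V: "variation_le \<gamma> V"
    and \<phi>: "\<And>e. e > 0 \<Longrightarrow> \<exists>d>0. \<forall>a t b. 0 \<le> a \<and> a \<le> t \<and> t \<le> b \<and> b \<le> 1 \<and> b - a < d \<longrightarrow>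
        norm (\<phi> b - \<phi> a - (\<gamma> b - \<gamma> a) *\<^sub>C f (\<gamma> t)) \<le> e * cmod (\<gamma> b - \<gamma> a)"
  shows "has_line_integral f (\<phi> 1 - \<phi> 0) \<gamma>"
  unfolding has_line_integral_line_sum
proof (intro allI impI)
  fix e :: real assume e: "e > 0"
  have W: "V + 1 > 0" using V by (simp add: variation_le_def)
  then have "e / (V + 1) > 0" using e by simp
  from \<phi>[OF this] obtain d where d: "d > 0"
    "\<And>a t b. 0 \<le> a \<Longrightarrow> a \<le> t \<Longrightarrow> t \<le> b \<Longrightarrow> b \<le> 1 \<Longrightarrow> b - a < d \<Longrightarrow>
        norm (\<phi> b - \<phi> a - (\<gamma> b - \<gamma> a) *\<^sub>C f (\<gamma> t)) \<le> e / (V + 1) * cmod (\<gamma> b - \<gamma> a)" by blast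
  have "norm (line_sum f \<gamma> p - (\<phi> 1 - \<phi> 0)) < e"
    if p: "p tagged_division_of {0..1}" "(\<lambda>t. ball t (d / 2)) fine p" for p
  proof -
    have "\<phi> 1 - \<phi> 0 = (\<Sum>(t, K)\<in>p. \<phi> (Sup K) - \<phi> (Inf K))"
      using additive_tagged_division_1[OF _ p(1), of \<phi>] by simp
    then have "norm (line_sum f \<gamma> p - (\<phi> 1 - \<phi> 0))
        = norm (\<Sum>(t, K)\<in>p. (\<phi> (Sup K) - \<phi> (Inf K)) - path_increment \<gamma> K *\<^sub>C f (\<gamma> t))"
      by (simp add: line_sum_def sum_subtractf case_prod_unfold norm_minus_commute)
    also have "\<dots> \<le> (\<Sum>(t, K)\<in>p. e / (V + 1) * cmod (path_increment \<gamma> K))"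
      unfolding case_prod_unfold
    proof (rule order_trans[OF norm_sum sum_mono])
      fix x assume "x \<in> p"
      then obtain t K where x: "x = (t, K)" "(t, K) \<in> p" by (cases x) auto
      obtain a b where ab: "K = {a..b}" "0 \<le> a" "a \<le> t" "t \<le> b" "b \<le> 1"
        using tagged_division_cell[OF p(1) x(2)] .
      have "{a..b} \<subseteq> ball t (d / 2)"
        using p(2) x ab unfolding fine_def by auto
      from subsetD[OF this, of a] subsetD[OF this, of b]
      have "a \<in> ball t (d / 2)" "b \<in> ball t (d / 2)"
        using ab by auto
      then have "b - a < d" using ab by (auto simp: dist_real_def)
      then show "norm (\<phi> (Sup (snd x)) - \<phi> (Inf (snd x)) - path_increment \<gamma> (snd x) *\<^sub>C f (\<gamma> (fst x)))
          \<le> e / (V + 1) * cmod (path_increment \<gamma> (snd x))"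
        using d(2)[of a t b] ab x by (simp add: path_increment_def)
    qed
    also have "\<dots> = e / (V + 1) * (\<Sum>(t, K)\<in>p. cmod (path_increment \<gamma> K))"
      by (simp add: sum_distrib_left case_prod_unfold)
    also have "\<dots> \<le> e / (V + 1) * V"
      using variation_le_tagged[OF V p(1)] e W by (intro mult_left_mono) auto
    also have "\<dots> < e"
      using e W by (simp add: field_simps)
    finally show ?thesis .
  qed
  with d(1) show "\<exists>d>0. \<forall>p. p tagged_division_of {0..1} \<and> (\<lambda>t. ball t d) fine p \<longrightarrow>
        norm (line_sum f \<gamma> p - (\<phi> 1 - \<phi> 0)) < e"
    by (intro exI[of _ "d / 2"]) auto
qed

text \<open>A continuous logarithm of \<open>\<gamma> - \<zeta>\<close> is a primitive of \<open>1 / (z - \<zeta>)\<close> along \<open>\<gamma>\<close>.\<close>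

lemma has_line_integral_winding_number:
  assumes V: "variation_le \<gamma> V" and \<gamma>: "path \<gamma>" and z: "\<zeta> \<notin> path_image \<gamma>"
  shows "has_line_integral (\<lambda>z. 1 / (z - \<zeta>)) (2 * of_real pi * \<i> * winding_number \<gamma> \<zeta>) \<gamma>"
proof -
  obtain q where q: "path q" "pathfinish q - pathstart q = 2 * of_real pi * \<i> * winding_number \<gamma> \<zeta>"
    "\<And>t. t \<in> {0..1} \<Longrightarrow> \<gamma> t = \<zeta> + exp (q t)"
    using winding_number_as_continuous_log[OF \<gamma> z] by blast
  obtain m where m: "m > 0" "\<And>t. t \<in> {0..1} \<Longrightarrow> m \<le> cmod (\<gamma> t - \<zeta>)"
  proof -
    have "0 < setdist {\<zeta>} (path_image \<gamma>)"
      using z compact_path_image[OF \<gamma>] path_image_nonempty[of \<gamma>]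
      by (simp add: setdist_gt_0_compact_closed compact_imp_closed)
    moreover have "setdist {\<zeta>} (path_image \<gamma>) \<le> cmod (\<gamma> t - \<zeta>)" if "t \<in> {0..1}" for t
      using setdist_le_dist[of \<zeta> "{\<zeta>}" "\<gamma> t" "path_image \<gamma>"] that
      by (auto simp: path_image_def dist_norm norm_minus_commute)
    ultimately show ?thesis using that by blast
  qed
  have "has_line_integral (\<lambda>z. 1 / (z - \<zeta>)) (q 1 - q 0) \<gamma>"
  proof (rule has_line_integral_primitive[OF V])
    fix e :: real assume e: "e > 0"
    define \<kappa> where "\<kappa> = min (1 / 2) (e * m / 2)"
    have \<kappa>: "\<kappa> > 0" "\<kappa> \<le> 1 / 2" "2 * \<kappa> \<le> e * m"
      using e m(1) by (auto simp: \<kappa>_def)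
    have "isCont exp (0::complex)" by simp
    then obtain \<eta> where \<eta>: "\<eta> > 0" "\<And>u::complex. cmod u < \<eta> \<Longrightarrow> cmod (exp u - 1) < \<kappa>"
      using \<kappa>(1) unfolding continuous_at_eps_delta by (auto simp: dist_norm)
    \<comment> \<open>The error must be compared with \<open>exp u - exp v\<close>, since only the variation of \<open>\<gamma>\<close> is known to be
      finite, not that of \<open>q\<close>.\<close>
    have exp_est: "cmod (exp u - exp v - (u - v)) \<le> 2 * \<kappa> * cmod (exp u - exp v)"
      if uv: "cmod u < \<eta>" "cmod v < \<eta>" for u v :: complex
    proof -
      have "cmod ((exp u - u) - (exp v - v)) \<le> \<kappa> * cmod (u - v)"
      proof (rule field_differentiable_bound[of "ball 0 \<eta>" _ "\<lambda>u. exp u - 1"])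
        show "((\<lambda>u. exp u - u) has_field_derivative exp w - 1) (at w within ball 0 \<eta>)" for w
          by (auto intro!: derivative_eq_intros)
        show "cmod (exp w - 1) \<le> \<kappa>" if "w \<in> ball 0 \<eta>" for w
          using \<eta>(2)[of w] that by simp
      qed (use uv in auto)
      then have 1: "cmod (exp u - exp v - (u - v)) \<le> \<kappa> * cmod (u - v)"
        by (simp add: algebra_simps)
      also have "\<dots> \<le> 1 / 2 * cmod (u - v)"
        using \<kappa> by (intro mult_right_mono) auto
      finally have "cmod (u - v) \<le> 2 * cmod (exp u - exp v)"
        using norm_triangle_ineq4[of "exp u - exp v" "exp u - exp v - (u - v)"] by simp
      then have "\<kappa> * cmod (u - v) \<le> \<kappa> * (2 * cmod (exp u - exp v))"
        using \<kappa>(1) by (intro mult_left_mono) auto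
      with 1 show ?thesis by simp
    qed
    have "uniformly_continuous_on {0..1} q"
      using q(1) unfolding path_def by (intro compact_uniformly_continuous) auto
    then obtain d where d: "d > 0"
      "\<And>s t. s \<in> {0..1} \<Longrightarrow> t \<in> {0..1} \<Longrightarrow> dist s t < d \<Longrightarrow> dist (q s) (q t) < \<eta>"
      using \<eta>(1) unfolding uniformly_continuous_on_def by meson
    have "norm (q b - q a - (\<gamma> b - \<gamma> a) *\<^sub>C (1 / (\<gamma> t - \<zeta>))) \<le> e * cmod (\<gamma> b - \<gamma> a)"
      if abt: "0 \<le> a" "a \<le> t" "t \<le> b" "b \<le> 1" "b - a < d" for a t b
    proof -
      define u v where "u = q b - q t" and "v = q a - q t"
      have in01: "a \<in> {0..1}" "b \<in> {0..1}" "t \<in> {0..1}"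
        using abt by auto
      then have uv: "cmod u < \<eta>" "cmod v < \<eta>"
        using d(2)[of b t] d(2)[of a t] abt by (auto simp: u_def v_def dist_norm)
      have eq: "exp u - exp v = (\<gamma> b - \<gamma> a) / (\<gamma> t - \<zeta>)"
        using q(3) in01 by (simp add: u_def v_def exp_diff diff_divide_distrib)
      have "cmod (exp u - exp v) \<le> cmod (\<gamma> b - \<gamma> a) / m"
        unfolding eq norm_divide using m(1) m(2)[OF in01(3)]
        by (intro divide_left_mono mult_pos_pos) auto
      then have "2 * \<kappa> * cmod (exp u - exp v) \<le> (e * m) * (cmod (\<gamma> b - \<gamma> a) / m)"
        by - (rule mult_mono, use \<kappa> e m(1) in auto)
      also have "\<dots> = e * cmod (\<gamma> b - \<gamma> a)"
        using m(1) by simp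
      finally have "cmod (exp u - exp v - (u - v)) \<le> e * cmod (\<gamma> b - \<gamma> a)"
        using exp_est[OF uv] by simp
      moreover have "q b - q a - (\<gamma> b - \<gamma> a) *\<^sub>C (1 / (\<gamma> t - \<zeta>)) = - (exp u - exp v - (u - v))"
        unfolding eq by (simp add: scaleC_complex_def u_def v_def)
      ultimately show ?thesis
        by (simp only: norm_minus_cancel)
    qed
    with d(1) show "\<exists>d>0. \<forall>a t b. 0 \<le> a \<and> a \<le> t \<and> t \<le> b \<and> b \<le> 1 \<and> b - a < d \<longrightarrow>
        norm (q b - q a - (\<gamma> b - \<gamma> a) *\<^sub>C (1 / (\<gamma> t - \<zeta>))) \<le> e * cmod (\<gamma> b - \<gamma> a)"
      by blast
  qed
  moreover have "q 1 - q 0 = 2 * of_real pi * \<i> * winding_number \<gamma> \<zeta>"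
    using q(2) by (simp add: pathstart_def pathfinish_def)
  ultimately show ?thesis by simp
qed

lemma has_line_integral_power:
  assumes V: "variation_le \<gamma> V" and \<gamma>: "path \<gamma>" "pathfinish \<gamma> = pathstart \<gamma>"
  shows "has_line_integral (\<lambda>z. z ^ n) 0 \<gamma>"
proof -
  \<comment> \<open>The difference quotient of \<open>z ^ Suc n / Suc n\<close> between \<open>\<gamma> a\<close> and \<open>\<gamma> b\<close>, minus the derivative at \<open>\<gamma> t\<close>.\<close>
  define \<Phi> where "\<Phi> = (\<lambda>(b, a, t). (\<Sum>i<Suc n. \<gamma> a ^ (Suc n - Suc i) * \<gamma> b ^ i) / of_nat (Suc n) - \<gamma> t ^ n)"
  have c\<gamma>: "continuous_on {0..1} \<gamma>" using \<gamma>(1) by (simp add: path_def)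
  have "continuous_on ({0..1} \<times> {0..1} \<times> {0..1}) \<Phi>"
    unfolding \<Phi>_def case_prod_unfold
    by (intro continuous_intros continuous_on_compose2[OF c\<gamma>]) (auto simp del: of_nat_Suc)
  then have unif: "uniformly_continuous_on ({0..1} \<times> {0..1} \<times> {0..1}) \<Phi>"
    by (intro compact_uniformly_continuous compact_Times) auto
  have "has_line_integral (\<lambda>z. z ^ n) (\<gamma> 1 ^ Suc n / of_nat (Suc n) - \<gamma> 0 ^ Suc n / of_nat (Suc n)) \<gamma>"
  proof (rule has_line_integral_primitive[OF V])
    fix e :: real assume "e > 0"
    then obtain d where d: "d > 0" "\<And>x y. x \<in> {0..1} \<times> {0..1} \<times> {0..1} \<Longrightarrow> y \<in> {0..1} \<times> {0..1} \<times> {0..1} \<Longrightarrow>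
        dist x y < d \<Longrightarrow> dist (\<Phi> x) (\<Phi> y) < e"
      using unif unfolding uniformly_continuous_on_def by meson
    have "cmod (\<gamma> b ^ Suc n / of_nat (Suc n) - \<gamma> a ^ Suc n / of_nat (Suc n) - (\<gamma> b - \<gamma> a) *\<^sub>C \<gamma> t ^ n)
        \<le> e * cmod (\<gamma> b - \<gamma> a)"
      if abt: "0 \<le> a" "a \<le> t" "t \<le> b" "b \<le> 1" "b - a < d / 2" for a t b
    proof -
      have "dist (b, a, t) (t, t, t) \<le> dist b t + dist a t"
        unfolding dist_Pair_Pair using sqrt_sum_squares_le_sum_abs[of "dist b t" "dist a t"] by simp
      then have "dist (b, a, t) (t, t, t) < d"
        using abt by (auto simp: dist_real_def)
      then have "dist (\<Phi> (b, a, t)) (\<Phi> (t, t, t)) < e"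
        using abt by (intro d(2)) auto
      moreover have "\<Phi> (t, t, t) = 0"
        unfolding \<Phi>_def by (simp add: power_add[symmetric] del: sum.lessThan_Suc of_nat_Suc)
      ultimately have le: "cmod (\<Phi> (b, a, t)) \<le> e"
        by (simp add: dist_norm)
      have "\<gamma> b ^ Suc n - \<gamma> a ^ Suc n = (\<gamma> b - \<gamma> a) * (\<Sum>i<Suc n. \<gamma> a ^ (Suc n - Suc i) * \<gamma> b ^ i)"
        by (rule power_diff_sumr2)
      then have "\<gamma> b ^ Suc n / of_nat (Suc n) - \<gamma> a ^ Suc n / of_nat (Suc n) - (\<gamma> b - \<gamma> a) *\<^sub>C \<gamma> t ^ n
          = (\<gamma> b - \<gamma> a) * \<Phi> (b, a, t)"
        unfolding \<Phi>_def scaleC_complex_def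
        by (simp only: diff_divide_distrib[symmetric] prod.case right_diff_distrib times_divide_eq_right)
      then show ?thesis
        using mult_right_mono[OF le, of "cmod (\<gamma> b - \<gamma> a)"]
        by (simp only: norm_mult mult.commute norm_ge_zero)
    qed
    with d(1) show "\<exists>d>0. \<forall>a t b. 0 \<le> a \<and> a \<le> t \<and> t \<le> b \<and> b \<le> 1 \<and> b - a < d \<longrightarrow>
        cmod (\<gamma> b ^ Suc n / of_nat (Suc n) - \<gamma> a ^ Suc n / of_nat (Suc n) - (\<gamma> b - \<gamma> a) *\<^sub>C \<gamma> t ^ n)
        \<le> e * cmod (\<gamma> b - \<gamma> a)"
      by (intro exI[of _ "d / 2"]) auto
  qed
  then show ?thesis
    using \<gamma>(2) by (simp add: pathstart_def pathfinish_def)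
qed

lemma has_line_integral_const_power:
  fixes c :: "'a::complex_normed_space"
  assumes "variation_le \<gamma> V" "path \<gamma>" "pathfinish \<gamma> = pathstart \<gamma>"
  shows "has_line_integral (\<lambda>z. z ^ n *\<^sub>C c) 0 \<gamma>"
  using has_line_integral_linear[OF has_line_integral_power[OF assms], of "\<lambda>z. z *\<^sub>C c" n]
  by (simp add: scaleC.bounded_linear_left scaleC_complex_def scaleC_scaleC)

lemma has_line_integral_diff:
  assumes "has_line_integral f I \<gamma>" "has_line_integral g J \<gamma>"
  shows "has_line_integral (\<lambda>z. f z - g z) (I - J) \<gamma>"
  using has_line_integral_add[OF assms(1) has_line_integral_scaleC[OF assms(2), of "-1"]]
  by (simp add: scaleC.minus_left scaleC_one)

text \<open>Dependence on parameters, and passage to uniform limits, follow from the length estimate.\<close>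

lemma has_line_integral_uniform_limit:
  fixes f :: "nat \<Rightarrow> complex \<Rightarrow> 'a::complex_banach"
  assumes V: "variation_le \<gamma> V" and \<gamma>: "path \<gamma>"
    and f: "\<And>n. has_line_integral (f n) (I n) \<gamma>" and g: "has_line_integral g J \<gamma>"
    and lim: "uniform_limit (path_image \<gamma>) f g sequentially"
  shows "I \<longlonglongrightarrow> J"
proof (rule tendstoI)
  fix e :: real assume e: "e > 0"
  have V0: "0 \<le> V" using V by (simp add: variation_le_def)
  then have "e / (V + 1) > 0" using e by simp
  then have "\<forall>\<^sub>F n in sequentially. \<forall>z\<in>path_image \<gamma>. dist (f n z) (g z) < e / (V + 1)"
    using lim unfolding uniform_limit_iff by blast
  then show "\<forall>\<^sub>F n in sequentially. dist (I n) J < e"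
  proof eventually_elim
    case (elim n)
    have "norm (I n - J) \<le> e / (V + 1) * V"
      using elim e V0
      by (intro has_line_integral_bound[OF has_line_integral_diff[OF f g] V]) (auto simp: dist_norm less_imp_le)
    also have "\<dots> < e" using e V0 by (simp add: field_simps)
    finally show ?case by (simp add: dist_norm)
  qed
qed

lemma continuous_on_line_integral_parameter:
  fixes f :: "'p::topological_space \<Rightarrow> complex \<Rightarrow> 'a::complex_banach"
  assumes V: "variation_le \<gamma> V" and \<gamma>: "path \<gamma>"
    and cont: "continuous_on (W \<times> path_image \<gamma>) (\<lambda>(p, z). f p z)"
  shows "continuous_on W (\<lambda>p. line_integral \<gamma> (f p))"
  unfolding continuous_on_def
proof (intro ballI tendstoI)
  fix p and e :: real assume p: "p \<in> W" and e: "e > 0"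
  have V0: "0 \<le> V" using V by (simp add: variation_le_def)
  then have e': "e / (V + 1) > 0" using e by simp
  have int: "has_line_integral (f x) (line_integral \<gamma> (f x)) \<gamma>" if "x \<in> W" for x
  proof (rule has_line_integral_exists[OF V \<gamma>])
    have "continuous_on (path_image \<gamma>) ((\<lambda>(p, z). f p z) \<circ> Pair x)"
      by (rule continuous_on_compose) (use that in \<open>auto intro!: continuous_intros continuous_on_subset[OF cont]\<close>)
    then show "continuous_on (path_image \<gamma>) (f x)" by (simp add: o_def)
  qed
  obtain X0 where X0: "p \<in> X0" "open X0"
    "\<forall>x\<in>X0 \<inter> W. \<forall>z\<in>path_image \<gamma>. dist (f x z) (f p z) \<le> e / (V + 1)"
    using continuous_on_prod_compactE[OF cont compact_path_image[OF \<gamma>] p e'] by auto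
  have "\<forall>\<^sub>F x in at p within W. x \<in> X0 \<inter> W"
    using X0(1,2) unfolding eventually_at_topological by auto
  then show "\<forall>\<^sub>F x in at p within W. dist (line_integral \<gamma> (f x)) (line_integral \<gamma> (f p)) < e"
  proof eventually_elim
    case (elim x)
    have "norm (line_integral \<gamma> (f x) - line_integral \<gamma> (f p)) \<le> e / (V + 1) * V"
      using elim e' X0(3) p
      by (intro has_line_integral_bound[OF has_line_integral_diff[OF int int] V]) (auto simp: dist_norm)
    also have "\<dots> < e" using e V0 by (simp add: field_simps)
    finally show ?case by (simp add: dist_norm)
  qed
qed

section \<open>Polygonal paths\<close>

fun polyline :: "complex list \<Rightarrow> real \<Rightarrow> complex" where
  "polyline (a # b # c # xs) = linepath a b +++ polyline (b # c # xs)"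
| "polyline [a, b] = linepath a b"
| "polyline [a] = linepath a a"
| "polyline [] = linepath 0 0"

fun walk_edges :: "'v list \<Rightarrow> ('v \<times> 'v) set" where
  "walk_edges (a # b # xs) = insert (a, b) (walk_edges (b # xs))"
| "walk_edges _ = {}"

lemma walk_edges_subset: "walk_edges xs \<subseteq> set xs \<times> set (tl xs)"
  by (induction xs rule: walk_edges.induct) auto

lemma finite_walk_edges [simp]: "finite (walk_edges xs)"
  by (induction xs rule: walk_edges.induct) auto

lemma walk_edges_snoc: "xs \<noteq> [] \<Longrightarrow> walk_edges (xs @ [c]) = insert (last xs, c) (walk_edges xs)"
  by (induction xs rule: walk_edges.induct) auto

lemma walk_edges_append: "walk_edges ys \<subseteq> walk_edges (xs @ ys)"
proof (induction xs)
  case (Cons x xs)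
  then show ?case by (cases "xs @ ys") auto
qed simp

lemma walk_edges_into_last: "2 \<le> length xs \<Longrightarrow> \<exists>a. (a, last xs) \<in> walk_edges xs"
  by (induction xs rule: walk_edges.induct) (force simp: Suc_le_eq)+

lemma sum_walk_edges:
  fixes f :: "'v \<Rightarrow> 'v \<Rightarrow> 'b::comm_monoid_add"
  assumes "distinct (a # b # xs)"
  shows "(\<Sum>(x, y)\<in>walk_edges (a # b # xs). f x y) = f a b + (\<Sum>(x, y)\<in>walk_edges (b # xs). f x y)"
proof -
  have "(a, b) \<notin> walk_edges (b # xs)"
    using walk_edges_subset[of "b # xs"] assms by auto
  then show ?thesis by simp
qed

lemma sum_walk_edges_telescope:
  fixes \<phi> :: "'v \<Rightarrow> real"
  assumes "xs \<noteq> []" "distinct xs"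
  shows "(\<Sum>(x, y)\<in>walk_edges xs. \<phi> y - \<phi> x) = \<phi> (last xs) - \<phi> (hd xs)"
  using assms
proof (induction xs rule: walk_edges.induct)
  case (1 a b xs)
  then show ?case
    by (subst sum_walk_edges) auto
qed auto

lemma polyline_ends [simp]:
  "xs \<noteq> [] \<Longrightarrow> pathstart (polyline xs) = hd xs"
  "xs \<noteq> [] \<Longrightarrow> pathfinish (polyline xs) = last xs"
  by (induction xs rule: polyline.induct) auto

lemma path_polyline [simp]: "path (polyline xs)"
proof (induction xs rule: polyline.induct)
  case (3 a)
  show ?case unfolding polyline.simps by (rule path_linepath)
next
  case 4
  show ?case unfolding polyline.simps by (rule path_linepath)
qed auto

lemma path_image_polyline:
  "2 \<le> length xs \<Longrightarrow> path_image (polyline xs) = (\<Union>(a, b)\<in>walk_edges xs. closed_segment a b)"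
  by (induction xs rule: polyline.induct) (auto simp: path_image_join)

lemma winding_number_polyline:
  assumes "2 \<le> length xs" "distinct xs" "z \<notin> path_image (polyline xs)"
  shows "winding_number (polyline xs) z = (\<Sum>(a, b)\<in>walk_edges xs. winding_number (linepath a b) z)"
  using assms
proof (induction xs rule: polyline.induct)
  case (1 a b c xs)
  have "z \<notin> path_image (linepath a b)" "z \<notin> path_image (polyline (b # c # xs))"
    using "1.prems"(3) by (auto simp: path_image_join)
  moreover have "winding_number (polyline (b # c # xs)) z
      = (\<Sum>(a, b)\<in>walk_edges (b # c # xs). winding_number (linepath a b) z)"
    using 1 calculation by auto
  ultimately show ?case
    using "1.prems"(2) by (subst sum_walk_edges) (auto simp: winding_number_join simp del: walk_edges.simps)
qed auto

text \<open>
  The edges of a plane straight-line graph meet only in common end points. Because the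
  intersection of the end point sets is taken, a proper edge and its reverse do not both belong to such a graph.
\<close>

definition edges_separated :: "(complex \<times> complex) set \<Rightarrow> bool" where
  "edges_separated E \<longleftrightarrow> (\<forall>(a, b)\<in>E. \<forall>(c, d)\<in>E. (a, b) \<noteq> (c, d) \<longrightarrow>
     closed_segment a b \<inter> closed_segment c d \<subseteq> {a, b} \<inter> {c, d})"

lemma edges_separatedD:
  "edges_separated E \<Longrightarrow> (a, b) \<in> E \<Longrightarrow> (c, d) \<in> E \<Longrightarrow> (a, b) \<noteq> (c, d) \<Longrightarrow>
     p \<in> closed_segment a b \<Longrightarrow> p \<in> closed_segment c d \<Longrightarrow> p \<in> {a, b} \<and> p \<in> {c, d}"
  unfolding edges_separated_def by blast

lemma edges_separated_mono: "edges_separated E \<Longrightarrow> F \<subseteq> E \<Longrightarrow> edges_separated F"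
  unfolding edges_separated_def by blast

lemma arc_polyline:
  assumes "2 \<le> length xs" "distinct xs" "edges_separated (walk_edges xs)"
  shows "arc (polyline xs)"
  using assms
proof (induction xs rule: polyline.induct)
  case (1 a b c xs)
  have "edges_separated (walk_edges (b # c # xs))"
    by (rule edges_separated_mono[OF "1.prems"(3)]) auto
  then have "arc (polyline (b # c # xs))"
    using 1 by simp
  moreover have "path_image (linepath a b) \<inter> path_image (polyline (b # c # xs)) \<subseteq> {b}"
  proof
    fix p assume p: "p \<in> path_image (linepath a b) \<inter> path_image (polyline (b # c # xs))"
    then obtain x y where xy: "(x, y) \<in> walk_edges (b # c # xs)" "p \<in> closed_segment x y"
      by (auto simp: path_image_polyline simp del: walk_edges.simps)
    have "x \<in> set (b # c # xs)" "y \<in> set (b # c # xs)"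
      using walk_edges_subset[of "b # c # xs"] xy(1) by auto
    then have ne: "a \<noteq> x" "a \<noteq> y" using "1.prems"(2) by auto
    have "(x, y) \<in> walk_edges (a # b # c # xs)" using xy(1) by simp
    then have "p \<in> {a, b} \<and> p \<in> {x, y}"
      using edges_separatedD[OF "1.prems"(3), of a b x y p] p xy(2) ne by auto
    with ne show "p \<in> {b}" by auto
  qed
  ultimately show ?case
    using "1.prems"(2) by (auto intro!: arc_join)
qed auto

lemma lipschitz_on_joinpaths:
  fixes g h :: "real \<Rightarrow> 'a::metric_space"
  assumes "\<exists>L. L-lipschitz_on {0..1} g" "\<exists>L. L-lipschitz_on {0..1} h" "pathfinish g = pathstart h"
  shows "\<exists>L. L-lipschitz_on {0..1} (g +++ h)"
proof -
  obtain L M where L: "L-lipschitz_on {0..1} g" and M: "M-lipschitz_on {0..1} h"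
    using assms by blast
  have nonneg: "0 \<le> L" "0 \<le> M"
    using L M by (auto dest: lipschitz_on_nonneg)
  have "(L * 2)-lipschitz_on {0..1/2} (\<lambda>x. g (2 * x))"
  proof (rule lipschitz_onI)
    fix x y :: real assume "x \<in> {0..1/2}" "y \<in> {0..1/2}"
    then have "dist (g (2 * x)) (g (2 * y)) \<le> L * dist (2 * x) (2 * y)"
      by (intro lipschitz_onD[OF L]) auto
    also have "dist (2 * x) (2 * y) = 2 * dist x y"
      by (simp add: dist_real_def abs_if)
    finally show "dist (g (2 * x)) (g (2 * y)) \<le> L * 2 * dist x y"
      by simp
  qed (use nonneg in simp)
  moreover have "(M * 2)-lipschitz_on {1/2..1} (\<lambda>x. h (2 * x - 1))"
  proof (rule lipschitz_onI)
    fix x y :: real assume "x \<in> {1/2..1}" "y \<in> {1/2..1}"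
    then have "dist (h (2 * x - 1)) (h (2 * y - 1)) \<le> M * dist (2 * x - 1) (2 * y - 1)"
      by (intro lipschitz_onD[OF M]) auto
    also have "dist (2 * x - 1) (2 * y - 1) = 2 * dist x y"
      by (simp add: dist_real_def abs_if)
    finally show "dist (h (2 * x - 1)) (h (2 * y - 1)) \<le> M * 2 * dist x y"
      by simp
  qed (use nonneg in simp)
  ultimately have "(max (L * 2) (M * 2))-lipschitz_on {0..1} (\<lambda>x. if x \<le> 1/2 then g (2 * x) else h (2 * x - 1))"
    by (rule lipschitz_on_concat_max) (use assms(3) in \<open>simp add: pathfinish_def pathstart_def\<close>)
  then show ?thesis unfolding joinpaths_def by blast
qed

lemma lipschitz_on_linepath: "\<exists>L. L-lipschitz_on {0..1} (linepath a b)"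
proof -
  have "dist (linepath a b x) (linepath a b y) = norm (b - a) * dist x y" for x y
  proof -
    have "linepath a b x - linepath a b y = (x - y) *\<^sub>R (b - a)"
      by (simp add: linepath_def algebra_simps)
    then show ?thesis by (simp add: dist_norm mult.commute)
  qed
  then show ?thesis by (intro exI[of _ "norm (b - a)"] lipschitz_onI) auto
qed

lemma lipschitz_on_polyline: "\<exists>L. L-lipschitz_on {0..1} (polyline xs)"
proof (induction xs rule: polyline.induct)
  case (1 a b c xs)
  then show ?case
    unfolding polyline.simps by (intro lipschitz_on_joinpaths lipschitz_on_linepath) auto
next
  case (2 a b)
  show ?case unfolding polyline.simps by (rule lipschitz_on_linepath)
next
  case (3 a)
  show ?case unfolding polyline.simps by (rule lipschitz_on_linepath)
next
  case 4
  show ?case unfolding polyline.simps by (rule lipschitz_on_linepath)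
qed

lemma rectifiable_path_lipschitz:
  assumes "L-lipschitz_on {0..1} \<gamma>"
  shows "rectifiable_path \<gamma>"
  unfolding rectifiable_path_def
proof
  show "path \<gamma>"
    using assms unfolding path_def by (rule lipschitz_on_continuous_on)
  show "bdd_above ((\<lambda>P. \<Sum>K\<in>P. dist (\<gamma> (Inf K)) (\<gamma> (Sup K))) ` {P. P division_of {0..1}})"
  proof (rule bdd_aboveI2)
    fix P :: "real set set" assume "P \<in> {P. P division_of {0..1}}"
    then have P: "P division_of cbox 0 1" by simp
    have "(\<Sum>K\<in>P. dist (\<gamma> (Inf K)) (\<gamma> (Sup K))) \<le> (\<Sum>K\<in>P. L * measure lborel K)"
    proof (rule sum_mono)
      fix K assume K: "K \<in> P"
      then obtain a b where ab: "K = {a..b}" "a \<le> b" "0 \<le> a" "b \<le> 1"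
        using division_ofD(2,3,4)[OF P K] by (auto simp: box_real)
      then have "dist (\<gamma> a) (\<gamma> b) \<le> L * dist a b"
        by (intro lipschitz_onD[OF assms]) auto
      then show "dist (\<gamma> (Inf K)) (\<gamma> (Sup K)) \<le> L * measure lborel K"
        using ab by (simp add: dist_real_def)
    qed
    also have "\<dots> = L"
      using additive_content_division[OF P] by (simp add: sum_distrib_left[symmetric])
    finally show "(\<Sum>K\<in>P. dist (\<gamma> (Inf K)) (\<gamma> (Sup K))) \<le> L" .
  qed
qed


section \<open>Decomposition of balanced plane graphs into Jordan polygons\<close>

text \<open>
  In-degree equals out-degree at every vertex, tested against all functions \<open>\<phi>\<close> on the vertices.
  In this form the condition is additive in the edge set.
\<close>

definition balanced :: "('v \<times> 'v) set \<Rightarrow> bool" where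
  "balanced E \<longleftrightarrow> (\<forall>\<phi> :: 'v \<Rightarrow> real. (\<Sum>(a, b)\<in>E. \<phi> b - \<phi> a) = 0)"

lemma balanced_successor:
  assumes E: "finite E" "balanced E" "\<And>a. (a, a) \<notin> E" and ab: "(a, b) \<in> E"
  shows "\<exists>c. (b, c) \<in> E"
proof (rule ccontr)
  assume no: "\<not> (\<exists>c. (b, c) \<in> E)"
  define \<phi> where "\<phi> v = (if v = b then 1 else 0 :: real)" for v
  have "0 < (\<Sum>(x, y)\<in>E. \<phi> y - \<phi> x)"
    by (rule sum_pos2[OF E(1) ab]) (use no ab E(3) in \<open>auto simp: \<phi>_def\<close>)
  with E(2) show False unfolding balanced_def by simp
qed

text \<open>A longest walk without repeated vertices can only be continued back to one of its vertices.\<close>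

lemma balanced_obtains_cycle:
  assumes E: "finite E" "balanced E" "\<And>a. (a, a) \<notin> E" "E \<noteq> {}"
  obtains xs where "2 \<le> length xs" "distinct xs" "walk_edges xs \<subseteq> E" "(last xs, hd xs) \<in> E"
proof -
  define V where "V = fst ` E \<union> snd ` E"
  define ok where "ok xs \<longleftrightarrow> 2 \<le> length xs \<and> distinct xs \<and> walk_edges xs \<subseteq> E" for xs
  have finV: "finite V" using E(1) by (simp add: V_def)
  have verts: "set xs \<subseteq> V" if "walk_edges xs \<subseteq> E" "2 \<le> length xs" for xs
    using that
  proof (induction xs rule: walk_edges.induct)
    case (1 a b xs)
    then have "(a, b) \<in> E" by simp
    then have "a \<in> V" "b \<in> V" unfolding V_def by force+
    moreover have "set (b # xs) \<subseteq> V"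
      using 1 \<open>b \<in> V\<close> by (cases xs) auto
    ultimately show ?case by simp
  qed auto
  have len: "length xs < Suc (card V)" if "ok xs" for xs
  proof -
    have "length xs = card (set xs)"
      using that by (simp add: ok_def distinct_card)
    also have "\<dots> \<le> card V"
      using that by (intro card_mono finV verts) (simp_all add: ok_def)
    finally show ?thesis by simp
  qed
  obtain a b where ab: "(a, b) \<in> E" using E(4) by auto
  then have "ok [a, b]" using E(3) by (auto simp: ok_def)
  then have "\<exists>xs. ok xs \<and> (\<forall>ys. ok ys \<longrightarrow> length ys \<le> length xs)"
    by (rule ex_has_greatest_nat[of ok _ length "Suc (card V)"]) (simp add: len less_imp_le)
  then obtain xs where xs: "ok xs" "\<And>ys. ok ys \<Longrightarrow> length ys \<le> length xs"
    by blast
  then have xs': "2 \<le> length xs" "distinct xs" "walk_edges xs \<subseteq> E" "xs \<noteq> []"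
    by (auto simp: ok_def)
  obtain u where "(u, last xs) \<in> E"
    using walk_edges_into_last[OF xs'(1)] xs'(3) by blast
  then obtain c where c: "(last xs, c) \<in> E"
    using balanced_successor[OF E(1-3)] by blast
  have "c \<in> set xs"
  proof (rule ccontr)
    assume "c \<notin> set xs"
    then have "ok (xs @ [c])"
      using xs' c by (simp add: ok_def walk_edges_snoc)
    from xs(2)[OF this] show False by simp
  qed
  then obtain ys zs where split: "xs = ys @ c # zs"
    by (auto simp: in_set_conv_decomp)
  have last: "last (c # zs) = last xs" by (simp add: split)
  have "c \<noteq> last xs" using c E(3) by metis
  then have "zs \<noteq> []" using last by auto
  then have "2 \<le> length (c # zs)" by (cases zs) auto
  moreover have "distinct (c # zs)" using xs'(2) split by simp
  moreover have "walk_edges (c # zs) \<subseteq> E"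
    using walk_edges_append[of "c # zs" ys] xs'(3) split by simp
  ultimately show ?thesis
    using that[of "c # zs"] c last by simp
qed

text \<open>
  Cycles are split off one at a time; what remains is balanced because a cycle is. The winding number
  of each resulting polygon is the sum over its edges of the winding numbers of the segments, which
  need not be integers.
\<close>

lemma balanced_Jordan_decomposition:
  assumes "finite E" "balanced E" "\<And>a. (a, a) \<notin> E" "edges_separated E"
  shows "\<exists>\<Gamma>. finite \<Gamma> \<and>
    (\<forall>\<gamma>\<in>\<Gamma>. simple_path \<gamma> \<and> pathfinish \<gamma> = pathstart \<gamma> \<and> (\<exists>L. L-lipschitz_on {0..1} \<gamma>)) \<and>
    (\<Union>\<gamma>\<in>\<Gamma>. path_image \<gamma>) = (\<Union>(a, b)\<in>E. closed_segment a b) \<and>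
    (\<forall>z. z \<notin> (\<Union>(a, b)\<in>E. closed_segment a b) \<longrightarrow>
      (\<Sum>\<gamma>\<in>\<Gamma>. winding_number \<gamma> z) = (\<Sum>(a, b)\<in>E. winding_number (linepath a b) z))"
  using assms
proof (induction E rule: finite_psubset_induct)
  case (psubset E)
  note E = \<open>finite E\<close> psubset.prems
  show ?case
  proof (cases "E = {}")
    case True
    then show ?thesis by (intro exI[of _ "{}"]) auto
  next
    case False
    obtain xs where xs: "2 \<le> length xs" "distinct xs" "walk_edges xs \<subseteq> E" "(last xs, hd xs) \<in> E"
      using balanced_obtains_cycle[OF E(1-3) False] by blast
    have ne: "xs \<noteq> []" using xs(1) by auto
    define e where "e = (last xs, hd xs)"
    define C where "C = insert e (walk_edges xs)"
    define \<gamma> where "\<gamma> = polyline xs +++ linepath (last xs) (hd xs)"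
    have e_new: "e \<notin> walk_edges xs"
      using walk_edges_subset[of xs] xs(2) ne unfolding e_def by (cases xs) auto
    have CE: "C \<subseteq> E" using xs by (auto simp: C_def e_def)
    have finC: "finite C" by (simp add: C_def)
    have lh: "last xs \<noteq> hd xs" using xs(4) E(3) by metis
    have loop: "pathfinish \<gamma> = pathstart \<gamma>"
      using ne by (simp add: \<gamma>_def)
    have image: "path_image \<gamma> = (\<Union>(a, b)\<in>C. closed_segment a b)"
      using ne xs(1) by (auto simp: \<gamma>_def path_image_join path_image_polyline C_def e_def)
    have simple: "simple_path \<gamma>"
      unfolding \<gamma>_def
    proof (rule simple_path_join_loop)
      show "arc (polyline xs)"
        by (rule arc_polyline[OF xs(1,2) edges_separated_mono[OF E(4) xs(3)]])
      show "path_image (polyline xs) \<inter> path_image (linepath (last xs) (hd xs))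
          \<subseteq> {pathstart (polyline xs), pathstart (linepath (last xs) (hd xs))}"
      proof
        fix p assume p: "p \<in> path_image (polyline xs) \<inter> path_image (linepath (last xs) (hd xs))"
        then obtain x y where xy: "(x, y) \<in> walk_edges xs" "p \<in> closed_segment x y"
          using path_image_polyline[OF xs(1)] by auto
        then have "p \<in> {last xs, hd xs}"
          using edges_separatedD[OF E(4) xs(4), of x y p] xs(3) e_new p unfolding e_def by auto
        then show "p \<in> {pathstart (polyline xs), pathstart (linepath (last xs) (hd xs))}"
          using ne by auto
      qed
    qed (use ne lh in auto)
    have lips: "\<exists>L. L-lipschitz_on {0..1} \<gamma>"
      unfolding \<gamma>_def using ne
      by (intro lipschitz_on_joinpaths lipschitz_on_polyline lipschitz_on_linepath) auto
    have wind: "winding_number \<gamma> z = (\<Sum>(a, b)\<in>C. winding_number (linepath a b) z)"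
      if "z \<notin> path_image \<gamma>" for z
    proof -
      have "z \<notin> path_image (polyline xs)" "z \<notin> path_image (linepath (last xs) (hd xs))"
        using that ne by (auto simp: \<gamma>_def path_image_join)
      then show ?thesis
        unfolding \<gamma>_def C_def using ne e_new winding_number_polyline[OF xs(1,2)]
        by (simp add: winding_number_join e_def)
    qed
    have balC: "(\<Sum>(a, b)\<in>C. \<phi> b - \<phi> a) = 0" for \<phi> :: "complex \<Rightarrow> real"
      unfolding C_def using e_new sum_walk_edges_telescope[OF ne xs(2), of \<phi>]
      by (simp add: e_def)
    have "balanced (E - C)"
      unfolding balanced_def
    proof
      fix \<phi> :: "complex \<Rightarrow> real"
      have "(\<Sum>(a, b)\<in>E. \<phi> b - \<phi> a) = 0"
        using E(2) unfolding balanced_def by blast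
      then show "(\<Sum>(a, b)\<in>E - C. \<phi> b - \<phi> a) = 0"
        using balC[of \<phi>] by (simp add: sum_diff[OF E(1) CE])
    qed
    moreover have "E - C \<subset> E" using xs(4) CE unfolding C_def e_def by auto
    moreover have "edges_separated (E - C)" by (rule edges_separated_mono[OF E(4)]) auto
    ultimately obtain \<Gamma> where \<Gamma>: "finite \<Gamma>"
      "\<forall>\<gamma>\<in>\<Gamma>. simple_path \<gamma> \<and> pathfinish \<gamma> = pathstart \<gamma> \<and> (\<exists>L. L-lipschitz_on {0..1} \<gamma>)"
      "(\<Union>\<gamma>\<in>\<Gamma>. path_image \<gamma>) = (\<Union>(a, b)\<in>E - C. closed_segment a b)"
      "\<forall>z. z \<notin> (\<Union>(a, b)\<in>E - C. closed_segment a b) \<longrightarrow>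
        (\<Sum>\<gamma>\<in>\<Gamma>. winding_number \<gamma> z) = (\<Sum>(a, b)\<in>E - C. winding_number (linepath a b) z)"
      using psubset.IH[of "E - C"] E(3) by auto
    \<comment> \<open>\<open>\<Gamma>\<close> is a set, so that \<open>\<gamma>\<close> must be new to contribute to the sum: the midpoint of \<open>e\<close> lies on \<open>\<gamma>\<close>,
      but on no remaining edge.\<close>
    have new: "\<gamma> \<notin> \<Gamma>"
    proof
      assume "\<gamma> \<in> \<Gamma>"
      define m where "m = midpoint (last xs) (hd xs)"
      have m: "m \<in> closed_segment (last xs) (hd xs)"
        unfolding m_def by (rule midpoint_in_closed_segment)
      then have "m \<in> path_image \<gamma>" unfolding image C_def e_def by auto
      then obtain x y where xy: "(x, y) \<in> E - C" "m \<in> closed_segment x y"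
        using \<open>\<gamma> \<in> \<Gamma>\<close> \<Gamma>(3) by blast
      then have "m \<in> {last xs, hd xs}"
        using edges_separatedD[OF E(4) xs(4), of x y m] m unfolding C_def e_def by auto
      with lh show False unfolding m_def by (auto simp: midpoint_eq_endpoint)
    qed
    have un: "(\<Union>(a, b)\<in>E. closed_segment a b) = (\<Union>(a, b)\<in>C. closed_segment a b) \<union> (\<Union>(a, b)\<in>E - C. closed_segment a b)"
      using CE by auto
    show ?thesis
    proof (intro exI[of _ "insert \<gamma> \<Gamma>"] conjI)
      show "\<forall>z. z \<notin> (\<Union>(a, b)\<in>E. closed_segment a b) \<longrightarrow>
        (\<Sum>\<gamma>\<in>insert \<gamma> \<Gamma>. winding_number \<gamma> z) = (\<Sum>(a, b)\<in>E. winding_number (linepath a b) z)"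
      proof (intro allI impI)
        fix z assume z: "z \<notin> (\<Union>(a, b)\<in>E. closed_segment a b)"
        then have z': "z \<notin> path_image \<gamma>" "z \<notin> (\<Union>(a, b)\<in>E - C. closed_segment a b)"
          unfolding image un by blast+
        have "(\<Sum>\<gamma>\<in>insert \<gamma> \<Gamma>. winding_number \<gamma> z) = winding_number \<gamma> z + (\<Sum>\<gamma>\<in>\<Gamma>. winding_number \<gamma> z)"
          using \<Gamma>(1) new by simp
        also have "\<dots> = (\<Sum>(a, b)\<in>C. winding_number (linepath a b) z) + (\<Sum>(a, b)\<in>E - C. winding_number (linepath a b) z)"
          using wind[OF z'(1)] \<Gamma>(4) z'(2) by simp
        also have "\<dots> = (\<Sum>(a, b)\<in>E. winding_number (linepath a b) z)"
          using sum.subset_diff[OF CE E(1), of "\<lambda>(a, b). winding_number (linepath a b) z"] by (simp add: add.commute)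
        finally show "(\<Sum>\<gamma>\<in>insert \<gamma> \<Gamma>. winding_number \<gamma> z) = (\<Sum>(a, b)\<in>E. winding_number (linepath a b) z)" .
      qed
    qed (use \<Gamma> simple loop lips image un in auto)
  qed
qed

section \<open>Existence of contours around a compact set\<close>

definition grid_point :: "real \<Rightarrow> int \<times> int \<Rightarrow> complex" where
  "grid_point \<delta> p = Complex (\<delta> * of_int (fst p)) (\<delta> * of_int (snd p))"

definition grid_cell :: "real \<Rightarrow> int \<times> int \<Rightarrow> complex set" where
  "grid_cell \<delta> q = cbox (grid_point \<delta> q) (grid_point \<delta> (fst q + 1, snd q + 1))"

definition open_grid_cell :: "real \<Rightarrow> int \<times> int \<Rightarrow> complex set" where
  "open_grid_cell \<delta> q = box (grid_point \<delta> q) (grid_point \<delta> (fst q + 1, snd q + 1))"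

text \<open>The edges of a cell, oriented counterclockwise.\<close>

definition cell_edges :: "int \<times> int \<Rightarrow> ((int \<times> int) \<times> (int \<times> int)) set" where
  "cell_edges q = (case q of (i, j) \<Rightarrow>
     {((i, j), (i + 1, j)), ((i + 1, j), (i + 1, j + 1)),
      ((i + 1, j + 1), (i, j + 1)), ((i, j + 1), (i, j))})"

definition all_edges :: "(int \<times> int) set \<Rightarrow> ((int \<times> int) \<times> (int \<times> int)) set" where
  "all_edges A = (\<Union>q\<in>A. cell_edges q)"

definition boundary_edges :: "(int \<times> int) set \<Rightarrow> ((int \<times> int) \<times> (int \<times> int)) set" where
  "boundary_edges A = {e \<in> all_edges A. prod.swap e \<notin> all_edges A}"

lemma mem_grid_cell:
  "z \<in> grid_cell \<delta> (i, j) \<longleftrightarrow> \<delta> * of_int i \<le> Re z \<and> Re z \<le> \<delta> * (of_int i + 1) \<and>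
     \<delta> * of_int j \<le> Im z \<and> Im z \<le> \<delta> * (of_int j + 1)"
  by (auto simp: grid_cell_def grid_point_def in_cbox_complex_iff)

lemma mem_open_grid_cell:
  "z \<in> open_grid_cell \<delta> (i, j) \<longleftrightarrow> \<delta> * of_int i < Re z \<and> Re z < \<delta> * (of_int i + 1) \<and>
     \<delta> * of_int j < Im z \<and> Im z < \<delta> * (of_int j + 1)"
  by (auto simp: open_grid_cell_def grid_point_def in_box_complex_iff)

lemma scaled_int_cases:
  fixes \<delta> x :: real
  assumes "\<delta> > 0" "\<delta> * of_int i \<le> x" "x \<le> \<delta> * (of_int k + 1)"
  shows "i \<le> k + 1" "i = k + 1 \<Longrightarrow> x = \<delta> * of_int i"
proof -
  have "\<delta> * of_int i \<le> \<delta> * of_int (k + 1)"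
    using order_trans[OF assms(2,3)] by simp
  then show "i \<le> k + 1"
    using assms(1) by (simp del: of_int_add)
  show "x = \<delta> * of_int i" if "i = k + 1"
    using assms(2,3) that by simp
qed

lemma scaled_int_strict:
  fixes \<delta> x :: real
  assumes "\<delta> > 0" "\<delta> * of_int i < x" "x \<le> \<delta> * (of_int k + 1)"
  shows "i \<le> k"
proof -
  have "\<delta> * of_int i < \<delta> * of_int (k + 1)"
    using less_le_trans[OF assms(2,3)] by simp
  then show ?thesis
    using assms(1) by (simp del: of_int_add)
qed

lemma open_grid_cell_unique:
  assumes "\<delta> > 0" "z \<in> open_grid_cell \<delta> p" "z \<in> grid_cell \<delta> q"
  shows "p = q"
proof -
  obtain i j k l where pq: "p = (i, j)" "q = (k, l)" by (cases p, cases q)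
  have p: "\<delta> * of_int i < Re z" "Re z < \<delta> * (of_int i + 1)" "\<delta> * of_int j < Im z" "Im z < \<delta> * (of_int j + 1)"
    and q: "\<delta> * of_int k \<le> Re z" "Re z \<le> \<delta> * (of_int k + 1)" "\<delta> * of_int l \<le> Im z" "Im z \<le> \<delta> * (of_int l + 1)"
    using assms(2,3) by (simp_all add: pq mem_grid_cell mem_open_grid_cell)
  have "i \<le> k" "j \<le> l"
    using scaled_int_strict[OF assms(1)] p q by blast+
  moreover have "k \<le> i + 1" "l \<le> j + 1" "k \<noteq> i + 1" "l \<noteq> j + 1"
    using scaled_int_cases[OF assms(1) q(1), of i] scaled_int_cases[OF assms(1) q(3), of j] p by auto
  ultimately show ?thesis by (simp add: pq)
qed

lemma open_grid_cell_dense: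
  assumes "\<delta> > 0" "z \<in> grid_cell \<delta> q" "open W" "z \<in> W"
  obtains u where "u \<in> open_grid_cell \<delta> q" "u \<in> W"
proof -
  have "open_grid_cell \<delta> q \<noteq> {}"
    unfolding open_grid_cell_def using assms(1)
    by (auto simp: box_ne_empty grid_point_def Basis_complex_def)
  then have "closure (open_grid_cell \<delta> q) = grid_cell \<delta> q"
    unfolding open_grid_cell_def grid_cell_def by (rule closure_box)
  then have "W \<inter> open_grid_cell \<delta> q \<noteq> {}"
    using assms open_Int_closure_eq_empty[of W "open_grid_cell \<delta> q"] by blast
  then show ?thesis using that by blast
qed

lemma grid_cells_cover:
  assumes "\<delta> > 0"
  obtains q where "z \<in> grid_cell \<delta> q"
proof -
  have "\<delta> * of_int \<lfloor>x / \<delta>\<rfloor> \<le> x \<and> x \<le> \<delta> * (of_int \<lfloor>x / \<delta>\<rfloor> + 1)" for x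
  proof -
    have "of_int \<lfloor>x / \<delta>\<rfloor> \<le> x / \<delta>" "x / \<delta> \<le> of_int \<lfloor>x / \<delta>\<rfloor> + 1"
      by linarith+
    then show ?thesis
      using assms by (simp only: pos_le_divide_eq pos_divide_le_eq mult.commute[of \<delta>])
  qed
  then have "z \<in> grid_cell \<delta> (\<lfloor>Re z / \<delta>\<rfloor>, \<lfloor>Im z / \<delta>\<rfloor>)"
    by (simp add: mem_grid_cell)
  then show ?thesis by (rule that)
qed

lemma grid_point_inject [simp]: "\<delta> > 0 \<Longrightarrow> grid_point \<delta> p = grid_point \<delta> q \<longleftrightarrow> p = q"
  by (auto simp: grid_point_def prod_eq_iff)

text \<open>Unoriented edges are given by their lower left end point and a flag for the direction.\<close>

definition unit_step :: "bool \<Rightarrow> int \<times> int" where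
  "unit_step h = (if h then (1, 0) else (0, 1))"

definition is_grid_edge :: "(int \<times> int) \<Rightarrow> bool \<Rightarrow> (int \<times> int) \<times> (int \<times> int) \<Rightarrow> bool" where
  "is_grid_edge p h e \<longleftrightarrow> e = (p, p + unit_step h) \<or> e = (p + unit_step h, p)"

lemma all_edges_is_grid_edge: "e \<in> all_edges A \<Longrightarrow> \<exists>p h. is_grid_edge p h e"
  unfolding all_edges_def cell_edges_def is_grid_edge_def unit_step_def
  by (auto split: prod.splits) (force intro: exI[of _ True] exI[of _ False])+

lemma grid_segment_horizontal:
  assumes "\<delta> > 0" "z \<in> closed_segment (grid_point \<delta> (i, j)) (grid_point \<delta> ((i, j) + unit_step True))"
  shows "Im z = \<delta> * of_int j" "\<delta> * of_int i \<le> Re z" "Re z \<le> \<delta> * (of_int i + 1)"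
proof -
  obtain u where u: "0 \<le> u" "u \<le> 1"
    "z = (1 - u) *\<^sub>R grid_point \<delta> (i, j) + u *\<^sub>R grid_point \<delta> ((i, j) + unit_step True)"
    using assms(2) by (auto simp: in_segment)
  have "Im z = \<delta> * of_int j" "Re z = \<delta> * of_int i + \<delta> * u"
    unfolding u(3) by (simp_all add: grid_point_def unit_step_def algebra_simps)
  moreover have "0 \<le> \<delta> * u" "\<delta> * u \<le> \<delta> * 1"
    using u assms(1) by (simp_all only: mult_left_mono less_imp_le mult_nonneg_nonneg)
  ultimately show "Im z = \<delta> * of_int j" "\<delta> * of_int i \<le> Re z" "Re z \<le> \<delta> * (of_int i + 1)"
    by (simp_all add: algebra_simps)
qed

lemma grid_segment_vertical:
  assumes "\<delta> > 0" "z \<in> closed_segment (grid_point \<delta> (i, j)) (grid_point \<delta> ((i, j) + unit_step False))"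
  shows "Re z = \<delta> * of_int i" "\<delta> * of_int j \<le> Im z" "Im z \<le> \<delta> * (of_int j + 1)"
proof -
  obtain u where u: "0 \<le> u" "u \<le> 1"
    "z = (1 - u) *\<^sub>R grid_point \<delta> (i, j) + u *\<^sub>R grid_point \<delta> ((i, j) + unit_step False)"
    using assms(2) by (auto simp: in_segment)
  have "Re z = \<delta> * of_int i" "Im z = \<delta> * of_int j + \<delta> * u"
    unfolding u(3) by (simp_all add: grid_point_def unit_step_def algebra_simps)
  moreover have "0 \<le> \<delta> * u" "\<delta> * u \<le> \<delta> * 1"
    using u assms(1) by (simp_all only: mult_left_mono less_imp_le mult_nonneg_nonneg)
  ultimately show "Re z = \<delta> * of_int i" "\<delta> * of_int j \<le> Im z" "Im z \<le> \<delta> * (of_int j + 1)"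
    by (simp_all add: algebra_simps)
qed

text \<open>Distinct integers differ by at least \<open>1\<close>, so that distinct grid intervals cannot overlap in more than a point.\<close>

lemma scaled_int_overlap:
  fixes \<delta> x :: real
  assumes "\<delta> > 0" "\<delta> * of_int i \<le> x" "x \<le> \<delta> * (of_int i + 1)"
    and "\<delta> * of_int k \<le> x" "x \<le> \<delta> * (of_int k + 1)" "i \<noteq> k"
  shows "(i = k + 1 \<and> x = \<delta> * of_int i) \<or> (k = i + 1 \<and> x = \<delta> * of_int k)"
  using scaled_int_cases[OF assms(1,2,5)] scaled_int_cases[OF assms(1,4,3)] assms(6) by fastforce

lemma grid_segments_meet:
  assumes \<delta>: "\<delta> > 0" and ne: "(p, h) \<noteq> (q, k)"
    and z: "z \<in> closed_segment (grid_point \<delta> p) (grid_point \<delta> (p + unit_step h))"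
      "z \<in> closed_segment (grid_point \<delta> q) (grid_point \<delta> (q + unit_step k))"
  shows "z \<in> {grid_point \<delta> p, grid_point \<delta> (p + unit_step h)} \<inter> {grid_point \<delta> q, grid_point \<delta> (q + unit_step k)}"
proof -
  obtain i j l m where pq: "p = (i, j)" "q = (l, m)" by (cases p, cases q)
  have at: "z = grid_point \<delta> r \<longleftrightarrow> Re z = \<delta> * of_int (fst r) \<and> Im z = \<delta> * of_int (snd r)" for r
    by (auto simp: grid_point_def complex_eq_iff)
  have inj: "\<delta> * of_int a = \<delta> * of_int b \<longleftrightarrow> a = b" for a b :: int
    using \<delta> by simp
  show ?thesis
  proof (cases h; cases k)
    assume hk: h k
    note a = grid_segment_horizontal[OF \<delta>, of z i j] and b = grid_segment_horizontal[OF \<delta>, of z l m]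
    have "j = m" using a(1) b(1) z hk inj by (simp add: pq)
    moreover have "(i = l + 1 \<and> Re z = \<delta> * of_int i) \<or> (l = i + 1 \<and> Re z = \<delta> * of_int l)"
      using a b z hk ne \<open>j = m\<close> by (intro scaled_int_overlap[OF \<delta>]) (auto simp: pq)
    ultimately show ?thesis
      using a(1) z hk by (auto simp: at pq unit_step_def)
  next
    assume hk: "\<not> h" "\<not> k"
    note a = grid_segment_vertical[OF \<delta>, of z i j] and b = grid_segment_vertical[OF \<delta>, of z l m]
    have "i = l" using a(1) b(1) z hk inj by (simp add: pq)
    moreover have "(j = m + 1 \<and> Im z = \<delta> * of_int j) \<or> (m = j + 1 \<and> Im z = \<delta> * of_int m)"
      using a b z hk ne \<open>i = l\<close> by (intro scaled_int_overlap[OF \<delta>]) (auto simp: pq)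
    ultimately show ?thesis
      using a(1) z hk by (auto simp: at pq unit_step_def)
  next
    assume hk: h "\<not> k"
    note a = grid_segment_horizontal[OF \<delta>, of z i j] and b = grid_segment_vertical[OF \<delta>, of z l m]
    have a': "Im z = \<delta> * of_int j" "\<delta> * of_int i \<le> Re z" "Re z \<le> \<delta> * (of_int i + 1)"
      and b': "Re z = \<delta> * of_int l" "\<delta> * of_int m \<le> Im z" "Im z \<le> \<delta> * (of_int m + 1)"
      using a b z hk by (simp_all add: pq)
    have "\<delta> * of_int i \<le> \<delta> * of_int l" "\<delta> * of_int m \<le> \<delta> * of_int j"
      using a' b' by simp_all
    then have "i \<le> l" "m \<le> j" using \<delta> by simp_all
    moreover have "l \<le> i + 1" "j \<le> m + 1"
      using scaled_int_cases(1)[OF \<delta>, of l "Re z" i] scaled_int_cases(1)[OF \<delta>, of j "Im z" m] a' b' by auto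
    ultimately have "(l = i \<or> l = i + 1) \<and> (j = m \<or> j = m + 1)" by auto
    then show ?thesis
      using a'(1) b'(1) hk by (auto simp: at pq unit_step_def)
  next
    assume hk: "\<not> h" k
    note a = grid_segment_vertical[OF \<delta>, of z i j] and b = grid_segment_horizontal[OF \<delta>, of z l m]
    have a': "Re z = \<delta> * of_int i" "\<delta> * of_int j \<le> Im z" "Im z \<le> \<delta> * (of_int j + 1)"
      and b': "Im z = \<delta> * of_int m" "\<delta> * of_int l \<le> Re z" "Re z \<le> \<delta> * (of_int l + 1)"
      using a b z hk by (simp_all add: pq)
    have "\<delta> * of_int l \<le> \<delta> * of_int i" "\<delta> * of_int j \<le> \<delta> * of_int m"
      using a' b' by simp_all
    then have "l \<le> i" "j \<le> m" using \<delta> by simp_all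
    moreover have "i \<le> l + 1" "m \<le> j + 1"
      using scaled_int_cases(1)[OF \<delta>, of i "Re z" l] scaled_int_cases(1)[OF \<delta>, of m "Im z" j] a' b' by auto
    ultimately have "(i = l \<or> i = l + 1) \<and> (m = j \<or> m = j + 1)" by auto
    then show ?thesis
      using a'(1) b'(1) hk by (auto simp: at pq unit_step_def)
  qed
qed

lemma edges_separated_boundary:
  assumes "\<delta> > 0"
  shows "edges_separated (map_prod (grid_point \<delta>) (grid_point \<delta>) ` boundary_edges A)"
proof -
  have "z \<in> {grid_point \<delta> a, grid_point \<delta> b} \<inter> {grid_point \<delta> c, grid_point \<delta> d}"
    if e: "(a, b) \<in> boundary_edges A" and f: "(c, d) \<in> boundary_edges A" and ne: "(a, b) \<noteq> (c, d)"
      and z: "z \<in> closed_segment (grid_point \<delta> a) (grid_point \<delta> b)" "z \<in> closed_segment (grid_point \<delta> c) (grid_point \<delta> d)"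
    for a b c d z
  proof -
    obtain p h where p: "is_grid_edge p h (a, b)"
      using all_edges_is_grid_edge[of "(a, b)" A] e by (auto simp: boundary_edges_def)
    obtain q k where q: "is_grid_edge q k (c, d)"
      using all_edges_is_grid_edge[of "(c, d)" A] f by (auto simp: boundary_edges_def)
    have "(a, b) \<noteq> (d, c)"
      using e f by (auto simp: boundary_edges_def)
    then have "(p, h) \<noteq> (q, k)"
      using p q ne unfolding is_grid_edge_def by (metis prod.inject)
    moreover have "z \<in> closed_segment (grid_point \<delta> p) (grid_point \<delta> (p + unit_step h))"
      using p z(1) by (auto simp: is_grid_edge_def closed_segment_commute)
    moreover have "z \<in> closed_segment (grid_point \<delta> q) (grid_point \<delta> (q + unit_step k))"
      using q z(2) by (auto simp: is_grid_edge_def closed_segment_commute)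
    ultimately have "z \<in> {grid_point \<delta> p, grid_point \<delta> (p + unit_step h)} \<inter> {grid_point \<delta> q, grid_point \<delta> (q + unit_step k)}"
      by (rule grid_segments_meet[OF assms])
    then show ?thesis
      using p q by (auto simp: is_grid_edge_def)
  qed
  then show ?thesis
    unfolding edges_separated_def by (fastforce simp: map_prod_def)
qed

lemma finite_cell_edges [simp]: "finite (cell_edges q)"
  by (simp add: cell_edges_def split: prod.splits)

lemma finite_all_edges: "finite A \<Longrightarrow> finite (all_edges A)"
  by (simp add: all_edges_def)

lemma sum_cell_edges:
  fixes f :: "int \<times> int \<Rightarrow> int \<times> int \<Rightarrow> 'b::ab_group_add"
  shows "(\<Sum>(a, b)\<in>cell_edges (i, j). f a b) =
    f (i, j) (i + 1, j) + f (i + 1, j) (i + 1, j + 1) + f (i + 1, j + 1) (i, j + 1) + f (i, j + 1) (i, j)"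
  by (simp add: cell_edges_def algebra_simps)

text \<open>Edges shared by two cells cancel, being traversed in opposite directions.\<close>

lemma sum_boundary_edges:
  fixes f :: "int \<times> int \<Rightarrow> int \<times> int \<Rightarrow> 'b::real_vector"
  assumes A: "finite A" and f: "\<And>a b. (a, b) \<in> all_edges A \<Longrightarrow> f b a = - f a b"
  shows "(\<Sum>(a, b)\<in>boundary_edges A. f a b) = (\<Sum>q\<in>A. \<Sum>(a, b)\<in>cell_edges q. f a b)"
proof -
  define I where "I = all_edges A - boundary_edges A"
  have sw: "prod.swap e \<in> I" if "e \<in> I" for e
    using that by (auto simp: I_def boundary_edges_def)
  have "(\<Sum>(a, b)\<in>I. f a b) = (\<Sum>(a, b)\<in>I. f b a)"
    by (rule sum.reindex_bij_witness[of _ prod.swap prod.swap]) (use sw in auto)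
  also have "\<dots> = - (\<Sum>(a, b)\<in>I. f a b)"
    unfolding sum_negf[symmetric] by (rule sum.cong) (use f in \<open>auto simp: I_def\<close>)
  finally have "(\<Sum>(a, b)\<in>I. f a b) = 0"
    by (simp add: eq_neg_iff_add_eq_0 scaleR_2[symmetric])
  moreover have "(\<Sum>(a, b)\<in>all_edges A. f a b) = (\<Sum>(a, b)\<in>I. f a b) + (\<Sum>(a, b)\<in>boundary_edges A. f a b)"
    unfolding I_def by (rule sum.subset_diff) (auto simp: boundary_edges_def finite_all_edges A)
  moreover have "(\<Sum>(a, b)\<in>all_edges A. f a b) = (\<Sum>q\<in>A. \<Sum>(a, b)\<in>cell_edges q. f a b)"
    unfolding all_edges_def
  proof (rule sum.UNION_disjoint[OF A])
    show "\<forall>p\<in>A. \<forall>q\<in>A. p \<noteq> q \<longrightarrow> cell_edges p \<inter> cell_edges q = {}"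
      by (auto simp: cell_edges_def split: prod.splits)
  qed simp
  ultimately show ?thesis by simp
qed

lemma balanced_boundary_edges:
  assumes "finite A" "\<delta> > 0"
  shows "balanced (map_prod (grid_point \<delta>) (grid_point \<delta>) ` boundary_edges A)"
  unfolding balanced_def
proof
  fix \<phi> :: "complex \<Rightarrow> real"
  let ?v = "grid_point \<delta>"
  have "inj_on (map_prod ?v ?v) (boundary_edges A)"
    using assms(2) by (auto simp: inj_on_def)
  then have "(\<Sum>(a, b)\<in>map_prod ?v ?v ` boundary_edges A. \<phi> b - \<phi> a) = (\<Sum>(a, b)\<in>boundary_edges A. \<phi> (?v b) - \<phi> (?v a))"
    by (simp add: sum.reindex case_prod_unfold)
  also have "\<dots> = (\<Sum>q\<in>A. \<Sum>(a, b)\<in>cell_edges q. \<phi> (?v b) - \<phi> (?v a))"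
    by (rule sum_boundary_edges[OF assms(1)]) simp
  also have "\<dots> = 0"
    by (rule sum.neutral) (auto simp: sum_cell_edges)
  finally show "(\<Sum>(a, b)\<in>map_prod ?v ?v ` boundary_edges A. \<phi> b - \<phi> a) = 0" .
qed

lemma cell_edge_segment:
  assumes "\<delta> > 0" "(a, b) \<in> cell_edges q" "z \<in> closed_segment (grid_point \<delta> a) (grid_point \<delta> b)"
  shows "z \<in> grid_cell \<delta> q" "z \<notin> open_grid_cell \<delta> p"
proof -
  obtain i j where q: "q = (i, j)" by (cases q)
  have "path_image (rectpath (grid_point \<delta> (i, j)) (grid_point \<delta> (i + 1, j + 1)))
      = grid_cell \<delta> (i, j) - open_grid_cell \<delta> (i, j)"
    unfolding grid_cell_def open_grid_cell_def
    by (subst path_image_rectpath_cbox_minus_box) (use assms(1) in \<open>auto simp: grid_point_def\<close>)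
  moreover have "z \<in> path_image (rectpath (grid_point \<delta> (i, j)) (grid_point \<delta> (i + 1, j + 1)))"
    using assms(2,3) by (auto simp: q cell_edges_def rectpath_def Let_def path_image_join grid_point_def)
  ultimately show z: "z \<in> grid_cell \<delta> q" and "z \<notin> open_grid_cell \<delta> p"
    using open_grid_cell_unique[OF assms(1), of z p q] q by auto
qed

lemma reversed_cell_edge: "(a, b) \<in> cell_edges q \<Longrightarrow> \<exists>q'. (b, a) \<in> cell_edges q'"
proof -
  assume e: "(a, b) \<in> cell_edges q"
  obtain i j where q: "q = (i, j)" by (cases q)
  have "(b, a) \<in> cell_edges (i, j - 1) \<or> (b, a) \<in> cell_edges (i + 1, j) \<or>
      (b, a) \<in> cell_edges (i, j + 1) \<or> (b, a) \<in> cell_edges (i - 1, j)"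
    using e by (auto simp: q cell_edges_def)
  then show ?thesis by blast
qed

lemma winding_number_cell:
  assumes \<delta>: "\<delta> > 0" and z: "z \<in> open_grid_cell \<delta> p"
  shows "(\<Sum>(a, b)\<in>cell_edges q. winding_number (linepath (grid_point \<delta> a) (grid_point \<delta> b)) z)
    = (if p = q then 1 else 0)"
proof -
  obtain i j where q: "q = (i, j)" by (cases q)
  define L where "L a b = linepath (grid_point \<delta> a) (grid_point \<delta> b)" for a b
  have rect: "rectpath (grid_point \<delta> (i, j)) (grid_point \<delta> (i + 1, j + 1)) =
      L (i, j) (i + 1, j) +++ L (i + 1, j) (i + 1, j + 1) +++ L (i + 1, j + 1) (i, j + 1) +++ L (i, j + 1) (i, j)"
    by (simp add: rectpath_def Let_def grid_point_def L_def)
  have off: "z \<notin> path_image (L a b)" if "(a, b) \<in> cell_edges q" for a b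
    using cell_edge_segment(2)[OF \<delta> that] z unfolding L_def by (metis path_image_linepath)
  have "(\<Sum>(a, b)\<in>cell_edges q. winding_number (L a b) z)
      = winding_number (rectpath (grid_point \<delta> (i, j)) (grid_point \<delta> (i + 1, j + 1))) z"
    unfolding rect q sum_cell_edges using off
    by (simp add: winding_number_join path_image_join q cell_edges_def L_def)
  also have "\<dots> = (if p = q then 1 else 0)"
  proof (cases "p = q")
    case True
    then show ?thesis
      using z by (simp add: q open_grid_cell_def winding_number_rectpath)
  next
    case False
    then have "z \<notin> grid_cell \<delta> (i, j)"
      using open_grid_cell_unique[OF \<delta> z] q by auto
    then show ?thesis
      using False \<delta> by (simp add: grid_cell_def winding_number_rectpath_outside grid_point_def)
  qed
  finally show ?thesis unfolding L_def .
qed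

text \<open>
  Take the cells of a fine square grid that come close to \<open>K\<close>, and let \<open>B\<close> be the union of the edges between
  chosen and other cells. The edges form a balanced graph, whose Jordan polygons have total winding
  number \<open>w = 1\<close> in chosen open cells and \<open>w = 0\<close> in all others. The region \<open>\<Omega>\<close> is then defined as the set where
  \<open>w = 1\<close>, which avoids any description of how the cells meet along edges and at corners: \<open>w\<close> is
  continuous off \<open>B\<close> and is thus determined by its values in the open cells.
\<close>

theorem spectral_contour_exists:
  assumes K: "compact K" and U: "open U" "K \<subseteq> U"
  shows "\<exists>\<Omega> \<Gamma>. spectral_contour U K \<Omega> \<Gamma>"
proof -
  obtain \<epsilon> where \<epsilon>: "\<epsilon> > 0" "(\<Union>x\<in>K. cball x \<epsilon>) \<subseteq> U"
    using compact_subset_open_imp_cball_epsilon_subset[OF K U] .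
  define \<delta> where "\<delta> = \<epsilon> / 4"
  have \<delta>: "\<delta> > 0" using \<epsilon> by (simp add: \<delta>_def)
  \<comment> \<open>Cells near \<open>K\<close> rather than cells meeting \<open>K\<close>: then \<open>K\<close> is interior to their union.\<close>
  define A where "A = {q. \<exists>x\<in>K. \<exists>y\<in>grid_cell \<delta> q. dist x y \<le> \<delta>}"
  define W where "W = (\<Union>q\<in>A. grid_cell \<delta> q)"
  define E where "E = boundary_edges A"
  define v where "v = grid_point \<delta>"
  define B where "B = (\<Union>(a, b)\<in>E. closed_segment (v a) (v b))"
  have "finite A"
  proof -
    obtain N where N: "\<And>x. x \<in> K \<Longrightarrow> cmod x \<le> N"
      using compact_imp_bounded[OF K] unfolding bounded_iff by blast
    define m where "m = \<lceil>(N + \<delta>) / \<delta>\<rceil>"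
    have bound: "i \<in> {- m - 1..m}" if "\<delta> * of_int i \<le> t" "t \<le> \<delta> * (of_int i + 1)" "\<bar>t\<bar> \<le> N + \<delta>" for i :: int and t
    proof -
      have m: "N + \<delta> \<le> \<delta> * of_int m"
        using \<delta> le_of_int_ceiling[of "(N + \<delta>) / \<delta>"] unfolding m_def
        by (simp only: pos_divide_le_eq mult.commute[of \<delta>])
      have "\<delta> * of_int i \<le> \<delta> * of_int m" "\<delta> * of_int (- m) \<le> \<delta> * of_int (i + 1)"
        using that m by auto
      then show ?thesis using \<delta> by (simp del: of_int_add of_int_minus)
    qed
    have "A \<subseteq> {- m - 1..m} \<times> {- m - 1..m}"
    proof
      fix q assume "q \<in> A"
      then obtain x y where xy: "x \<in> K" "y \<in> grid_cell \<delta> q" "dist x y \<le> \<delta>"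
        by (auto simp: A_def)
      have "cmod y \<le> N + \<delta>"
        using N[OF xy(1)] xy(3) norm_triangle_sub[of y x] by (simp add: dist_norm norm_minus_commute)
      then have "\<bar>Re y\<bar> \<le> N + \<delta>" "\<bar>Im y\<bar> \<le> N + \<delta>"
        using abs_Re_le_cmod[of y] abs_Im_le_cmod[of y] by linarith+
      then show "q \<in> {- m - 1..m} \<times> {- m - 1..m}"
        using xy(2) bound by (cases q) (auto simp: mem_grid_cell)
    qed
    then show ?thesis by (rule finite_subset) simp
  qed
  have WU: "W \<subseteq> U"
  proof
    fix z assume "z \<in> W"
    then obtain q x y where q: "x \<in> K" "y \<in> grid_cell \<delta> q" "dist x y \<le> \<delta>" "z \<in> grid_cell \<delta> q"
      by (auto simp: W_def A_def)
    have "\<bar>Re (y - z)\<bar> \<le> \<delta>" "\<bar>Im (y - z)\<bar> \<le> \<delta>"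
      using q(2,4) by (cases q; auto simp: mem_grid_cell algebra_simps abs_le_iff)+
    then have "dist y z \<le> 2 * \<delta>"
      using cmod_le[of "y - z"] by (simp add: dist_norm)
    then have "dist x z \<le> \<epsilon>"
      using q(3) dist_triangle[of x z y] \<epsilon>(1) unfolding \<delta>_def by linarith
    then have "z \<in> cball x \<epsilon>" by simp
    then show "z \<in> U" using \<epsilon>(2) q(1) by blast
  qed
  have "compact W"
    unfolding W_def grid_cell_def using \<open>finite A\<close> by (intro compact_UN) auto
  then have closedW: "closed W" by (rule compact_imp_closed)
  have KW: "K \<subseteq> interior W"
  proof
    fix x assume x: "x \<in> K"
    have "ball x \<delta> \<subseteq> W"
    proof
      fix y assume y: "y \<in> ball x \<delta>"
      obtain q where q: "y \<in> grid_cell \<delta> q" using grid_cells_cover[OF \<delta>] .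
      have "dist x y \<le> \<delta>" using y by simp
      then have "q \<in> A" using x q unfolding A_def by blast
      then show "y \<in> W" using q unfolding W_def by blast
    qed
    then show "x \<in> interior W" using \<delta> by (intro interiorI[of "ball x \<delta>"]) auto
  qed
  have E_cell: "\<exists>q\<in>A. (a, b) \<in> cell_edges q" if "(a, b) \<in> E" for a b
    using that by (auto simp: E_def boundary_edges_def all_edges_def)
  have openB: "z \<notin> B" if "z \<in> open_grid_cell \<delta> q" for z q
  proof
    assume "z \<in> B"
    then obtain a b where ab: "(a, b) \<in> E" "z \<in> closed_segment (v a) (v b)"
      unfolding B_def by auto
    then obtain p where "(a, b) \<in> cell_edges p" using E_cell by blast
    from cell_edge_segment(2)[OF \<delta> this, of z q] ab(2) that show False
      by (simp add: v_def)
  qed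
  have BW: "B \<subseteq> W"
  proof
    fix z assume "z \<in> B"
    then obtain a b where ab: "(a, b) \<in> E" "z \<in> closed_segment (v a) (v b)"
      unfolding B_def by auto
    then obtain p where p: "p \<in> A" "(a, b) \<in> cell_edges p" using E_cell by blast
    from cell_edge_segment(1)[OF \<delta> p(2), of z] ab(2) p(1) show "z \<in> W"
      unfolding W_def v_def by blast
  qed
  have BintW: "B \<inter> interior W = {}"
  proof (rule ccontr)
    assume "B \<inter> interior W \<noteq> {}"
    then obtain a b z where e: "(a, b) \<in> E" and z: "z \<in> closed_segment (v a) (v b)" "z \<in> interior W"
      by (auto simp: B_def)
    obtain q where q: "(b, a) \<in> cell_edges q"
      using E_cell[OF e] reversed_cell_edge by blast
    have "q \<notin> A"
      using q e by (auto simp: E_def boundary_edges_def all_edges_def)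
    have "z \<in> grid_cell \<delta> q"
      using cell_edge_segment(1)[OF \<delta> q] z(1) by (simp add: v_def closed_segment_commute)
    then obtain u where u: "u \<in> open_grid_cell \<delta> q" "u \<in> interior W"
      using open_grid_cell_dense[OF \<delta> _ open_interior z(2)] by blast
    then have "u \<in> W" using interior_subset by blast
    then show False
      using open_grid_cell_unique[OF \<delta> u(1)] \<open>q \<notin> A\<close> unfolding W_def by blast
  qed
  define E' where "E' = map_prod v v ` E"
  have B_eq: "B = (\<Union>(a, b)\<in>E'. closed_segment a b)"
    by (auto simp: B_def E'_def)
  have finE: "finite E" unfolding E_def boundary_edges_def using finite_all_edges[OF \<open>finite A\<close>] by simp
  have injE: "inj_on (map_prod v v) E" using \<delta> by (auto simp: inj_on_def v_def)
  have loopfree: "(a, a) \<notin> E'" for a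
  proof
    assume "(a, a) \<in> E'"
    then obtain p q where pq: "(p, q) \<in> E" "v p = v q"
      unfolding E'_def by auto
    have "p = q" using pq(2) \<delta> by (simp add: v_def)
    moreover obtain r where "(p, q) \<in> cell_edges r" using E_cell[OF pq(1)] by blast
    ultimately show False by (cases r) (auto simp: cell_edges_def)
  qed
  obtain \<Gamma> where \<Gamma>: "finite \<Gamma>"
    "\<And>\<gamma>. \<gamma> \<in> \<Gamma> \<Longrightarrow> simple_path \<gamma> \<and> pathfinish \<gamma> = pathstart \<gamma> \<and> (\<exists>L. L-lipschitz_on {0..1} \<gamma>)"
    "(\<Union>\<gamma>\<in>\<Gamma>. path_image \<gamma>) = B"
    "\<And>z. z \<notin> B \<Longrightarrow> (\<Sum>\<gamma>\<in>\<Gamma>. winding_number \<gamma> z) = (\<Sum>(a, b)\<in>E'. winding_number (linepath a b) z)"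
  proof -
    have "finite E'" "balanced E'" "edges_separated E'"
      unfolding E'_def E_def v_def
      using finE[unfolded E_def] balanced_boundary_edges[OF \<open>finite A\<close> \<delta>]
        edges_separated_boundary[OF \<delta>, of A] by simp_all
    from balanced_Jordan_decomposition[OF this(1,2) loopfree this(3)]
    show ?thesis unfolding B_eq[symmetric] using that by blast
  qed
  define w where "w z = (\<Sum>\<gamma>\<in>\<Gamma>. winding_number \<gamma> z)" for z
  have w_cell: "w z = (if q \<in> A then 1 else 0)" if z: "z \<in> open_grid_cell \<delta> q" for z q
  proof -
    have "w z = (\<Sum>(a, b)\<in>E. winding_number (linepath (v a) (v b)) z)"
      unfolding w_def \<Gamma>(4)[OF openB[OF z]] E'_def using injE by (simp add: sum.reindex case_prod_unfold)
    also have "\<dots> = (\<Sum>p\<in>A. \<Sum>(a, b)\<in>cell_edges p. winding_number (linepath (v a) (v b)) z)"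
      unfolding E_def
    proof (rule sum_boundary_edges[OF \<open>finite A\<close>])
      fix a b assume "(a, b) \<in> all_edges A"
      then obtain p where p: "(a, b) \<in> cell_edges p" by (auto simp: all_edges_def)
      have "z \<notin> path_image (linepath (v a) (v b))"
        using cell_edge_segment(2)[OF \<delta> p, of z q] z by (auto simp: v_def)
      then show "winding_number (linepath (v b) (v a)) z = - winding_number (linepath (v a) (v b)) z"
        using winding_number_reversepath[of "linepath (v a) (v b)" z] by simp
    qed
    also have "\<dots> = (\<Sum>p\<in>A. if q = p then 1 else 0)"
      unfolding v_def winding_number_cell[OF \<delta> z] ..
    also have "\<dots> = (if q \<in> A then 1 else 0)"
      using \<open>finite A\<close> by simp
    finally show ?thesis .
  qed
  have "compact B"
    unfolding B_def case_prod_unfold using finE by (intro compact_UN) auto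
  then have openCB: "open (- B)" by (simp add: compact_imp_closed open_Compl)
  have w_cont: "continuous_on (- B) w"
    unfolding w_def
  proof (intro continuous_on_sum)
    fix \<gamma> assume "\<gamma> \<in> \<Gamma>"
    then show "continuous_on (- B) (winding_number \<gamma>)"
      using \<Gamma>(2)[of \<gamma>] \<Gamma>(3) by (intro continuous_on_subset[OF continuous_on_winding_number])
        (auto dest: simple_path_imp_path)
  qed
  \<comment> \<open>Points of open cells are dense, so \<open>w\<close> is known everywhere by continuity.\<close>
  have generic: "w z \<in> S" if "open O'" "z \<in> O'" "z \<notin> B" "closed S"
    and S: "\<And>u q. u \<in> open_grid_cell \<delta> q \<Longrightarrow> u \<in> O' \<Longrightarrow> w u \<in> S" for O' z S
  proof (rule ccontr)
    assume "w z \<notin> S"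
    have "open (- B \<inter> w -` (- S))"
      using w_cont openCB \<open>closed S\<close> by (simp add: continuous_on_open_vimage Int_commute open_Compl)
    then have "open (O' \<inter> (- B \<inter> w -` (- S)))" using that(1) by blast
    moreover obtain q where "z \<in> grid_cell \<delta> q" using grid_cells_cover[OF \<delta>] .
    moreover have "z \<in> O' \<inter> (- B \<inter> w -` (- S))" using that \<open>w z \<notin> S\<close> by auto
    ultimately obtain u where "u \<in> open_grid_cell \<delta> q" "u \<in> O' \<inter> (- B \<inter> w -` (- S))"
      using open_grid_cell_dense[OF \<delta>] by metis
    then show False using S[of u q] by auto
  qed
  have w01: "w z \<in> {0, 1}" if "z \<notin> B" for z
    by (rule generic[of UNIV]) (use that w_cell in auto)
  have w_out: "w z = 0" if "z \<notin> W" for z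
  proof -
    have "w z \<in> {0}"
    proof (rule generic[of "- W"])
      show "w u \<in> {0}" if "u \<in> open_grid_cell \<delta> q" "u \<in> - W" for u q
      proof -
        have "u \<in> grid_cell \<delta> q"
          using that(1) by (cases q) (auto simp: mem_grid_cell mem_open_grid_cell)
        then have "q \<notin> A" using that(2) by (auto simp: W_def)
        then show ?thesis using w_cell[OF that(1)] by simp
      qed
    qed (use that closedW BW in auto)
    then show ?thesis by simp
  qed
  have w_in: "w z = 1" if "z \<in> interior W" for z
  proof -
    have "w z \<in> {1}"
    proof (rule generic[of "interior W"])
      show "w u \<in> {1}" if u: "u \<in> open_grid_cell \<delta> q" "u \<in> interior W" for u q
      proof -
        have "u \<in> W" using u(2) interior_subset by blast
        then obtain p where "p \<in> A" "u \<in> grid_cell \<delta> p" by (auto simp: W_def)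
        then have "q \<in> A" using open_grid_cell_unique[OF \<delta> u(1)] by blast
        then show ?thesis using w_cell[OF u(1)] by simp
      qed
    qed (use that BintW in auto)
    then show ?thesis by simp
  qed
  define \<Omega> where "\<Omega> = {z. z \<notin> B \<and> w z = 1}"
  have \<Omega>_alt: "\<Omega> = - B \<inter> w -` (- {0})"
    using w01 by (auto simp: \<Omega>_def)
  have open\<Omega>: "open \<Omega>"
    unfolding \<Omega>_alt using w_cont openCB
    by (simp add: continuous_on_open_vimage Int_commute open_Compl)
  have \<Omega>W: "\<Omega> \<subseteq> W" using w_out by (force simp: \<Omega>_def)
  have cl: "closure \<Omega> \<subseteq> \<Omega> \<union> B"
  proof
    fix z assume z: "z \<in> closure \<Omega>"
    have "z \<in> \<Omega>" if "z \<notin> B"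
    proof (rule ccontr)
      assume "z \<notin> \<Omega>"
      then have "z \<in> - B \<inter> w -` (- {1})" using that by (auto simp: \<Omega>_def)
      moreover have "open (- B \<inter> w -` (- {1}))"
        using w_cont openCB by (simp add: continuous_on_open_vimage Int_commute open_Compl)
      ultimately have "\<Omega> \<inter> (- B \<inter> w -` (- {1})) \<noteq> {}"
        using z by (meson closure_iff_nhds_not_empty order_refl)
      then show False by (auto simp: \<Omega>_def)
    qed
    then show "z \<in> \<Omega> \<union> B" by blast
  qed
  have Bcl: "B \<subseteq> closure \<Omega>"
  proof
    fix z assume "z \<in> B"
    then obtain a b where e: "(a, b) \<in> E" "z \<in> closed_segment (v a) (v b)" by (auto simp: B_def)
    obtain q where q: "q \<in> A" "(a, b) \<in> cell_edges q" using E_cell[OF e(1)] by blast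
    have zq: "z \<in> grid_cell \<delta> q" using cell_edge_segment(1)[OF \<delta> q(2)] e(2) by (simp add: v_def)
    show "z \<in> closure \<Omega>"
      unfolding closure_iff_nhds_not_empty
    proof (intro allI impI)
      fix S V assume SV: "V \<subseteq> S" "open V" "z \<in> V"
      obtain u where u: "u \<in> open_grid_cell \<delta> q" "u \<in> V"
        using open_grid_cell_dense[OF \<delta> zq SV(2,3)] .
      then have "u \<in> \<Omega>" using w_cell[OF u(1)] openB[OF u(1)] q(1) by (simp add: \<Omega>_def)
      then show "\<Omega> \<inter> S \<noteq> {}" using u SV by blast
    qed
  qed
  have clos: "closure \<Omega> = \<Omega> \<union> B" using cl Bcl closure_subset by blast
  have front: "frontier \<Omega> = B"
    unfolding frontier_def interior_open[OF open\<Omega>] clos by (auto simp: \<Omega>_def)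
  have clU: "closure \<Omega> \<subseteq> U"
    unfolding clos using \<Omega>W BW WU by blast
  have K\<Omega>: "K \<subseteq> \<Omega>"
    using KW w_in BintW by (auto simp: \<Omega>_def)
  have out: "w z = 0" if "z \<notin> closure \<Omega>" for z
  proof -
    have "z \<notin> B" "w z \<noteq> 1" using that unfolding clos by (auto simp: \<Omega>_def)
    then show ?thesis using w01[of z] by simp
  qed
  have "simple_path \<gamma> \<and> pathfinish \<gamma> = pathstart \<gamma> \<and> rectifiable_path \<gamma>" if "\<gamma> \<in> \<Gamma>" for \<gamma>
    using \<Gamma>(2)[OF that] rectifiable_path_lipschitz by blast
  moreover have "\<forall>z\<in>\<Omega>. (\<Sum>\<gamma>\<in>\<Gamma>. winding_number \<gamma> z) = 1"
    unfolding \<Omega>_def w_def by blast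
  moreover have "\<forall>z. z \<notin> closure \<Omega> \<longrightarrow> (\<Sum>\<gamma>\<in>\<Gamma>. winding_number \<gamma> z) = 0"
    using out unfolding w_def by blast
  ultimately have "spectral_contour U K \<Omega> \<Gamma>"
    unfolding spectral_contour_def \<Gamma>(3) front
    using open\<Omega> K\<Omega> clU \<Gamma>(1) by blast
  then show ?thesis by blast
qed

section \<open>A vector-valued Liouville theorem\<close>

text \<open>
  The mean of \<open>H\<close> over the circle of radius \<open>\<rho>\<close> about \<open>z\<close> does not depend on \<open>\<rho>\<close>: differentiating under the
  integral sign gives, up to a factor, the integral of the angular derivative of \<open>H\<close> over a full
  period. It equals \<open>H z\<close> for \<open>\<rho> = 0\<close> and tends to \<open>0\<close> as \<open>\<rho> \<rightarrow> \<infinity>\<close>.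
\<close>

lemma Liouville_vanishing_at_infinity:
  fixes H :: "complex \<Rightarrow> 'a::complex_banach"
  assumes der: "\<And>z. (H has_derivative (\<lambda>h. h *\<^sub>C H' z)) (at z)"
    and cont: "continuous_on UNIV H'" and lim: "(H \<longlongrightarrow> 0) at_infinity"
  shows "H z = 0"
proof -
  define f where "f \<rho> \<theta> = H (z + of_real \<rho> * cis \<theta>)" for \<rho> \<theta>
  define f' where "f' \<rho> \<theta> = cis \<theta> *\<^sub>C H' (z + of_real \<rho> * cis \<theta>)" for \<rho> \<theta>
  have contH: "continuous_on UNIV H"
    using der has_derivative_continuous by (intro continuous_at_imp_continuous_on) blast
  have cont_f: "continuous_on A (f \<rho>)" for A \<rho>
    unfolding f_def by (intro continuous_on_compose2[OF contH] continuous_intros) auto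
  have cont_f': "continuous_on A (f' \<rho>)" for A \<rho>
    unfolding f'_def
    by (intro scaleC.continuous_on continuous_on_compose2[OF cont] continuous_intros) auto
  have radial: "((\<lambda>\<rho>. f \<rho> \<theta>) has_vector_derivative f' \<rho> \<theta>) (at \<rho>)" for \<rho> \<theta>
  proof -
    have "((\<lambda>\<rho>. z + of_real \<rho> * cis \<theta>) has_derivative (\<lambda>h. of_real h * cis \<theta>)) (at \<rho>)"
      by (auto intro!: derivative_eq_intros)
    from has_derivative_compose[OF this der] show ?thesis
      unfolding f_def f'_def has_vector_derivative_def
      by (simp add: scaleC_scaleC[symmetric] scaleC_of_real)
  qed
  have angular: "(f \<rho> has_vector_derivative (of_real \<rho> * \<i>) *\<^sub>C f' \<rho> \<theta>) (at \<theta>)" for \<rho> \<theta>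
  proof -
    have "((\<lambda>\<theta>. z + of_real \<rho> * cis \<theta>) has_derivative
        (\<lambda>h. of_real h * ((of_real \<rho> * \<i>) * cis \<theta>))) (at \<theta>)"
      by (auto intro!: derivative_eq_intros simp: scaleR_conv_of_real algebra_simps)
    from has_derivative_compose[OF this der] show ?thesis
      unfolding f_def f'_def has_vector_derivative_def
      by (simp add: scaleC_scaleC[symmetric] scaleC_of_real)
  qed
  define I where "I \<rho> = integral {0..2 * pi} (f \<rho>)" for \<rho>
  have derI: "(I has_vector_derivative integral {0..2 * pi} (f' \<rho>)) (at \<rho>)" for \<rho>
  proof -
    have "((\<lambda>\<rho>. integral (cbox 0 (2 * pi)) (f \<rho>)) has_vector_derivative
        integral (cbox 0 (2 * pi)) (f' \<rho>)) (at \<rho> within UNIV)"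
    proof (rule leibniz_rule_vector_derivative)
      show "continuous_on (UNIV \<times> cbox 0 (2 * pi)) (\<lambda>(\<rho>, \<theta>). f' \<rho> \<theta>)"
        unfolding f'_def case_prod_unfold
        by (intro scaleC.continuous_on continuous_on_compose2[OF cont] continuous_intros) auto
    qed (use radial cont_f in \<open>auto intro!: integrable_continuous_interval has_vector_derivative_at_within\<close>)
    then show ?thesis unfolding I_def by simp
  qed
  have zero: "integral {0..2 * pi} (f' \<rho>) = 0" if "\<rho> \<noteq> 0" for \<rho>
  proof -
    have "((\<lambda>\<theta>. (of_real \<rho> * \<i>) *\<^sub>C f' \<rho> \<theta>) has_integral (f \<rho> (2 * pi) - f \<rho> 0)) {0..2 * pi}"
      using angular by (intro fundamental_theorem_of_calculus) (auto intro: has_vector_derivative_at_within)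
    moreover have "((\<lambda>\<theta>. (of_real \<rho> * \<i>) *\<^sub>C f' \<rho> \<theta>) has_integral
        (of_real \<rho> * \<i>) *\<^sub>C integral {0..2 * pi} (f' \<rho>)) {0..2 * pi}"
      using has_integral_linear[OF integrable_integral bounded_linear_scaleC, of "f' \<rho>" "{0..2 * pi}"]
        integrable_continuous_interval[OF cont_f'] by (simp add: o_def)
    ultimately have "(of_real \<rho> * \<i>) *\<^sub>C integral {0..2 * pi} (f' \<rho>) = f \<rho> (2 * pi) - f \<rho> 0"
      using has_integral_unique by blast
    then have "norm ((of_real \<rho> * \<i>) *\<^sub>C integral {0..2 * pi} (f' \<rho>)) = 0"
      by (simp add: f_def)
    then show ?thesis using that by (simp add: norm_scaleC norm_mult)
  qed
  have const: "I r = I 0" if "r \<ge> 0" for r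
  proof (rule has_derivative_zero_unique_strong_interval[of "{0}" 0 r])
    show "continuous_on {0..r} I"
      using derI by (intro continuous_at_imp_continuous_on ballI has_vector_derivative_continuous)
    show "(I has_derivative (\<lambda>h. 0)) (at x within {0..r})" if "x \<in> {0..r} - {0}" for x
      using derI[of x] zero[of x] that
      by (auto simp: has_vector_derivative_def intro: has_derivative_at_withinI)
  qed (use that in auto)
  have "norm (H z) \<le> e" if "e > 0" for e
  proof -
    obtain b where b: "\<And>x. b \<le> norm x \<Longrightarrow> norm (H x) < e"
      using lim \<open>e > 0\<close> unfolding Lim_at_infinity by auto
    define r where "r = \<bar>b\<bar> + cmod z"
    have r0: "r \<ge> 0" by (simp add: r_def)
    have "norm (f r \<theta>) \<le> e" for \<theta>
    proof -
      have "cmod (of_real r * cis \<theta>) = r"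
        using r0 by (simp add: norm_mult)
      then have "r \<le> cmod (z + of_real r * cis \<theta>) + cmod z"
        using norm_triangle_ineq4[of "z + of_real r * cis \<theta>" z] by simp
      then have "b \<le> cmod (z + of_real r * cis \<theta>)"
        unfolding r_def by linarith
      then show ?thesis
        unfolding f_def by (rule less_imp_le[OF b])
    qed
    then have "norm (I r) \<le> e * (2 * pi - 0)"
      unfolding I_def by (intro integral_bound cont_f) auto
    moreover have "I r = (2 * pi) *\<^sub>R H z"
    proof -
      have "f 0 = (\<lambda>\<theta>. H z)" by (simp add: f_def fun_eq_iff)
      then show ?thesis using const[OF r0] by (simp add: I_def)
    qed
    ultimately show ?thesis by simp
  qed
  then have "norm (H z) \<le> 0" by (meson dense_ge)
  then show ?thesis by simp
qed


section \<open>The functional calculus of a power series\<close>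

locale operator_contour =
  fixes U :: "complex set" and T :: "'g::complex_banach bop" and \<Omega> :: "complex set"
    and \<Gamma> :: "(real \<Rightarrow> complex) set"
  assumes contour: "spectral_contour U (spectrum T) \<Omega> \<Gamma>"
begin

lemma open_\<Omega>: "open \<Omega>" and spectrum_\<Omega>: "spectrum T \<subseteq> \<Omega>" and finite_\<Gamma>: "finite \<Gamma>"
  using contour by (simp_all add: spectral_contour_def)

lemma \<Gamma>_path: "\<gamma> \<in> \<Gamma> \<Longrightarrow> path \<gamma>" and \<Gamma>_closed: "\<gamma> \<in> \<Gamma> \<Longrightarrow> pathfinish \<gamma> = pathstart \<gamma>"
  using contour by (simp_all add: spectral_contour_def simple_path_imp_path)

lemma \<Gamma>_variation:
  assumes "\<gamma> \<in> \<Gamma>"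
  obtains V where "variation_le \<gamma> V"
proof -
  have "rectifiable_path \<gamma>"
    using assms contour by (simp add: spectral_contour_def)
  then show ?thesis by (rule rectifiable_pathD) (rule that)
qed

lemma winding: "z \<in> \<Omega> \<Longrightarrow> (\<Sum>\<gamma>\<in>\<Gamma>. winding_number \<gamma> z) = 1"
  using contour by (simp add: spectral_contour_def)

definition track :: "complex set" where
  "track = (\<Union>\<gamma>\<in>\<Gamma>. path_image \<gamma>)"

lemma path_image_track: "\<gamma> \<in> \<Gamma> \<Longrightarrow> path_image \<gamma> \<subseteq> track"
  by (auto simp: track_def)

lemma track_frontier: "track = frontier \<Omega>" and track_U: "track \<subseteq> U"
  using contour frontier_subset_closed[of "closure \<Omega>"]
  by (auto simp: spectral_contour_def track_def frontier_def)

lemma track_\<Omega>: "track \<inter> \<Omega> = {}"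
  unfolding track_frontier by (auto simp: frontier_def interior_open open_\<Omega>)

lemma track_spectrum: "track \<inter> spectrum T = {}"
  using track_\<Omega> spectrum_\<Omega> by blast

lemma compact_track: "compact track"
  unfolding track_def using finite_\<Gamma> \<Gamma>_path by (intro compact_UN compact_path_image) auto

text \<open>The integral over the whole contour, with the factor of Cauchy's formula.\<close>

definition cint :: "(complex \<Rightarrow> 'b::complex_banach) \<Rightarrow> 'b" where
  "cint f = (1 / (2 * of_real pi * \<i>)) *\<^sub>C (\<Sum>\<gamma>\<in>\<Gamma>. line_integral \<gamma> f)"

lemma has_line_integral_track:
  fixes f :: "complex \<Rightarrow> 'b::complex_banach"
  assumes "continuous_on track f" "\<gamma> \<in> \<Gamma>"
  shows "has_line_integral f (line_integral \<gamma> f) \<gamma>"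
proof -
  obtain V where "variation_le \<gamma> V" using \<Gamma>_variation[OF assms(2)] .
  then show ?thesis
    by (rule has_line_integral_exists[OF _ \<Gamma>_path[OF assms(2)]
          continuous_on_subset[OF assms(1) path_image_track[OF assms(2)]]])
qed

lemma cint_eqI:
  assumes "\<And>\<gamma>. \<gamma> \<in> \<Gamma> \<Longrightarrow> has_line_integral f (I \<gamma>) \<gamma>"
  shows "cint f = (1 / (2 * of_real pi * \<i>)) *\<^sub>C (\<Sum>\<gamma>\<in>\<Gamma>. I \<gamma>)"
  unfolding cint_def using line_integral_eqI[OF assms] by simp

lemma cint_add:
  assumes "continuous_on track f" "continuous_on track g"
  shows "cint (\<lambda>z. f z + g z) = cint f + cint g"
proof -
  have "cint (\<lambda>z. f z + g z) =
      (1 / (2 * of_real pi * \<i>)) *\<^sub>C (\<Sum>\<gamma>\<in>\<Gamma>. line_integral \<gamma> f + line_integral \<gamma> g)"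
    by (intro cint_eqI has_line_integral_add has_line_integral_track assms)
  then show ?thesis
    by (simp add: cint_def sum.distrib scaleC_add_right)
qed

lemma cint_linear:
  assumes "continuous_on track f" "bounded_linear A" "\<And>c x. A (c *\<^sub>C x) = c *\<^sub>C A x"
  shows "cint (\<lambda>z. A (f z)) = A (cint f)"
proof -
  have "cint (\<lambda>z. A (f z)) = (1 / (2 * of_real pi * \<i>)) *\<^sub>C (\<Sum>\<gamma>\<in>\<Gamma>. A (line_integral \<gamma> f))"
    by (rule cint_eqI) (rule has_line_integral_linear[OF has_line_integral_track[OF assms(1)] assms(2,3)])
  then show ?thesis
    by (simp add: cint_def linear_sum[OF bounded_linear.linear[OF assms(2)]] assms(3))
qed

lemma cint_scaleC: "continuous_on track f \<Longrightarrow> cint (\<lambda>z. c *\<^sub>C f z) = c *\<^sub>C cint f"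
  by (rule cint_linear[where A = "scaleC c"]) (simp_all add: bounded_linear_scaleC scaleC_scaleC mult.commute)

lemma cint_mult_left: "continuous_on track f \<Longrightarrow> cint (\<lambda>z. S * f z) = S * cint f"
  for f :: "complex \<Rightarrow> 'g bop"
  by (rule cint_linear[where A = "(*) S"]) (simp_all add: bounded_linear_mult_right scaleC_mult_right)

lemma cint_cong:
  assumes "continuous_on track f" "\<And>z. z \<in> track \<Longrightarrow> f z = g z"
  shows "cint f = cint g"
proof -
  have "cint g = (1 / (2 * of_real pi * \<i>)) *\<^sub>C (\<Sum>\<gamma>\<in>\<Gamma>. line_integral \<gamma> f)"
    using assms path_image_track
    by (intro cint_eqI has_line_integral_cong[OF has_line_integral_track[OF assms(1)]]) auto
  then show ?thesis by (simp add: cint_def)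
qed

lemma cint_const_power: "cint (\<lambda>z. z ^ n *\<^sub>C c) = 0"
proof -
  have "cint (\<lambda>z. z ^ n *\<^sub>C c) = (1 / (2 * of_real pi * \<i>)) *\<^sub>C (\<Sum>\<gamma>\<in>\<Gamma>. 0)"
  proof (rule cint_eqI)
    fix \<gamma> assume \<gamma>: "\<gamma> \<in> \<Gamma>"
    obtain V where "variation_le \<gamma> V" using \<Gamma>_variation[OF \<gamma>] .
    then show "has_line_integral (\<lambda>z. z ^ n *\<^sub>C c) 0 \<gamma>"
      by (rule has_line_integral_const_power[OF _ \<Gamma>_path[OF \<gamma>] \<Gamma>_closed[OF \<gamma>]])
  qed
  then show ?thesis by simp
qed

lemma cint_Cauchy_kernel:
  assumes "\<zeta> \<in> \<Omega>"
  shows "cint (\<lambda>z. (1 / (z - \<zeta>)) *\<^sub>C c) = c"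
proof -
  have "has_line_integral (\<lambda>z. (1 / (z - \<zeta>)) *\<^sub>C c) ((2 * of_real pi * \<i> * winding_number \<gamma> \<zeta>) *\<^sub>C c) \<gamma>"
    if \<gamma>: "\<gamma> \<in> \<Gamma>" for \<gamma>
  proof -
    obtain V where V: "variation_le \<gamma> V" using \<Gamma>_variation[OF \<gamma>] .
    have "\<zeta> \<notin> path_image \<gamma>" using assms track_\<Omega> path_image_track[OF \<gamma>] by blast
    from has_line_integral_winding_number[OF V \<Gamma>_path[OF \<gamma>] this]
    have "has_line_integral (\<lambda>z. (1 / (z - \<zeta>)) *\<^sub>C c) ((2 * of_real pi * \<i> * winding_number \<gamma> \<zeta>) *\<^sub>C c) \<gamma>"
      by (rule has_line_integral_linear[where A = "\<lambda>x. x *\<^sub>C c"])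
        (simp_all add: scaleC.bounded_linear_left scaleC_complex_def scaleC_scaleC)
    then show ?thesis .
  qed
  then have "cint (\<lambda>z. (1 / (z - \<zeta>)) *\<^sub>C c) = (1 / (2 * of_real pi * \<i>)) *\<^sub>C
      (\<Sum>\<gamma>\<in>\<Gamma>. (2 * of_real pi * \<i> * winding_number \<gamma> \<zeta>) *\<^sub>C c)"
    by (rule cint_eqI)
  also have "\<dots> = (\<Sum>\<gamma>\<in>\<Gamma>. winding_number \<gamma> \<zeta>) *\<^sub>C c"
    by (simp add: scaleC.sum_right scaleC_scaleC scaleC.sum_left)
  finally show ?thesis using winding[OF assms] by (simp add: scaleC_one)
qed

lemma continuous_on_cint:
  fixes f :: "'p::topological_space \<Rightarrow> complex \<Rightarrow> 'b::complex_banach"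
  assumes "continuous_on (W \<times> track) (\<lambda>(p, z). f p z)"
  shows "continuous_on W (\<lambda>p. cint (f p))"
  unfolding cint_def
proof (intro scaleC.continuous_on continuous_on_const continuous_on_sum)
  fix \<gamma> assume \<gamma>: "\<gamma> \<in> \<Gamma>"
  obtain V where V: "variation_le \<gamma> V" using \<Gamma>_variation[OF \<gamma>] .
  show "continuous_on W (\<lambda>p. line_integral \<gamma> (f p))"
    by (rule continuous_on_line_integral_parameter[OF V \<Gamma>_path[OF \<gamma>] continuous_on_subset[OF assms]])
      (use path_image_track[OF \<gamma>] in auto)
qed

lemma cint_uniform_limit:
  assumes f: "\<And>n. continuous_on track (f n)" and g: "continuous_on track g"
    and lim: "uniform_limit track f g sequentially"
  shows "(\<lambda>n. cint (f n)) \<longlonglongrightarrow> cint g"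
  unfolding cint_def
proof (intro scaleC.tendsto tendsto_const tendsto_sum)
  fix \<gamma> assume \<gamma>: "\<gamma> \<in> \<Gamma>"
  obtain V where V: "variation_le \<gamma> V" using \<Gamma>_variation[OF \<gamma>] .
  show "(\<lambda>n. line_integral \<gamma> (f n)) \<longlonglongrightarrow> line_integral \<gamma> g"
    by (rule has_line_integral_uniform_limit[OF V \<Gamma>_path[OF \<gamma>] has_line_integral_track[OF f \<gamma>]
          has_line_integral_track[OF g \<gamma>] uniform_limit_on_subset[OF lim path_image_track[OF \<gamma>]]])
qed

lemma continuous_on_track_resolvent: "continuous_on track (resolvent T)"
  by (rule continuous_on_resolvent[OF track_spectrum])

text \<open>
  Let \<open>P\<close> be the integral of the resolvent. The Cauchy transform of the resolvent solves
  \<open>(\<zeta> - T) X = P - 1\<close> on \<open>\<Omega>\<close>, that is also on the spectrum, where the resolvent itself is not defined.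
  Away from the spectrum the solution is \<open>resolvent T \<zeta> * (P - 1)\<close>. Together they form an entire
  function that vanishes at infinity, so that \<open>P = 1\<close>.
\<close>

lemma cint_resolvent: "cint (resolvent T) = 1"
proof -
  let ?R = "resolvent T"
  define N where "N = cint ?R - 1"
  define S where "S \<zeta> = cint (\<lambda>z. (1 / (\<zeta> - z)) *\<^sub>C ?R z)" for \<zeta>
  define Q where "Q = (\<lambda>(\<zeta>, \<mu>). cint (\<lambda>z. (- 1 / ((\<zeta> - z) * (\<mu> - z))) *\<^sub>C ?R z))"
  have off: "\<zeta> \<noteq> z" if "\<zeta> \<in> \<Omega>" "z \<in> track" for \<zeta> z
    using that track_\<Omega> by blast
  note contR = continuous_on_track_resolvent
  have contk: "continuous_on track (\<lambda>z. (1 / (\<zeta> - z)) *\<^sub>C ?R z)" if "\<zeta> \<in> \<Omega>" for \<zeta>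
    using off[OF that] by (intro scaleC.continuous_on contR continuous_intros) auto
  have contk2: "continuous_on track (\<lambda>z. (- 1 / ((\<zeta> - z) * (\<mu> - z))) *\<^sub>C ?R z)" if "\<zeta> \<in> \<Omega>" "\<mu> \<in> \<Omega>" for \<zeta> \<mu>
    using off[OF that(1)] off[OF that(2)] by (intro scaleC.continuous_on contR continuous_intros) auto
  have contk3: "continuous_on track (\<lambda>z. (1 / (z - \<zeta>)) *\<^sub>C (1 :: 'g bop))" if "\<zeta> \<in> \<Omega>" for \<zeta>
    using off[OF that] by (intro scaleC.continuous_on continuous_intros) auto
  have S_eq: "(\<zeta> *\<^sub>C 1 - T) * S \<zeta> = N" if \<zeta>: "\<zeta> \<in> \<Omega>" for \<zeta>
  proof -
    have split: "(\<zeta> *\<^sub>C 1 - T) * ((1 / (\<zeta> - z)) *\<^sub>C ?R z) = ?R z + (- 1) *\<^sub>C ((1 / (z - \<zeta>)) *\<^sub>C 1)"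
      if z: "z \<in> track" for z
    proof -
      have "\<zeta> *\<^sub>C 1 - T = (\<zeta> - z) *\<^sub>C 1 + (z *\<^sub>C 1 - T)"
        by (simp add: scaleC.diff_left)
      then have "(\<zeta> *\<^sub>C 1 - T) * ?R z = ((\<zeta> - z) *\<^sub>C 1 + (z *\<^sub>C 1 - T)) * ?R z"
        by (rule arg_cong)
      also have "\<dots> = (\<zeta> - z) *\<^sub>C ?R z + (z *\<^sub>C 1 - T) * ?R z"
        by (simp only: distrib_right scaleC_mult_left mult_1_left)
      also have "(z *\<^sub>C 1 - T) * ?R z = 1"
        by (rule resolvent_inverse(1)) (use track_spectrum z in blast)
      finally have "(\<zeta> *\<^sub>C 1 - T) * ?R z = (\<zeta> - z) *\<^sub>C ?R z + 1" .
      then have "(\<zeta> *\<^sub>C 1 - T) * ((1 / (\<zeta> - z)) *\<^sub>C ?R z) = (1 / (\<zeta> - z)) *\<^sub>C ((\<zeta> - z) *\<^sub>C ?R z + 1)"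
        by (simp only: scaleC_mult_right)
      also have "\<dots> = ?R z + (1 / (\<zeta> - z)) *\<^sub>C 1"
        using off[OF \<zeta> z] by (simp add: scaleC_add_right scaleC_scaleC scaleC_one)
      also have "(1 / (\<zeta> - z)) *\<^sub>C (1 :: 'g bop) = (- 1) *\<^sub>C ((1 / (z - \<zeta>)) *\<^sub>C 1)"
      proof -
        have "1 / (\<zeta> - z) = (- 1) * (1 / (z - \<zeta>))"
          using off[OF \<zeta> z] by (simp add: divide_simps)
        then show ?thesis by (simp only: scaleC_scaleC)
      qed
      finally show ?thesis .
    qed
    have "(\<zeta> *\<^sub>C 1 - T) * S \<zeta> = cint (\<lambda>z. (\<zeta> *\<^sub>C 1 - T) * ((1 / (\<zeta> - z)) *\<^sub>C ?R z))"
      unfolding S_def by (rule cint_mult_left[OF contk[OF \<zeta>], symmetric])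
    also have "\<dots> = cint (\<lambda>z. ?R z + (- 1) *\<^sub>C ((1 / (z - \<zeta>)) *\<^sub>C 1))"
      by (rule cint_cong[OF continuous_on_mult[OF continuous_on_const contk[OF \<zeta>]] split])
    also have "\<dots> = cint ?R + cint (\<lambda>z. (- 1) *\<^sub>C ((1 / (z - \<zeta>)) *\<^sub>C 1))"
      by (rule cint_add[OF contR scaleC.continuous_on[OF continuous_on_const contk3[OF \<zeta>]]])
    also have "cint (\<lambda>z. (- 1) *\<^sub>C ((1 / (z - \<zeta>)) *\<^sub>C (1 :: 'g bop))) = (- 1) *\<^sub>C cint (\<lambda>z. (1 / (z - \<zeta>)) *\<^sub>C 1)"
      by (intro cint_scaleC contk3 \<zeta>)
    also have "cint (\<lambda>z. (1 / (z - \<zeta>)) *\<^sub>C (1 :: 'g bop)) = 1"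
      by (rule cint_Cauchy_kernel[OF \<zeta>])
    finally show ?thesis by (simp add: N_def scaleC.minus_left scaleC_one)
  qed
  have S_diff: "S \<zeta> - S \<mu> = (\<zeta> - \<mu>) *\<^sub>C Q (\<zeta>, \<mu>)" if \<zeta>: "\<zeta> \<in> \<Omega>" "\<mu> \<in> \<Omega>" for \<zeta> \<mu>
  proof -
    have "cint (\<lambda>z. (1 / (\<zeta> - z)) *\<^sub>C ?R z) =
        cint (\<lambda>z. (1 / (\<mu> - z)) *\<^sub>C ?R z + (\<zeta> - \<mu>) *\<^sub>C ((- 1 / ((\<zeta> - z) * (\<mu> - z))) *\<^sub>C ?R z))"
    proof (rule cint_cong[OF contk[OF \<zeta>(1)]])
      fix z assume "z \<in> track"
      then have "\<zeta> - z \<noteq> 0" "\<mu> - z \<noteq> 0" using off \<zeta> by auto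
      then have "1 / (\<zeta> - z) = 1 / (\<mu> - z) + (\<zeta> - \<mu>) * (- 1 / ((\<zeta> - z) * (\<mu> - z)))"
        by (simp add: divide_simps)
      then show "(1 / (\<zeta> - z)) *\<^sub>C ?R z = (1 / (\<mu> - z)) *\<^sub>C ?R z + (\<zeta> - \<mu>) *\<^sub>C ((- 1 / ((\<zeta> - z) * (\<mu> - z))) *\<^sub>C ?R z)"
        by (simp only: scaleC_add_left scaleC_scaleC)
    qed
    also have "\<dots> = S \<mu> + (\<zeta> - \<mu>) *\<^sub>C Q (\<zeta>, \<mu>)"
      unfolding S_def Q_def prod.case
      by (simp only: cint_add[OF contk[OF \<zeta>(2)] scaleC.continuous_on[OF continuous_on_const contk2[OF \<zeta>]]]
          cint_scaleC[OF contk2[OF \<zeta>]])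
    finally show ?thesis by (simp add: S_def)
  qed
  have contQ: "continuous_on (\<Omega> \<times> \<Omega>) Q"
  proof -
    have "continuous_on ((\<Omega> \<times> \<Omega>) \<times> track)
        (\<lambda>(p, z). (- 1 / ((fst p - z) * (snd p - z))) *\<^sub>C ?R z)"
      unfolding case_prod_unfold
      by (intro scaleC.continuous_on continuous_on_compose2[OF contR] continuous_intros)
        (use off in auto)
    from continuous_on_cint[OF this] show ?thesis
      by (simp add: Q_def case_prod_unfold)
  qed
  define H where "H \<zeta> = (if \<zeta> \<in> \<Omega> then S \<zeta> else ?R \<zeta> * N)" for \<zeta>
  have H_res: "H \<zeta> = ?R \<zeta> * N" if "\<zeta> \<notin> spectrum T" for \<zeta>
  proof (cases "\<zeta> \<in> \<Omega>")
    case True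
    have "?R \<zeta> * N = (?R \<zeta> * (\<zeta> *\<^sub>C 1 - T)) * S \<zeta>"
      unfolding S_eq[OF True, symmetric] by (simp only: mult.assoc)
    also have "\<dots> = S \<zeta>" using resolvent_inverse(2)[OF that] by simp
    finally show ?thesis using True by (simp add: H_def)
  qed (simp add: H_def)
  define H' where "H' \<zeta> = (if \<zeta> \<in> \<Omega> then Q (\<zeta>, \<zeta>) else - (?R \<zeta> * ?R \<zeta>) * N)" for \<zeta>
  have der\<Omega>: "(H has_derivative (\<lambda>h. h *\<^sub>C Q (\<zeta>, \<zeta>))) (at \<zeta>)" if \<zeta>: "\<zeta> \<in> \<Omega>" for \<zeta>
  proof (rule has_derivative_scaleC_Caratheodory[OF open_\<Omega> \<zeta>, where \<phi> = "\<lambda>w. Q (w, \<zeta>)"])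
    have "continuous_on \<Omega> (\<lambda>w. Q (w, \<zeta>))"
      by (rule continuous_on_compose2[OF contQ]) (use \<zeta> in \<open>auto intro!: continuous_intros\<close>)
    then show "isCont (\<lambda>w. Q (w, \<zeta>)) \<zeta>"
      using open_\<Omega> \<zeta> by (simp add: continuous_on_eq_continuous_at)
  qed (use \<zeta> S_diff in \<open>simp add: H_def\<close>)
  have der_res: "(H has_derivative (\<lambda>h. h *\<^sub>C (- (?R \<zeta> * ?R \<zeta>) * N))) (at \<zeta>)"
    if \<zeta>: "\<zeta> \<in> - spectrum T" for \<zeta>
  proof (rule has_derivative_scaleC_Caratheodory[OF open_resolvent_set \<zeta>, where \<phi> = "\<lambda>w. - (?R w * ?R \<zeta>) * N"])
    show "isCont (\<lambda>w. - (?R w * ?R \<zeta>) * N) \<zeta>"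
      using \<zeta> by (intro continuous_intros isCont_resolvent) auto
    fix w assume "w \<in> - spectrum T"
    then show "H w - H \<zeta> = (w - \<zeta>) *\<^sub>C (- (?R w * ?R \<zeta>) * N)"
      using \<zeta> resolvent_identity[of \<zeta> T w]
      by (simp add: H_res left_diff_distrib[symmetric] scaleC_mult_left)
  qed
  have unique: "a = b" if "(H has_derivative (\<lambda>h. h *\<^sub>C a)) (at \<zeta>)" "(H has_derivative (\<lambda>h. h *\<^sub>C b)) (at \<zeta>)"
    for a b \<zeta>
    using fun_cong[OF has_derivative_unique[OF that], of 1] by (simp add: scaleC_one)
  have H'_res: "H' \<zeta> = - (?R \<zeta> * ?R \<zeta>) * N" if "\<zeta> \<in> - spectrum T" for \<zeta>
    using unique[OF der\<Omega> der_res[OF that]] by (simp add: H'_def)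
  have cover: "\<Omega> \<union> - spectrum T = UNIV"
    using spectrum_\<Omega> by blast
  have der: "(H has_derivative (\<lambda>h. h *\<^sub>C H' \<zeta>)) (at \<zeta>)" for \<zeta>
    using der\<Omega>[of \<zeta>] der_res[of \<zeta>] H'_res[of \<zeta>] cover by (cases "\<zeta> \<in> \<Omega>") (auto simp: H'_def)
  have "continuous_on \<Omega> H'"
    by (subst continuous_on_cong[OF refl, of _ _ "\<lambda>\<zeta>. Q (\<zeta>, \<zeta>)"])
      (auto simp: H'_def intro!: continuous_on_compose2[OF contQ] continuous_intros)
  moreover have "continuous_on (- spectrum T) H'"
    by (subst continuous_on_cong[OF refl H'_res], assumption)
      (intro continuous_intros continuous_on_resolvent, auto)
  ultimately have contH': "continuous_on UNIV H'"
    using continuous_on_open_Un[OF open_\<Omega> open_resolvent_set] cover by metis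
  have "(H \<longlongrightarrow> 0) at_infinity"
  proof (rule Lim_null_comparison)
    show "\<forall>\<^sub>F \<zeta> in at_infinity. norm (H \<zeta>) \<le> norm N * inverse (cmod \<zeta> - norm T)"
      unfolding eventually_at_infinity
    proof (intro exI[of _ "norm T + 1"] allI impI)
      fix \<zeta> :: complex assume "norm T + 1 \<le> cmod \<zeta>"
      then have z: "norm T < cmod \<zeta>" by simp
      have "norm (H \<zeta>) \<le> norm (?R \<zeta>) * norm N"
        using spectrum_bounded[of \<zeta> T] z by (subst H_res) (auto intro: norm_mult_ineq)
      also have "\<dots> \<le> 1 / (cmod \<zeta> - norm T) * norm N"
        by (intro mult_right_mono norm_resolvent_le z) simp
      finally show "norm (H \<zeta>) \<le> norm N * inverse (cmod \<zeta> - norm T)"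
        by (simp add: divide_inverse mult.commute)
    qed
    have "filterlim (\<lambda>\<zeta>. - norm T + cmod \<zeta>) at_top at_infinity"
      by (rule filterlim_tendsto_add_at_top[OF tendsto_const filterlim_norm_at_top])
    then have "((\<lambda>\<zeta>. inverse (cmod \<zeta> - norm T)) \<longlongrightarrow> 0) at_infinity"
      by (intro tendsto_inverse_0_at_top) simp
    then show "((\<lambda>\<zeta>. norm N * inverse (cmod \<zeta> - norm T)) \<longlongrightarrow> 0) at_infinity"
      by (rule tendsto_mult_right_zero)
  qed
  then have H0: "H \<zeta> = 0" for \<zeta>
    using Liouville_vanishing_at_infinity[OF der contH'] by blast
  define \<zeta> :: complex where "\<zeta> = of_real (norm T + 1)"
  have "\<zeta> \<notin> spectrum T"
    using spectrum_bounded[of \<zeta> T] unfolding \<zeta>_def norm_of_real by auto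
  then have "N = (\<zeta> *\<^sub>C 1 - T) * H \<zeta>"
    using resolvent_inverse(1)[of \<zeta> T] by (simp add: H_res mult.assoc[symmetric])
  then show ?thesis by (simp add: H0 N_def)
qed

text \<open>
  By \<open>z R(z) = 1 + T R(z)\<close> for the resolvent \<open>R\<close>, multiplying the integrand by \<open>z\<close> multiplies the integral by \<open>T\<close>,
  up to the integral of a monomial, which vanishes.
\<close>

lemma cint_power_resolvent: "cint (\<lambda>z. z ^ n *\<^sub>C resolvent T z) = T ^ n"
proof (induction n)
  case 0
  then show ?case by (simp add: scaleC_one cint_resolvent)
next
  case (Suc n)
  have cont: "continuous_on track (\<lambda>z. z ^ n *\<^sub>C resolvent T z)"
    by (intro scaleC.continuous_on continuous_on_track_resolvent continuous_intros)
  have cont1: "continuous_on track (\<lambda>z. z ^ n *\<^sub>C (1 :: 'g bop))"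
    by (intro scaleC.continuous_on continuous_intros)
  have "cint (\<lambda>z. z ^ Suc n *\<^sub>C resolvent T z) = cint (\<lambda>z. z ^ n *\<^sub>C 1 + T * (z ^ n *\<^sub>C resolvent T z))"
  proof (rule cint_cong)
    fix z assume "z \<in> track"
    then have "z *\<^sub>C resolvent T z = 1 + T * resolvent T z"
      using resolvent_inverse(1)[of z T] track_spectrum
      by (simp add: left_diff_distrib scaleC_mult_left diff_eq_eq disjoint_iff)
    then have "z ^ n *\<^sub>C (z *\<^sub>C resolvent T z) = z ^ n *\<^sub>C 1 + z ^ n *\<^sub>C (T * resolvent T z)"
      by (simp add: scaleC_add_right)
    then show "z ^ Suc n *\<^sub>C resolvent T z = z ^ n *\<^sub>C 1 + T * (z ^ n *\<^sub>C resolvent T z)"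
      by (simp add: scaleC_scaleC scaleC_mult_right mult.commute)
  qed (intro scaleC.continuous_on continuous_on_track_resolvent continuous_intros)
  also have "\<dots> = cint (\<lambda>z. z ^ n *\<^sub>C (1 :: 'g bop)) + cint (\<lambda>z. T * (z ^ n *\<^sub>C resolvent T z))"
    by (intro cint_add cont cont1 continuous_intros)
  also have "\<dots> = T * T ^ n"
    by (simp only: cint_mult_left[OF cont] Suc cint_const_power add_0_left)
  finally show ?case by simp
qed

end

text \<open>
  Any contour that the choice in \<open>functional_calculus\<close> may pick is compact and lies in the open disc of
  convergence, where the power series converges uniformly and may be integrated term by term.
\<close>

lemma sums_functional_calculus:
  fixes T :: "'g::complex_banach bop"
  assumes ex: "\<exists>\<Omega> \<Gamma>. spectral_contour U (spectrum T) \<Omega> \<Gamma>"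
    and R: "0 < conv_radius \<alpha>" and U: "open U" and g: "\<And>z. z \<in> U \<Longrightarrow> (\<lambda>n. \<alpha> n * z ^ n) sums g z"
  shows "(\<lambda>n. \<alpha> n *\<^sub>C T ^ n) sums functional_calculus U g T"
proof -
  have "\<exists>S \<Omega> \<Gamma>. spectral_contour U (spectrum T) \<Omega> \<Gamma> \<and> S = (1 / (2 * of_real pi * \<i>)) *\<^sub>C
              (\<Sum>\<gamma>\<in>\<Gamma>. line_integral \<gamma> (\<lambda>z. g z *\<^sub>C bop_inverse (z *\<^sub>C 1 - T)))"
    using ex by blast
  from someI_ex[OF this, folded functional_calculus_def]
  obtain \<Omega> \<Gamma> where con: "spectral_contour U (spectrum T) \<Omega> \<Gamma>"
    and S: "functional_calculus U g T = (1 / (2 * of_real pi * \<i>)) *\<^sub>C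
              (\<Sum>\<gamma>\<in>\<Gamma>. line_integral \<gamma> (\<lambda>z. g z *\<^sub>C resolvent T z))"
    unfolding resolvent_def by blast
  interpret operator_contour U T \<Omega> \<Gamma> by (rule operator_contour.intro[OF con])
  \<comment> \<open>Since \<open>U\<close> is open, the series also converges at some point of larger modulus than \<open>z\<close>.\<close>
  have in_disc: "ereal (cmod z) < conv_radius \<alpha>" if zU: "z \<in> U" for z
  proof -
    obtain e where e: "e > 0" "ball z e \<subseteq> U"
      using openE[OF U zU] .
    define w where "w = z + of_real (e / 2) * (if z = 0 then 1 else sgn z)"
    have "w \<in> ball z e"
      using e(1) by (auto simp: w_def dist_norm norm_mult norm_sgn)
    then have "w \<in> U" using e(2) by (rule subsetD[rotated])
    then have "summable (\<lambda>n. \<alpha> n * w ^ n)"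
      by (rule sums_summable[OF g])
    then have "ereal (cmod w) \<le> conv_radius \<alpha>"
      by (rule conv_radius_geI)
    moreover have "cmod z < cmod w"
    proof (cases "z = 0")
      case False
      have "of_real (cmod z) * sgn z = z"
        using False by (simp add: sgn_eq)
      then have "w = of_real (cmod z + e / 2) * sgn z"
        using False by (simp add: w_def distrib_right)
      then have "cmod w = \<bar>cmod z + e / 2\<bar>"
        using False by (simp only: norm_mult norm_of_real norm_sgn) simp
      then show ?thesis using e(1) by simp
    qed (use e(1) in \<open>simp add: w_def\<close>)
    ultimately show ?thesis
      by (meson ereal_less(2) less_ereal.simps(1) less_le_trans)
  qed
  obtain \<rho> where \<rho>: "\<rho> \<ge> 0" "ereal \<rho> < conv_radius \<alpha>" "\<And>z. z \<in> track \<Longrightarrow> cmod z \<le> \<rho>"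
  proof (cases "track = {}")
    case True
    show ?thesis
      by (rule that[of 0]) (use True R in \<open>auto simp: zero_ereal_def[symmetric]\<close>)
  next
    case False
    then obtain z where z: "z \<in> track" "\<And>w. w \<in> track \<Longrightarrow> cmod w \<le> cmod z"
      using continuous_attains_sup[OF compact_track, of cmod] by (auto intro: continuous_intros)
    show ?thesis
      by (rule that[of "cmod z"]) (use z in_disc track_U in auto)
  qed
  define c where "c n z = (\<alpha> n * z ^ n) *\<^sub>C resolvent T z" for n z
  have cont_c: "continuous_on track (c n)" for n
    unfolding c_def by (intro scaleC.continuous_on continuous_on_track_resolvent continuous_intros)
  obtain C where C: "\<And>z. z \<in> track \<Longrightarrow> norm (resolvent T z) \<le> C"
    using compact_imp_bounded[OF compact_continuous_image[OF continuous_on_track_resolvent compact_track]]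
    unfolding bounded_iff by auto
  have ul: "uniform_limit track (\<lambda>N z. \<Sum>n<N. c n z) (\<lambda>z. \<Sum>n. c n z) sequentially"
  proof (rule Weierstrass_m_test)
    show "norm (c n z) \<le> norm (\<alpha> n * of_real \<rho> ^ n) * C" if "z \<in> track" for n z
      unfolding c_def norm_scaleC
      using \<rho>(1) \<rho>(3)[OF that] by (intro mult_mono C that) (auto simp: norm_mult norm_power intro!: mult_left_mono power_mono)
    show "summable (\<lambda>n. norm (\<alpha> n * of_real \<rho> ^ n) * C)"
      using \<rho> by (intro summable_mult2 abs_summable_in_conv_radius) auto
  qed
  have eq: "(\<Sum>n. c n z) = g z *\<^sub>C resolvent T z" if "z \<in> track" for z
  proof -
    have "z \<in> U" using that track_U by blast
    from bounded_linear.sums[OF scaleC.bounded_linear_left g[OF this], of "resolvent T z"]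
    show ?thesis unfolding c_def by (rule sums_unique[symmetric])
  qed
  have lim: "uniform_limit track (\<lambda>N z. \<Sum>n<N. c n z) (\<lambda>z. g z *\<^sub>C resolvent T z) sequentially"
    by (rule uniform_limit_cong'[OF refl eq, THEN iffD1, OF _ ul])
  have cont_s: "continuous_on track (\<lambda>z. \<Sum>n<N. c n z)" for N
    by (intro continuous_on_sum cont_c)
  have "continuous_on track (\<lambda>z. g z *\<^sub>C resolvent T z)"
    using uniform_limit_theorem[OF _ lim] cont_s by auto
  then have "(\<lambda>N. cint (\<lambda>z. \<Sum>n<N. c n z)) \<longlonglongrightarrow> cint (\<lambda>z. g z *\<^sub>C resolvent T z)"
    by (intro cint_uniform_limit lim cont_s)
  moreover have "cint (\<lambda>z. \<Sum>n<N. c n z) = (\<Sum>n<N. \<alpha> n *\<^sub>C T ^ n)" for N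
  proof (induction N)
    case 0
    then show ?case using cint_const_power[of 0 "0 :: 'g bop"] by (simp)
  next
    case (Suc N)
    have "cint (c N) = \<alpha> N *\<^sub>C cint (\<lambda>z. z ^ N *\<^sub>C resolvent T z)"
      unfolding c_def scaleC_scaleC[symmetric]
      by (intro cint_scaleC scaleC.continuous_on continuous_on_track_resolvent continuous_intros)
    then show ?case
      using Suc by (simp add: cint_add[OF cont_s cont_c] cint_power_resolvent)
  qed
  ultimately show ?thesis
    unfolding sums_def S cint_def by simp
qed

section \<open>Rearrangement of triangular double series\<close>

text \<open>
  Under absolute summability over the triangle \<open>k \<le> n\<close>, summing along \<open>n\<close> first is summing along \<open>k\<close> first.
  Along \<open>n\<close> the index is counted from the diagonal.
\<close>

lemma summable_triangular:
  fixes f :: "nat \<Rightarrow> nat \<Rightarrow> 'a::banach" and B :: "nat \<Rightarrow> nat \<Rightarrow> real"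
  assumes B: "\<And>n k. k \<le> n \<Longrightarrow> norm (f n k) \<le> B n k" and sB: "summable (\<lambda>n. \<Sum>k\<le>n. B n k)"
  shows "summable (\<lambda>n. \<Sum>k\<le>n. f n k)"
    and "summable (\<lambda>n. norm (f (n + k) k))"
    and "summable (\<lambda>k. \<Sum>n. norm (f (n + k) k))"
    and "(\<lambda>k. \<Sum>n. f (n + k) k) sums (\<Sum>n. \<Sum>k\<le>n. f n k)"
proof -
  define S where "S = Sigma UNIV (\<lambda>n::nat. {..n})"
  define g where "g = (\<lambda>(n, k). f n k)"
  define G where "G = (\<lambda>(k, m). f (m + k) k)"
  have "summable (\<lambda>n. \<Sum>k\<le>n. norm (f n k))"
  proof (rule summable_comparison_test'[OF sB, of 0])
    show "norm (\<Sum>k\<le>n. norm (f n k)) \<le> (\<Sum>k\<le>n. B n k)" for n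
      using sum_mono[of "{..n}" "\<lambda>k. norm (f n k)" "B n"] B by (simp add: abs_of_nonneg sum_nonneg)
  qed
  then have gS: "(\<lambda>x. norm (g x)) summable_on S"
    unfolding S_def
    by - (intro Infinite_Sum.abs_summable_on_Sigma_iff[THEN iffD2] conjI ballI,
      auto simp: g_def summable_on_UNIV_nonneg_real_iff sum_nonneg)
  have bij: "bij_betw (\<lambda>(k, m). (m + k, k)) (UNIV \<times> UNIV) S"
    by (rule bij_betw_byWitness[of _ "\<lambda>(n, k). (k, n - k)"]) (auto simp: S_def)
  have G_g: "G x = g ((\<lambda>(k, m). (m + k, k)) x)" for x
    by (simp add: G_def g_def case_prod_unfold)
  have GU: "(\<lambda>x. norm (G x)) summable_on UNIV \<times> UNIV"
    unfolding G_g using summable_on_reindex_bij_betw[OF bij, of "\<lambda>x. norm (g x)"] gS by simp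
  note GU' = GU[unfolded Infinite_Sum.abs_summable_on_Sigma_iff]
  show row: "summable (\<lambda>n. norm (f (n + k) k))" for k
    using GU' by (auto simp: G_def summable_on_UNIV_nonneg_real_iff)
  have inf_suminf: "infsum (\<lambda>m. norm (G (k, m))) UNIV = (\<Sum>n. norm (f (n + k) k))" for k
    using norm_summable_imp_has_sum[of "\<lambda>n. norm (f (n + k) k)"] row[of k]
    by (intro infsumI) (auto simp: G_def summable_sums)
  have nonneg: "0 \<le> (\<Sum>n. norm (f (n + k) k))" for k
    by (rule suminf_nonneg[OF row]) simp
  show "summable (\<lambda>k. \<Sum>n. norm (f (n + k) k))"
    using GU' nonneg by (simp add: inf_suminf summable_on_UNIV_nonneg_real_iff)
  have g_sum: "infsum g S = infsum G (UNIV \<times> UNIV)"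
    unfolding G_g using infsum_reindex_bij_betw[OF bij, of g] by simp
  have colsum: "((\<lambda>n. \<Sum>k\<le>n. f n k) has_sum infsum g S) UNIV"
  proof -
    have "((\<lambda>n. infsum (\<lambda>k. g (n, k)) {..n}) has_sum infsum g S) UNIV"
      using has_sum_infsum[OF summable_on_Sigma_banach, of "\<lambda>n k. g (n, k)" UNIV "\<lambda>n. {..n}"]
        abs_summable_summable[OF gS] infsum_Sigma_banach[of g UNIV "\<lambda>n. {..n}"]
      unfolding S_def by simp
    then show ?thesis by (simp add: g_def)
  qed
  from has_sum_imp_sums[OF this] have cols: "(\<lambda>n. \<Sum>k\<le>n. f n k) sums infsum g S" .
  then show "summable (\<lambda>n. \<Sum>k\<le>n. f n k)" by (rule sums_summable)
  have "((\<lambda>k. infsum (\<lambda>m. G (k, m)) UNIV) has_sum infsum G (UNIV \<times> UNIV)) UNIV"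
    using has_sum_infsum[OF summable_on_Sigma_banach, of "\<lambda>k m. G (k, m)" UNIV "\<lambda>_. UNIV"]
      abs_summable_summable[OF GU] infsum_Sigma_banach[of G UNIV "\<lambda>_. UNIV"] by simp
  moreover have "infsum (\<lambda>m. G (k, m)) UNIV = (\<Sum>n. f (n + k) k)" for k
    using norm_summable_imp_has_sum[of "\<lambda>n. f (n + k) k"] row[of k] summable_norm_cancel[OF row[of k]]
    by (intro infsumI) (auto simp: G_def summable_sums)
  ultimately have "(\<lambda>k. \<Sum>n. f (n + k) k) sums infsum g S"
    unfolding g_sum by (intro has_sum_imp_sums) simp
  then show "(\<lambda>k. \<Sum>n. f (n + k) k) sums (\<Sum>n. \<Sum>k\<le>n. f n k)"
    using sums_unique[OF cols] by simp
qed

text \<open>When \<open>f\<close> depends on a parameter and the majorant does not, this yields uniform convergence of the inner sums.\<close>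

lemma norm_suminf_triangular_le:
  fixes f :: "nat \<Rightarrow> nat \<Rightarrow> 'a::banach" and B :: "nat \<Rightarrow> nat \<Rightarrow> real"
  assumes B: "\<And>n k. k \<le> n \<Longrightarrow> norm (f n k) \<le> B n k" and sB: "summable (\<lambda>n. \<Sum>k\<le>n. B n k)"
  shows "norm (\<Sum>n. f (n + k) k) \<le> (\<Sum>n. norm (B (n + k) k))"
    and "summable (\<lambda>k. \<Sum>n. norm (B (n + k) k))" and "summable (\<lambda>n. norm (B (n + k) k))"
proof -
  have "0 \<le> B n k" if "k \<le> n" for n k
    using B[OF that] norm_ge_zero order_trans by blast
  then have B': "norm (B n k) \<le> B n k" if "k \<le> n" for n k
    using that by simp
  show "summable (\<lambda>k. \<Sum>n. norm (B (n + k) k))" and s: "summable (\<lambda>n. norm (B (n + k) k))"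
    by (rule summable_triangular[OF B' sB]; assumption)+
  show "norm (\<Sum>n. f (n + k) k) \<le> (\<Sum>n. norm (B (n + k) k))"
    by (rule norm_suminf_le[OF order_trans[OF B] s]) simp_all
qed

lemma abs_unif_convergent_onI:
  assumes "\<And>n u. u \<in> S \<Longrightarrow> norm (f n u) \<le> K n" "summable K" "\<And>n. 0 \<le> K n"
  shows "abs_unif_convergent_on S f"
proof -
  have "(\<Sum>n. SUP u\<in>S. ennreal (norm (f n u))) \<le> (\<Sum>n. ennreal (K n))"
    by (intro suminf_le SUP_least ennreal_leI assms) auto
  also have "\<dots> = ennreal (\<Sum>n. K n)"
    by (rule suminf_ennreal2[OF assms(3,2)])
  finally show ?thesis
    unfolding abs_unif_convergent_on_def by (simp add: le_less_trans)
qed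

lemma abs_unif_convergent_cong:
  assumes "\<And>n u. u \<in> S \<Longrightarrow> f n u = g n u"
  shows "abs_unif_convergent_on S f \<longleftrightarrow> abs_unif_convergent_on S g"
  unfolding abs_unif_convergent_on_def by (simp add: assms cong: SUP_cong)

lemma abs_unif_convergent_compose:
  assumes "abs_unif_convergent_on S f" "\<And>v. v \<in> S' \<Longrightarrow> \<phi> v \<in> S"
  shows "abs_unif_convergent_on S' (\<lambda>n v. f n (\<phi> v))"
proof -
  have "(\<Sum>n. SUP v\<in>S'. ennreal (norm (f n (\<phi> v)))) \<le> (\<Sum>n. SUP u\<in>S. ennreal (norm (f n u)))"
    by (intro suminf_le SUP_least SUP_upper2[of "\<phi> _" S] assms(2)) auto
  then show ?thesis
    using assms(1) unfolding abs_unif_convergent_on_def by (rule le_less_trans)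
qed


section \<open>The difference quotient of a power\<close>

text \<open>For commuting \<open>a\<close> and \<open>b\<close> this is \<open>(b ^ n - a ^ n) / (b - a)\<close>, written without division.\<close>

definition power_dq :: "nat \<Rightarrow> 'b::{real_normed_algebra, monoid_mult} \<Rightarrow> 'b \<Rightarrow> 'b" where
  "power_dq n a b = (\<Sum>i<n. a ^ i * b ^ (n - 1 - i))"

lemma power_dq_0 [simp]: "power_dq 0 a b = 0"
  by (simp add: power_dq_def)

lemma power_dq_Suc: "power_dq (Suc n) a b = power_dq n a b * b + a ^ n"
proof -
  have "(\<Sum>i<n. a ^ i * b ^ (n - i)) = (\<Sum>i<n. a ^ i * b ^ (n - 1 - i) * b)"
  proof (rule sum.cong[OF refl])
    fix i assume "i \<in> {..<n}"
    then have "n - i = Suc (n - 1 - i)" by auto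
    then show "a ^ i * b ^ (n - i) = a ^ i * b ^ (n - 1 - i) * b"
      by (simp only: power_Suc2 mult.assoc)
  qed
  then show ?thesis
    by (simp add: power_dq_def sum_distrib_right)
qed

lemma power_dq_Suc': "power_dq (Suc n) a b = a * power_dq n a b + b ^ n"
proof -
  have "power_dq (Suc n) a b = b ^ n + (\<Sum>i<n. a ^ Suc i * b ^ (n - Suc i))"
    unfolding power_dq_def by (subst sum.lessThan_Suc_shift) (simp del: sum.lessThan_Suc power_Suc)
  also have "(\<Sum>i<n. a ^ Suc i * b ^ (n - Suc i)) = a * power_dq n a b"
    unfolding power_dq_def sum_distrib_left by (rule sum.cong) (simp_all add: mult.assoc)
  finally show ?thesis by (simp only: add.commute)
qed

context
  fixes a b :: "'b::{real_normed_algebra, monoid_mult}"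
  assumes comm: "a * b = b * a"
begin

lemma power_commute: "b ^ n * a = a * b ^ n" "a ^ n * b = b * a ^ n" "a ^ m * b ^ n = b ^ n * a ^ m"
  using power_commuting_commutes[of b a n] power_commuting_commutes[of a b n] comm
    power_commuting_commutes[of a "b ^ n" m] by auto

lemma power_dq_mult: "power_dq n a b * (b - a) = b ^ n - a ^ n"
proof (induction n)
  case (Suc n)
  have "power_dq (Suc n) a b * (b - a) = a * (power_dq n a b * (b - a)) + b ^ n * (b - a)"
    by (simp only: power_dq_Suc' distrib_right mult.assoc)
  also have "\<dots> = a * (b ^ n - a ^ n) + (b ^ n * b - b ^ n * a)"
    unfolding Suc by (simp add: right_diff_distrib)
  also have "\<dots> = b ^ Suc n - a ^ Suc n"
    by (simp add: right_diff_distrib power_commute power_Suc2 power_commutes)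
  finally show ?case .
qed simp

text \<open>Expansion in powers of \<open>b - a\<close>: the quotient \<open>((a + c) ^ n - a ^ n) / c\<close> for \<open>c = b - a\<close>.\<close>

lemma power_dq_binomial:
  "power_dq n a b = (\<Sum>p<n. real (n choose Suc p) *\<^sub>R (a ^ (n - Suc p) * (b - a) ^ p))"
proof (induction n)
  case (Suc n)
  let ?c = "b - a"
  let ?t = "\<lambda>n p. real (n choose p) *\<^sub>R (a ^ (n - p) * ?c ^ p)"
  have "b ^ n = a ^ n + power_dq n a b * ?c"
    by (simp add: power_dq_mult)
  also have "power_dq n a b * ?c = (\<Sum>p<n. ?t n (Suc p))"
    unfolding Suc by (simp add: sum_distrib_right mult.assoc power_commutes)
  also have "a ^ n + \<dots> = (\<Sum>p<Suc n. ?t n p)"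
    by (subst sum.lessThan_Suc_shift) simp
  finally have bn: "b ^ n = (\<Sum>p<Suc n. real (n choose p) *\<^sub>R (a ^ (n - p) * ?c ^ p))" .
  have "a * power_dq n a b = (\<Sum>p<n. real (n choose Suc p) *\<^sub>R (a ^ (n - p) * ?c ^ p))"
    unfolding Suc sum_distrib_left
  proof (rule sum.cong[OF refl])
    fix p assume "p \<in> {..<n}"
    then have "n - p = Suc (n - Suc p)" by auto
    then show "a * real (n choose Suc p) *\<^sub>R (a ^ (n - Suc p) * ?c ^ p) = real (n choose Suc p) *\<^sub>R (a ^ (n - p) * ?c ^ p)"
      by (simp add: mult.assoc)
  qed
  also have "\<dots> = (\<Sum>p<Suc n. real (n choose Suc p) *\<^sub>R (a ^ (n - p) * ?c ^ p))"
    by simp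
  finally show ?case
    unfolding power_dq_Suc' bn
    by (simp only: sum.distrib[symmetric] scaleR_left_distrib[symmetric] of_nat_add[symmetric]
        binomial_Suc_Suc diff_Suc_Suc add.commute)
qed simp

text \<open>
  Every summand \<open>a ^ i * b ^ (n - 1 - i)\<close> differs from \<open>b ^ (n - 1)\<close> by a multiple of \<open>a ^ i - b ^ i\<close>, which telescopes into
  terms \<open>a ^ p * (a - b) * b ^ (i - 1 - p)\<close>; the term with a given \<open>p\<close> occurs once for each \<open>i > p\<close>.
\<close>

lemma power_dq_commutator:
  "power_dq (Suc (Suc n)) a b = real (n + 2) *\<^sub>R b ^ Suc n +
     (\<Sum>p\<le>n. real (n + 1 - p) *\<^sub>R (a ^ p * (a - b) * b ^ (n - p)))"
proof (induction n)
  case 0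
  then show ?case
    by (simp add: power_dq_def numeral_2_eq_2 scaleR_2[unfolded numeral_2_eq_2])
next
  case (Suc n)
  have tele: "(\<Sum>p\<le>m. a ^ p * (a - b) * b ^ (m - p)) = a ^ Suc m - b ^ Suc m" for m
  proof (induction m)
    case (Suc m)
    have "(\<Sum>p\<le>m. a ^ p * (a - b) * b ^ (Suc m - p)) = (\<Sum>p\<le>m. a ^ p * (a - b) * b ^ (m - p)) * b"
      unfolding sum_distrib_right
      by (rule sum.cong) (auto simp: Suc_diff_le mult.assoc power_commutes)
    then have "(\<Sum>p\<le>Suc m. a ^ p * (a - b) * b ^ (Suc m - p)) = (a ^ Suc m - b ^ Suc m) * b + a ^ Suc m * (a - b)"
      by (simp add: Suc.IH)
    also have "\<dots> = a ^ Suc (Suc m) - b ^ Suc (Suc m)"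
      by (simp only: left_diff_distrib right_diff_distrib power_Suc2[of _ "Suc m"]) simp
    finally show ?case .
  qed simp
  let ?t = "\<lambda>n p. a ^ p * (a - b) * b ^ (n - p)"
  have "(\<Sum>p\<le>Suc n. real (Suc n + 1 - p) *\<^sub>R ?t (Suc n) p)
      = (\<Sum>p\<le>Suc n. real (n + 1 - p) *\<^sub>R ?t (Suc n) p + ?t (Suc n) p)"
  proof (rule sum.cong[OF refl])
    fix p assume "p \<in> {..Suc n}"
    then have "real (Suc n + 1 - p) = real (n + 1 - p) + 1" by (auto simp: of_nat_diff)
    then show "real (Suc n + 1 - p) *\<^sub>R ?t (Suc n) p = real (n + 1 - p) *\<^sub>R ?t (Suc n) p + ?t (Suc n) p"
      by (simp only: scaleR_left_distrib scaleR_one)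
  qed
  also have "\<dots> = (\<Sum>p\<le>Suc n. real (n + 1 - p) *\<^sub>R ?t (Suc n) p) + (a ^ Suc (Suc n) - b ^ Suc (Suc n))"
    unfolding sum.distrib tele ..
  also have "(\<Sum>p\<le>Suc n. real (n + 1 - p) *\<^sub>R ?t (Suc n) p) = (\<Sum>p\<le>n. real (n + 1 - p) *\<^sub>R ?t n p) * b"
    unfolding sum_distrib_right
    by (simp, rule sum.cong) (auto simp: Suc_diff_le mult.assoc power_commutes)
  finally have 1: "(\<Sum>p\<le>Suc n. real (Suc n + 1 - p) *\<^sub>R ?t (Suc n) p) =
      (\<Sum>p\<le>n. real (n + 1 - p) *\<^sub>R ?t n p) * b + (a ^ Suc (Suc n) - b ^ Suc (Suc n))" .
  have "power_dq (Suc (Suc (Suc n))) a b = power_dq (Suc (Suc n)) a b * b + a ^ Suc (Suc n)"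
    by (rule power_dq_Suc)
  also have "\<dots> = real (n + 2) *\<^sub>R b ^ Suc (Suc n) + (\<Sum>p\<le>n. real (n + 1 - p) *\<^sub>R ?t n p) * b + a ^ Suc (Suc n)"
    unfolding Suc by (simp only: distrib_right mult_scaleR_left power_Suc2[of b "Suc n"])
  also have "\<dots> = real (Suc n + 2) *\<^sub>R b ^ Suc (Suc n) + (\<Sum>p\<le>Suc n. real (Suc n + 1 - p) *\<^sub>R ?t (Suc n) p)"
    unfolding 1 by (simp only: of_nat_add of_nat_Suc scaleR_left_distrib scaleR_one) simp
  finally show ?case .
qed

lemma power_dq_power_differences:
  "power_dq (Suc (Suc n)) a b = real (n + 2) *\<^sub>R b ^ Suc n - (\<Sum>k\<le>n. b ^ (n - k) * (b ^ Suc k - a ^ Suc k))"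
proof -
  have "(\<Sum>k\<le>n. b ^ (n - k) * (b ^ Suc k - a ^ Suc k)) = (\<Sum>k\<le>n. b ^ Suc n) - (\<Sum>k\<le>n. b ^ (n - k) * a ^ Suc k)"
    unfolding sum_subtractf[symmetric]
    by (rule sum.cong) (auto simp: right_diff_distrib power_add[symmetric] simp del: power_Suc)
  also have "(\<Sum>k\<le>n. b ^ Suc n) = real (n + 1) *\<^sub>R b ^ Suc n"
    by (simp only: sum_constant_scaleR card_atMost) simp
  also have "(\<Sum>k\<le>n. b ^ (n - k) * a ^ Suc k) = power_dq (Suc (Suc n)) a b - b ^ Suc n"
  proof -
    have "power_dq (Suc (Suc n)) a b = b ^ Suc n + (\<Sum>k<Suc n. a ^ Suc k * b ^ (n - k))"
      unfolding power_dq_def by (subst sum.lessThan_Suc_shift) (simp del: sum.lessThan_Suc)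
    then show ?thesis
      by (simp only: lessThan_Suc_atMost power_commute(3)) simp
  qed
  finally show ?thesis
    by (simp add: scaleR_left_distrib scaleR_2)
qed

end

section \<open>Differentiating a power series of operators\<close>

lemma Rop_power_apply: "bop_apply (Rop T ^ n) h = T ^ n * h"
  by (induction n arbitrary: h) (simp_all add: bop_apply_simps Rop_apply mult.assoc)

lemma Lop_power_apply: "bop_apply (Lop T ^ n) h = h * T ^ n"
  by (induction n arbitrary: h) (simp_all add: bop_apply_simps Lop_apply mult.assoc power_commutes)

lemma Lop_power: "Lop (T ^ n) = Lop T ^ n" and Rop_power: "Rop (T ^ n) = Rop T ^ n"
  by (rule bop_eqI, simp add: Lop_apply Lop_power_apply Rop_apply Rop_power_apply)+

lemma Rop_Lop_commute: "Rop T * Lop T = Lop T * Rop T"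
  by (rule bop_eqI) (simp add: bop_apply_simps Rop_apply Lop_apply mult.assoc)

lemma norm_Rop_le: "norm (Rop T) \<le> norm T"
  by (rule norm_bop_leI) (simp_all add: Rop_apply norm_mult_ineq)

lemma norm_Lop_le: "norm (Lop T) \<le> norm T"
  by (rule norm_bop_leI) (simp_all add: Lop_apply norm_mult_ineq mult.commute[of "norm T"])

lemma norm_Cop_le: "norm (Cop T) \<le> 2 * norm T"
  unfolding Cop_def using norm_triangle_ineq4[of "Lop T" "Rop T"] norm_Rop_le[of T] norm_Lop_le[of T]
  by linarith

lemma bounded_linear_Rop: "bounded_linear Rop"
proof (rule bounded_linear_intro[where K = 1])
  show "Rop (S + T) = Rop S + Rop T" for S T :: "'a bop"
    by (rule bop_eqI) (simp add: bop_apply_simps Rop_apply distrib_right)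
  show "Rop (r *\<^sub>R S) = r *\<^sub>R Rop S" for r and S :: "'a bop"
    by (rule bop_eqI) (simp add: bop_apply_linear Rop_apply)
qed (simp add: norm_Rop_le)

lemma bounded_linear_Lop: "bounded_linear Lop"
proof (rule bounded_linear_intro[where K = 1])
  show "Lop (S + T) = Lop S + Lop T" for S T :: "'a bop"
    by (rule bop_eqI) (simp add: bop_apply_simps Lop_apply distrib_left)
  show "Lop (r *\<^sub>R S) = r *\<^sub>R Lop S" for r and S :: "'a bop"
    by (rule bop_eqI) (simp add: bop_apply_linear Lop_apply)
qed (simp add: norm_Lop_le)

lemma norm_mult_le: "norm x \<le> c \<Longrightarrow> norm y \<le> d \<Longrightarrow> 0 \<le> c \<Longrightarrow> norm (x * y) \<le> c * d"
  for x y :: "'b::real_normed_algebra"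
  by (rule order_trans[OF norm_mult_ineq mult_mono]) auto

text \<open>
  The differential of \<open>T \<mapsto> T ^ n\<close>, as an element of the algebra of operators on \<open>B(G)\<close>. There \<open>Rop T\<close> and \<open>Lop T\<close>
  commute, although \<open>T\<close> and the argument of the differential do not.
\<close>

definition diff_power :: "nat \<Rightarrow> 'a::complex_normed_space bop \<Rightarrow> 'a bop bop" where
  "diff_power n T = power_dq n (Rop T) (Lop T)"

lemma has_derivative_power_bop:
  "((\<lambda>T. T ^ n) has_derivative bop_apply (diff_power n T)) (at T within S)"
  for T :: "'a::complex_normed_space bop"
proof (induction n)
  case 0
  have "bop_apply (diff_power 0 T) = (\<lambda>h. 0)"
    by (simp add: diff_power_def fun_eq_iff bop_apply.zero_left)
  then show ?case by simp
next
  case (Suc n)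
  have "((\<lambda>T. T * T ^ n) has_derivative (\<lambda>h. T * bop_apply (diff_power n T) h + h * T ^ n)) (at T within S)"
    by (rule has_derivative_mult[OF has_derivative_ident Suc])
  moreover have "bop_apply (diff_power (Suc n) T) = (\<lambda>h. T * bop_apply (diff_power n T) h + h * T ^ n)"
    by (simp add: diff_power_def power_dq_Suc' fun_eq_iff bop_apply_simps Rop_apply Lop_power_apply)
  ultimately show ?case by simp
qed

lemma frechet_diff_eqI:
  assumes "(f has_derivative blinfun_apply A) (at x)"
  shows "frechet_diff f x = A"
  using frechet_derivative_at[OF assms] by (simp add: frechet_diff_def blinfun_apply_inverse flip: frechet_derivative_at[OF assms])

lemma frechet_diff_has_derivative:
  assumes "f differentiable (at x)"
  shows "(f has_derivative blinfun_apply (frechet_diff f x)) (at x)"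
proof -
  have "(f has_derivative frechet_derivative f (at x)) (at x)"
    using assms frechet_derivative_works by blast
  then show ?thesis
    using bounded_linear_Blinfun_apply[OF has_derivative_bounded_linear]
    unfolding frechet_diff_def by metis
qed

lemma bop_apply_eq_blinfun_apply: "bop_apply A = blinfun_apply (blinfun_of_bop A)"
  by (simp add: bop_apply.rep_eq fun_eq_iff)

lemma frechet_diff_power: "frechet_diff (\<lambda>T. T ^ n) T = blinfun_of_bop (diff_power n T)"
  by (rule frechet_diff_eqI) (simp add: has_derivative_power_bop flip: bop_apply_eq_blinfun_apply)

lemma bop_comp_apply: "blinfun_apply (A \<odot> f) h = bop_apply A (blinfun_apply f h)"
  by (simp add: bop_comp_def bop_apply_eq_blinfun_apply)

lemma bounded_bilinear_bop_comp:
  "bounded_bilinear ((\<odot>) :: 'a::complex_normed_space bop \<Rightarrow> ('x::real_normed_vector \<Rightarrow>\<^sub>L 'a) \<Rightarrow> 'x \<Rightarrow>\<^sub>L 'a)"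
proof (rule bounded_bilinear.intro)
  show "\<exists>K. \<forall>(a :: 'a bop) (b :: 'x \<Rightarrow>\<^sub>L 'a). norm (a \<odot> b) \<le> norm a * norm b * K"
    unfolding bop_comp_def by (rule exI[of _ 1]) (simp add: norm_bop.rep_eq norm_blinfun_compose)
qed (auto intro!: blinfun_eqI simp: bop_comp_apply bop_apply_simps bop_apply_linear bop_apply.add_right
    bop_apply.scaleR_right blinfun.add_left blinfun.scaleR_left)

interpretation bop_comp: bounded_bilinear
    "(\<odot>) :: 'a::complex_normed_space bop \<Rightarrow> ('x::real_normed_vector \<Rightarrow>\<^sub>L 'a) \<Rightarrow> 'x \<Rightarrow>\<^sub>L 'a"
  by (rule bounded_bilinear_bop_comp)

lemma norm_bop_comp_le: "norm (A \<odot> f) \<le> norm A * norm f"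
  unfolding bop_comp_def by (simp add: norm_bop.rep_eq norm_blinfun_compose)

lemma bop_comp_scaleC: "(c *\<^sub>C A) \<odot> f = c *\<^sub>C (A \<odot> f)"
  by (rule blinfun_eqI) (simp add: bop_comp_apply bop_apply_simps scaleC_blinfun.rep_eq)

lemma norm_power_dq_le:
  fixes a b :: "'a::complex_normed_space bop"
  assumes "norm a \<le> \<rho>" "norm b \<le> \<rho>"
  shows "norm (power_dq n a b) \<le> real n * \<rho> ^ (n - 1)"
proof -
  have "0 \<le> \<rho>" using assms(1) norm_ge_zero order_trans by blast
  have "norm (power_dq n a b) \<le> (\<Sum>i<n. \<rho> ^ (n - 1))"
    unfolding power_dq_def
  proof (rule order_trans[OF norm_sum sum_mono])
    fix i assume "i \<in> {..<n}"
    then have "\<rho> ^ i * \<rho> ^ (n - 1 - i) = \<rho> ^ (n - 1)"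
      by (simp add: power_add[symmetric])
    then show "norm (a ^ i * b ^ (n - 1 - i)) \<le> \<rho> ^ (n - 1)"
      using norm_mult_le[OF norm_power_bop_le'[OF assms(1)] norm_power_bop_le'[OF assms(2)], of i "n - 1 - i"] \<open>0 \<le> \<rho>\<close>
      by simp
  qed
  then show ?thesis by simp
qed

lemma norm_diff_power_le: "norm T \<le> \<rho> \<Longrightarrow> norm (diff_power n T) \<le> real n * \<rho> ^ (n - 1)"
  unfolding diff_power_def
  by (intro norm_power_dq_le order_trans[OF norm_Rop_le] order_trans[OF norm_Lop_le])

lemma continuous_on_power_dq:
  fixes f g :: "'p::topological_space \<Rightarrow> 'a::complex_normed_space bop"
  assumes "continuous_on S f" "continuous_on S g"
  shows "continuous_on S (\<lambda>x. power_dq n (f x) (g x))"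
proof -
  have pow: "continuous_on S (\<lambda>x. h x ^ k)" if "continuous_on S h" for k and h :: "'p \<Rightarrow> 'a bop"
    using that by (induction k) (auto intro: continuous_on_mult)
  show ?thesis
    unfolding power_dq_def by (intro continuous_on_sum continuous_on_mult pow assms)
qed

lemma continuous_on_diff_power: "continuous_on S (diff_power n)"
  unfolding diff_power_def
  by (intro continuous_on_power_dq bounded_linear.continuous_on[OF bounded_linear_Rop]
      bounded_linear.continuous_on[OF bounded_linear_Lop] continuous_on_id)

text \<open>Inside the disc of convergence, weighting the coefficients by polynomials in the index is harmless.\<close>

lemma summable_diffs_norm:
  assumes "0 \<le> \<rho>" "ereal \<rho> < conv_radius \<alpha>"
  shows "summable (\<lambda>n. real (n + 1) * cmod (\<alpha> (n + 1)) * \<rho> ^ n)"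
    and "summable (\<lambda>n. real (n + 1) * real (n + 2) * cmod (\<alpha> (n + 2)) * \<rho> ^ n)"
proof -
  obtain K :: real where K: "\<rho> < K" "ereal K < conv_radius \<alpha>"
    using ereal_dense2[OF assms(2)] by (metis ereal_less_eq(3) less_ereal.simps(1) not_le ereal_less(2))
  have s0: "summable (\<lambda>n. cmod (\<alpha> n) * x ^ n)" if "norm x < K" for x :: real
  proof (rule summable_norm_cancel)
    have "summable (\<lambda>n. norm (\<alpha> n * of_real x ^ n))"
      by (rule abs_summable_in_conv_radius) (use that K less_trans[of "ereal \<bar>x\<bar>" "ereal K"] in auto)
    then show "summable (\<lambda>n. norm (cmod (\<alpha> n) * x ^ n))"
      by (simp add: norm_mult norm_power abs_mult power_abs)
  qed
  have s1: "summable (\<lambda>n. diffs (\<lambda>n. cmod (\<alpha> n)) n * x ^ n)" if "norm x < K" for x :: real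
    by (rule termdiff_converges[OF that s0])
  have s2: "summable (\<lambda>n. diffs (diffs (\<lambda>n. cmod (\<alpha> n))) n * x ^ n)" if "norm x < K" for x :: real
    by (rule termdiff_converges[OF that s1])
  have "norm \<rho> < K" using assms(1) K(1) by simp
  from s1[OF this] s2[OF this]
  show "summable (\<lambda>n. real (n + 1) * cmod (\<alpha> (n + 1)) * \<rho> ^ n)"
    "summable (\<lambda>n. real (n + 1) * real (n + 2) * cmod (\<alpha> (n + 2)) * \<rho> ^ n)"
    by (simp_all add: diffs_def mult_ac add_ac)
qed

lemma summable_norm_deriv:
  assumes "0 \<le> \<rho>" "ereal \<rho> < conv_radius \<alpha>"
  shows "summable (\<lambda>n. cmod (\<alpha> n) * (real n * \<rho> ^ (n - 1)))"
proof -
  have "summable (\<lambda>n. cmod (\<alpha> (Suc n)) * (real (Suc n) * \<rho> ^ (Suc n - 1)))"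
    using summable_diffs_norm(1)[OF assms] by (simp add: mult_ac)
  then show ?thesis by (subst (asm) summable_Suc_iff)
qed

definition diff_pser :: "(nat \<Rightarrow> complex) \<Rightarrow> 'a::complex_normed_space bop \<Rightarrow> 'a bop bop" where
  "diff_pser \<alpha> T = (\<Sum>n. \<alpha> n *\<^sub>C diff_power n T)"

lemma uniform_limit_diff_pser:
  fixes \<alpha> :: "nat \<Rightarrow> complex"
  assumes "0 \<le> \<rho>" "ereal \<rho> < conv_radius \<alpha>"
  shows "uniform_limit {T :: 'a::complex_banach bop. norm T \<le> \<rho>}
    (\<lambda>N T. \<Sum>n<N. \<alpha> n *\<^sub>C diff_power n T) (diff_pser \<alpha>) sequentially"
  unfolding diff_pser_def
proof (rule Weierstrass_m_test)
  show "norm (\<alpha> n *\<^sub>C diff_power n T) \<le> cmod (\<alpha> n) * (real n * \<rho> ^ (n - 1))"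
    if "T \<in> {T :: 'a bop. norm T \<le> \<rho>}" for n T
    using that unfolding norm_scaleC mem_Collect_eq by (intro mult_left_mono norm_diff_power_le) auto
qed (rule summable_norm_deriv[OF assms])

lemma sums_diff_pser:
  fixes T :: "'a::complex_banach bop"
  assumes "norm T \<le> \<rho>" "ereal \<rho> < conv_radius \<alpha>"
  shows "(\<lambda>n. \<alpha> n *\<^sub>C diff_power n T) sums diff_pser \<alpha> T"
proof -
  have "0 \<le> \<rho>" using assms(1) norm_ge_zero order_trans by blast
  from tendsto_uniform_limitI[OF uniform_limit_diff_pser[OF this assms(2)]] assms(1)
  show ?thesis unfolding sums_def by simp
qed

lemma continuous_on_diff_pser:
  fixes \<alpha> :: "nat \<Rightarrow> complex"
  assumes "0 \<le> \<rho>" "ereal \<rho> < conv_radius \<alpha>"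
  shows "continuous_on {T :: 'a::complex_banach bop. norm T \<le> \<rho>} (diff_pser \<alpha>)"
  by (rule uniform_limit_theorem[OF _ uniform_limit_diff_pser[OF assms]])
    (auto intro!: always_eventually continuous_on_sum scaleC.continuous_on continuous_on_diff_power)

lemma has_derivative_power_series_bop:
  fixes T :: "'a::complex_banach bop"
  assumes T: "norm T \<le> \<rho>" and \<rho>: "ereal \<rho> < conv_radius \<alpha>"
  shows "((\<lambda>T. \<Sum>n. \<alpha> n *\<^sub>C T ^ n) has_derivative bop_apply (diff_pser \<alpha> T)) (at T)"
proof -
  have "0 \<le> \<rho>" using T norm_ge_zero order_trans by blast
  obtain K :: real where K: "\<rho> < K" "ereal K < conv_radius \<alpha>"
    using ereal_dense2[OF \<rho>] by (metis ereal_less_eq(3) less_ereal.simps(1) not_le ereal_less(2))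
  define S where "S = ball (0 :: 'a bop) K"
  have K0: "0 \<le> K" using K \<open>0 \<le> \<rho>\<close> by simp
  have TS: "T \<in> S" and zS: "0 \<in> S" using T K \<open>0 \<le> \<rho>\<close> by (auto simp: S_def)
  have "\<exists>g. \<forall>T\<in>S. (\<lambda>n. \<alpha> n *\<^sub>C T ^ n) sums g T \<and> (g has_derivative bop_apply (diff_pser \<alpha> T)) (at T within S)"
  proof (rule has_derivative_series[OF _ _ _ zS])
    show "convex S" by (simp add: S_def)
    show "((\<lambda>T. \<alpha> n *\<^sub>C T ^ n) has_derivative (\<lambda>h. bop_apply (\<alpha> n *\<^sub>C diff_power n T) h)) (at T within S)" for n T
      using bounded_linear.has_derivative[OF bounded_linear_scaleC has_derivative_power_bop]
      by (simp add: bop_apply_simps)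
    show "(\<lambda>n. \<alpha> n *\<^sub>C (0 :: 'a bop) ^ n) sums (\<alpha> 0 *\<^sub>C 1)"
    proof -
      have "\<alpha> n *\<^sub>C (0 :: 'a bop) ^ n = 0" if "n \<notin> {0}" for n
        using that by (cases n) auto
      then show ?thesis
        using sums_finite[of "{0}" "\<lambda>n. \<alpha> n *\<^sub>C (0 :: 'a bop) ^ n"] by simp
    qed
    fix e :: real assume e: "e > 0"
    have "\<forall>\<^sub>F N in sequentially. \<forall>T\<in>{T :: 'a bop. norm T \<le> K}. dist (\<Sum>n<N. \<alpha> n *\<^sub>C diff_power n T) (diff_pser \<alpha> T) < e"
      using uniform_limit_diff_pser[OF K0 K(2)] e unfolding uniform_limit_iff by blast
    then show "\<forall>\<^sub>F N in sequentially. \<forall>T\<in>S. \<forall>h.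
        norm ((\<Sum>i<N. bop_apply (\<alpha> i *\<^sub>C diff_power i T) h) - bop_apply (diff_pser \<alpha> T) h) \<le> e * norm h"
    proof eventually_elim
      case (elim N)
      show ?case
      proof (intro ballI allI)
        fix T :: "'a bop" and h assume "T \<in> S"
        then have "norm ((\<Sum>n<N. \<alpha> n *\<^sub>C diff_power n T) - diff_pser \<alpha> T) \<le> e"
          using elim by (auto simp: S_def dist_norm less_imp_le)
        then have "norm (bop_apply ((\<Sum>n<N. \<alpha> n *\<^sub>C diff_power n T) - diff_pser \<alpha> T) h) \<le> e * norm h"
          by (intro order_trans[OF norm_bop_apply_le] mult_right_mono) auto
        then show "norm ((\<Sum>i<N. bop_apply (\<alpha> i *\<^sub>C diff_power i T) h) - bop_apply (diff_pser \<alpha> T) h) \<le> e * norm h"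
          by (simp add: bop_apply_linear bop_apply.sum_left)
      qed
    qed
  qed
  then obtain g where g: "\<And>T. T \<in> S \<Longrightarrow> (\<lambda>n. \<alpha> n *\<^sub>C T ^ n) sums g T"
    "\<And>T. T \<in> S \<Longrightarrow> (g has_derivative bop_apply (diff_pser \<alpha> T)) (at T within S)"
    by blast
  have "(g has_derivative bop_apply (diff_pser \<alpha> T)) (at T)"
    using g(2)[OF TS] TS at_within_open[of T S] by (simp add: S_def)
  then show ?thesis
    by (rule has_derivative_transform_within_open[of _ _ _ _ S])
      (use TS g(1) sums_unique in \<open>auto simp: S_def\<close>)
qed

section \<open>Three expansions of the differential\<close>

lemma scaleC_of_nat: "of_nat n *\<^sub>C x = real n *\<^sub>R x"
  for x :: "'a::complex_normed_space"
  by (metis of_real_of_nat_eq scaleC_of_real)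

lemma norm_scaleC_mult_le:
  fixes x y :: "'a::complex_normed_space bop"
  shows "norm x \<le> c \<Longrightarrow> norm y \<le> d \<Longrightarrow> 0 \<le> c \<Longrightarrow> norm (\<mu> *\<^sub>C (x * y)) \<le> cmod \<mu> * (c * d)"
  unfolding norm_scaleC by (intro mult_left_mono norm_mult_le) auto

lemma norm_Lop_power_le: "norm T \<le> \<rho> \<Longrightarrow> norm (Lop T ^ n) \<le> \<rho> ^ n"
  and norm_Rop_power_le: "norm T \<le> \<rho> \<Longrightarrow> norm (Rop T ^ n) \<le> \<rho> ^ n"
  and norm_Cop_power_le: "norm T \<le> \<rho> \<Longrightarrow> norm (Cop T ^ n) \<le> (2 * \<rho>) ^ n"
  using norm_Lop_le[of T] norm_Rop_le[of T] norm_Cop_le[of T] by (intro norm_power_bop_le'; linarith)+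

text \<open>
  The expansion in powers of \<open>Cop T\<close>. Majorizing \<open>Rop T\<close> by \<open>\<rho>\<close> and \<open>Cop T\<close> by \<open>2 * \<rho>\<close> amounts to
  replacing the difference quotient by its value at \<open>\<rho>\<close> and \<open>\<rho> + 2 * \<rho>\<close>; hence the factor \<open>3\<close>.
\<close>

definition binomial_term :: "(nat \<Rightarrow> complex) \<Rightarrow> nat \<Rightarrow> 'a::complex_normed_space bop \<Rightarrow> 'a bop bop" where
  "binomial_term \<alpha> p T = (1 / fact (Suc p)) *\<^sub>R (pser_deriv \<alpha> (Suc p) (Rop T) * Cop T ^ p)"

definition binomial_coeff :: "(nat \<Rightarrow> complex) \<Rightarrow> nat \<Rightarrow> nat \<Rightarrow> complex" where
  "binomial_coeff \<alpha> n p = of_nat (n choose Suc p) * \<alpha> n"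

lemma binomial_majorant:
  assumes "0 \<le> \<rho>" "ereal (3 * \<rho>) < conv_radius \<alpha>"
  shows "summable (\<lambda>n. \<Sum>p\<le>n. cmod (binomial_coeff \<alpha> n p) * (\<rho> ^ (n - Suc p) * (2 * \<rho>) ^ p))"
proof (rule summable_comparison_test'[of "\<lambda>n. cmod (\<alpha> n) * (real n * (3 * \<rho>) ^ (n - 1))" 0])
  show "summable (\<lambda>n. cmod (\<alpha> n) * (real n * (3 * \<rho>) ^ (n - 1)))"
    by (rule summable_norm_deriv) (use assms in auto)
  fix n :: nat
  let ?s = "\<Sum>p\<le>n. cmod (binomial_coeff \<alpha> n p) * (\<rho> ^ (n - Suc p) * (2 * \<rho>) ^ p)"
  have "?s = (\<Sum>p<n. cmod (binomial_coeff \<alpha> n p) * (\<rho> ^ (n - Suc p) * (2 * \<rho>) ^ p))"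
    by (rule sum.mono_neutral_right) (auto simp: binomial_coeff_def not_less)
  also have "\<dots> = cmod (\<alpha> n) * (\<Sum>p<n. real (n choose Suc p) *\<^sub>R (\<rho> ^ (n - Suc p) * (3 * \<rho> - \<rho>) ^ p))"
    unfolding sum_distrib_left by (rule sum.cong) (auto simp: binomial_coeff_def norm_mult)
  also have "\<dots> = cmod (\<alpha> n) * power_dq n \<rho> (3 * \<rho>)"
    by (subst power_dq_binomial) (auto simp: mult.commute)
  also have "power_dq n \<rho> (3 * \<rho>) \<le> (\<Sum>i<n. (3 * \<rho>) ^ (n - 1))"
    unfolding power_dq_def
  proof (rule sum_mono)
    fix i assume "i \<in> {..<n}"
    have "\<rho> ^ i * (3 * \<rho>) ^ (n - 1 - i) \<le> (3 * \<rho>) ^ i * (3 * \<rho>) ^ (n - 1 - i)"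
      using assms(1) by (intro mult_right_mono power_mono) auto
    also have "\<dots> = (3 * \<rho>) ^ (n - 1)"
      using \<open>i \<in> {..<n}\<close> by (subst power_add[symmetric]) auto
    finally show "\<rho> ^ i * (3 * \<rho>) ^ (n - 1 - i) \<le> (3 * \<rho>) ^ (n - 1)" .
  qed
  finally have "?s \<le> cmod (\<alpha> n) * (real n * (3 * \<rho>) ^ (n - 1))"
    by (simp add: mult_left_mono)
  moreover have "0 \<le> ?s"
    using assms(1) by (intro sum_nonneg mult_nonneg_nonneg) auto
  ultimately show "norm ?s \<le> cmod (\<alpha> n) * (real n * (3 * \<rho>) ^ (n - 1))"
    by simp
qed

lemma summable_pser_deriv:
  fixes Q :: "'a::complex_banach bop"
  assumes Q: "norm Q \<le> \<rho>" and \<rho>: "ereal \<rho> < conv_radius \<alpha>"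
  shows "summable (\<lambda>n. (fact p * of_nat (n choose p) * \<alpha> n) *\<^sub>C Q ^ (n - p))"
proof -
  have \<rho>0: "0 \<le> \<rho>" using Q norm_ge_zero order_trans by blast
  obtain K :: real where K: "\<rho> < K" "ereal K < conv_radius \<alpha>"
    using ereal_dense2[OF \<rho>] by (metis ereal_less_eq(3) less_ereal.simps(1) not_le ereal_less(2))
  show ?thesis
  proof (rule summable_comparison_test'[of "\<lambda>n. fact p / (K - \<rho>) ^ p * norm (\<alpha> n * of_real K ^ n)" 0])
    show "summable (\<lambda>n. fact p / (K - \<rho>) ^ p * norm (\<alpha> n * of_real K ^ n))"
      by (intro summable_mult abs_summable_in_conv_radius) (use K \<rho>0 in auto)
    fix n :: nat
    \<comment> \<open>A single term of the binomial expansion of \<open>((K - \<rho>) + \<rho>) ^ n\<close>.\<close>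
    have "real (n choose p) * (K - \<rho>) ^ p * \<rho> ^ (n - p) \<le> K ^ n"
    proof (cases "p \<le> n")
      case True
      have "real (n choose p) * (K - \<rho>) ^ p * \<rho> ^ (n - p) \<le> (\<Sum>k\<le>n. real (n choose k) * (K - \<rho>) ^ k * \<rho> ^ (n - k))"
        by (rule member_le_sum[of p "{..n}" "\<lambda>k. real (n choose k) * (K - \<rho>) ^ k * \<rho> ^ (n - k)"])
          (use True K \<rho>0 in auto)
      also have "\<dots> = ((K - \<rho>) + \<rho>) ^ n" by (rule binomial_ring[symmetric])
      finally show ?thesis by simp
    qed (use K \<rho>0 in \<open>simp add: binomial_eq_0\<close>)
    then have le: "real (n choose p) * \<rho> ^ (n - p) \<le> K ^ n / (K - \<rho>) ^ p"
      using K by (simp add: pos_le_divide_eq mult_ac)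
    have "norm ((fact p * of_nat (n choose p) * \<alpha> n) *\<^sub>C Q ^ (n - p))
        = fact p * cmod (\<alpha> n) * (real (n choose p) * norm (Q ^ (n - p)))"
      by (simp add: norm_scaleC norm_mult norm_fact)
    also have "\<dots> \<le> fact p * cmod (\<alpha> n) * (real (n choose p) * \<rho> ^ (n - p))"
      by (intro mult_left_mono norm_power_bop_le'[OF Q]) auto
    also have "\<dots> \<le> fact p * cmod (\<alpha> n) * (K ^ n / (K - \<rho>) ^ p)"
      by (intro mult_left_mono le) auto
    finally show "norm ((fact p * of_nat (n choose p) * \<alpha> n) *\<^sub>C Q ^ (n - p))
        \<le> fact p / (K - \<rho>) ^ p * norm (\<alpha> n * of_real K ^ n)"
      using K \<rho>0 by (simp add: norm_mult norm_power)
  qed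
qed

lemma pser_deriv_Rop_apply:
  fixes T :: "'a::complex_banach bop"
  assumes T: "norm T \<le> \<rho>" and \<rho>: "ereal \<rho> < conv_radius \<alpha>"
  shows "bop_apply (pser_deriv \<alpha> p (Rop T)) k = pser_deriv \<alpha> p T * k"
proof -
  let ?c = "\<lambda>n. fact p * of_nat (n choose p) * \<alpha> n"
  have "bop_apply (pser_deriv \<alpha> p (Rop T)) k = (\<Sum>n. bop_apply (?c n *\<^sub>C Rop T ^ (n - p)) k)"
    unfolding pser_deriv_def
    by (rule bounded_linear.suminf[OF bop_apply.bounded_linear_left])
      (rule summable_pser_deriv[OF order_trans[OF norm_Rop_le T] \<rho>])
  also have "\<dots> = (\<Sum>n. (?c n *\<^sub>C T ^ (n - p)) * k)"
    by (simp add: bop_apply_simps Rop_power_apply scaleC_mult_left)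
  also have "\<dots> = pser_deriv \<alpha> p T * k"
    unfolding pser_deriv_def
    by (rule bounded_linear.suminf[OF bounded_linear_mult_left, symmetric]) (rule summable_pser_deriv[OF T \<rho>])
  finally show ?thesis .
qed

lemma suminf_shift_zero:
  fixes f :: "nat \<Rightarrow> 'b::real_normed_vector"
  assumes "summable (\<lambda>n. f (n + k))" "\<And>n. n < k \<Longrightarrow> f n = 0"
  shows "f sums (\<Sum>n. f (n + k))"
  using sums_iff_shift[of f k "\<Sum>n. f (n + k)"] summable_sums[OF assms(1)] assms(2) by simp

lemma binomial_expansion:
  fixes \<alpha> :: "nat \<Rightarrow> complex"
  assumes \<rho>: "0 \<le> \<rho>" "ereal (3 * \<rho>) < conv_radius \<alpha>"
  obtains K where "summable K" "\<And>p. 0 \<le> K p"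
    "\<And>(T :: 'a::complex_banach bop) p. norm T \<le> \<rho> \<Longrightarrow> norm (binomial_term \<alpha> p T) \<le> K p"
    "\<And>T :: 'a bop. norm T \<le> \<rho> \<Longrightarrow> (\<lambda>p. binomial_term \<alpha> p T) sums diff_pser \<alpha> T"
    "\<And>(T :: 'a bop) p h. norm T \<le> \<rho> \<Longrightarrow> bop_apply (binomial_term \<alpha> p T) h =
       (1 / fact (Suc p)) *\<^sub>R (pser_deriv \<alpha> (Suc p) T * bop_apply (Cop T ^ p) h)"
proof -
  define B where "B n p = cmod (binomial_coeff \<alpha> n p) * (\<rho> ^ (n - Suc p) * (2 * \<rho>) ^ p)" for n p
  define f where "f T n p = binomial_coeff \<alpha> n p *\<^sub>C (Rop T ^ (n - Suc p) * Cop T ^ p)" for T :: "'a bop" and n p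
  have sB: "summable (\<lambda>n. \<Sum>p\<le>n. B n p)"
    unfolding B_def by (rule binomial_majorant[OF \<rho>])
  have f_le: "norm (f T n p) \<le> B n p" if "norm T \<le> \<rho>" for T n p
    unfolding f_def B_def using norm_Rop_power_le[OF that] norm_Cop_power_le[OF that] \<rho>(1)
    by (intro norm_scaleC_mult_le) auto
  have \<rho>': "ereal \<rho> < conv_radius \<alpha>"
    using le_less_trans[OF _ \<rho>(2), of "ereal \<rho>"] \<rho>(1) by simp
  have zero: "f T n p = 0" if "n < Suc p" for T n p
    using that by (simp add: f_def binomial_coeff_def binomial_eq_0)
  have f_dq: "(\<Sum>p\<le>n. f T n p) = \<alpha> n *\<^sub>C diff_power n T" for T n
  proof -
    have "(\<Sum>p\<le>n. f T n p) = (\<Sum>p<n. f T n p)"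
      by (rule sum.mono_neutral_right) (use zero in auto)
    also have "\<dots> = (\<Sum>p<n. \<alpha> n *\<^sub>C (real (n choose Suc p) *\<^sub>R (Rop T ^ (n - Suc p) * Cop T ^ p)))"
      by (rule sum.cong) (auto simp: f_def binomial_coeff_def mult.commute[of "of_nat _"]
          scaleC_scaleC[symmetric] scaleC_of_nat)
    also have "\<dots> = \<alpha> n *\<^sub>C diff_power n T"
      unfolding diff_power_def power_dq_binomial[OF Rop_Lop_commute] Cop_def by (simp add: scaleC.sum_right)
    finally show ?thesis .
  qed
  \<comment> \<open>The terms with \<open>n = p\<close> vanish, too, so that the triangle \<open>p \<le> n\<close> may be used.\<close>
  have row: "(\<Sum>n. f T (n + p) p) = binomial_term \<alpha> p T" if T: "norm T \<le> \<rho>" for T p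
  proof -
    have s: "summable (\<lambda>n. f T (n + p) p)"
      by (rule summable_norm_cancel[OF summable_triangular(2)[OF f_le[OF T] sB]])
    have full: "(\<lambda>n. f T n p) sums (\<Sum>n. f T (n + p) p)"
      by (rule suminf_shift_zero[OF s]) (simp add: zero)
    define e where "e n = (fact (Suc p) * of_nat (n choose Suc p) * \<alpha> n) *\<^sub>C Rop T ^ (n - Suc p)" for n
    have f_e: "f T n p = (1 / fact (Suc p)) *\<^sub>R (e n * Cop T ^ p)" for n
    proof -
      have "(1 / fact (Suc p)) *\<^sub>R x = (1 / fact (Suc p) :: complex) *\<^sub>C x" for x :: "'a bop bop"
        by (metis of_real_1 of_real_divide of_real_fact scaleC_of_real)
      then show ?thesis
        by (simp add: f_def e_def binomial_coeff_def scaleC_mult_left scaleC_scaleC del: fact_Suc)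
    qed
    have "summable e"
      unfolding e_def by (rule summable_pser_deriv[OF order_trans[OF norm_Rop_le T] \<rho>'])
    then have "(\<lambda>n. (1 / fact (Suc p)) *\<^sub>R (e n * Cop T ^ p)) sums ((1 / fact (Suc p)) *\<^sub>R (suminf e * Cop T ^ p))"
      by (intro bounded_linear.sums[OF bounded_linear_scaleR_right] bounded_linear.sums[OF bounded_linear_mult_left] summable_sums)
    then have "(\<lambda>n. f T n p) sums binomial_term \<alpha> p T"
      unfolding f_e binomial_term_def pser_deriv_def e_def .
    then show ?thesis using full sums_unique2 by blast
  qed
  show ?thesis
  proof (rule that[of "\<lambda>p. \<Sum>n. norm (B (n + p) p)"])
    show "summable (\<lambda>p. \<Sum>n. norm (B (n + p) p))"
      using norm_suminf_triangular_le(2)[of "f 0", OF _ sB] f_le[of 0] \<rho>(1) by simp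
    show "0 \<le> (\<Sum>n. norm (B (n + p) p))" for p
      using norm_suminf_triangular_le(3)[of "f 0", OF _ sB] f_le[of 0] \<rho>(1) by (intro suminf_nonneg) auto
    show "norm (binomial_term \<alpha> p T) \<le> (\<Sum>n. norm (B (n + p) p))" if "norm T \<le> \<rho>" for T :: "'a bop" and p
      unfolding row[OF that, symmetric] by (rule norm_suminf_triangular_le(1)[OF f_le[OF that] sB])
    show "(\<lambda>p. binomial_term \<alpha> p T) sums diff_pser \<alpha> T" if T: "norm T \<le> \<rho>" for T :: "'a bop"
      using summable_triangular(4)[OF f_le[OF T] sB] by (simp add: row[OF T] f_dq diff_pser_def)
    show "bop_apply (binomial_term \<alpha> p T) h = (1 / fact (Suc p)) *\<^sub>R (pser_deriv \<alpha> (Suc p) T * bop_apply (Cop T ^ p) h)"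
      if T: "norm T \<le> \<rho>" for T :: "'a bop" and p h
      by (simp add: binomial_term_def bop_apply_linear bop_apply_simps pser_deriv_Rop_apply[OF T \<rho>'] del: fact_Suc)
  qed
qed

text \<open>
  The other two expansions become triangular once the multiples of the powers of \<open>Lop T\<close> have been split
  off. The remaining sums start at \<open>n = 2\<close>, hence the shift of the index.
\<close>

definition leading_term :: "(nat \<Rightarrow> complex) \<Rightarrow> nat \<Rightarrow> 'a::complex_normed_space bop \<Rightarrow> 'a bop bop" where
  "leading_term \<alpha> n T = (of_nat (n + 1) * \<alpha> (n + 1)) *\<^sub>C Lop T ^ n"

lemma norm_leading_term_le:
  "norm T \<le> \<rho> \<Longrightarrow> norm (leading_term \<alpha> n T) \<le> real (n + 1) * cmod (\<alpha> (n + 1)) * \<rho> ^ n"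
  unfolding leading_term_def norm_scaleC norm_mult norm_of_nat by (intro mult_left_mono norm_Lop_power_le) auto

lemma summable_leading_term:
  fixes T :: "'a::complex_banach bop"
  assumes T: "norm T \<le> \<rho>" and \<rho>: "ereal \<rho> < conv_radius \<alpha>"
  shows "summable (\<lambda>n. leading_term \<alpha> n T)"
proof (rule summable_comparison_test'[OF summable_diffs_norm(1), of _ _ 0])
  show "0 \<le> \<rho>" using T norm_ge_zero order_trans by blast
qed (use assms norm_leading_term_le in auto)

definition triangular_majorant :: "(nat \<Rightarrow> complex) \<Rightarrow> real \<Rightarrow> nat \<Rightarrow> nat \<Rightarrow> real" where
  "triangular_majorant \<alpha> \<rho> n k = real (n + 2) * cmod (\<alpha> (n + 2)) * (2 * \<rho> * \<rho> ^ n)"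

lemma summable_triangular_majorant:
  assumes "0 \<le> \<rho>" "ereal \<rho> < conv_radius \<alpha>"
  shows "summable (\<lambda>n. \<Sum>k\<le>n. triangular_majorant \<alpha> \<rho> n k)"
proof -
  have "(\<Sum>k\<le>n. triangular_majorant \<alpha> \<rho> n k) =
      2 * \<rho> * (real (n + 1) * real (n + 2) * cmod (\<alpha> (n + 2)) * \<rho> ^ n)" for n
    unfolding triangular_majorant_def by (simp add: algebra_simps)
  then show ?thesis
    using summable_mult[OF summable_diffs_norm(2)[OF assms], of "2 * \<rho>"] by simp
qed

definition commutator_term :: "(nat \<Rightarrow> complex) \<Rightarrow> nat \<Rightarrow> nat \<Rightarrow> 'a::complex_normed_space bop \<Rightarrow> 'a bop bop" where
  "commutator_term \<alpha> n p T = (of_nat (n + 1 - p) * \<alpha> (n + 2)) *\<^sub>C (Rop T ^ p * (Rop T - Lop T) * Lop T ^ (n - p))"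

definition power_difference_term :: "(nat \<Rightarrow> complex) \<Rightarrow> nat \<Rightarrow> nat \<Rightarrow> 'a::complex_normed_space bop \<Rightarrow> 'a bop bop" where
  "power_difference_term \<alpha> n k T = \<alpha> (n + 2) *\<^sub>C (Lop T ^ (n - k) * Cop (T ^ (k + 1)))"

lemma norm_commutator_term_le:
  assumes T: "norm T \<le> \<rho>" and "p \<le> n"
  shows "norm (commutator_term \<alpha> n p T) \<le> triangular_majorant \<alpha> \<rho> n p"
proof -
  have \<rho>: "0 \<le> \<rho>" using T norm_ge_zero order_trans by blast
  have "norm (Rop T - Lop T) \<le> 2 * \<rho>"
    using norm_Cop_le[of T] T unfolding Cop_def by (subst norm_minus_commute) linarith
  then have "norm (commutator_term \<alpha> n p T) \<le> cmod (of_nat (n + 1 - p) * \<alpha> (n + 2)) * (\<rho> ^ p * (2 * \<rho>) * \<rho> ^ (n - p))"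
    unfolding commutator_term_def using \<rho>
    by (intro norm_scaleC_mult_le norm_mult_le norm_Rop_power_le norm_Lop_power_le T mult_nonneg_nonneg) auto
  also have "\<rho> ^ p * (2 * \<rho>) * \<rho> ^ (n - p) = 2 * \<rho> * (\<rho> ^ p * \<rho> ^ (n - p))"
    by simp
  also have "\<rho> ^ p * \<rho> ^ (n - p) = \<rho> ^ n"
    using \<open>p \<le> n\<close> by (simp add: power_add[symmetric])
  also have "cmod (of_nat (n + 1 - p) * \<alpha> (n + 2)) * (2 * \<rho> * \<rho> ^ n) \<le> triangular_majorant \<alpha> \<rho> n p"
    unfolding triangular_majorant_def norm_mult norm_of_nat using \<rho>
    by (intro mult_right_mono) auto
  finally show ?thesis .
qed

lemma norm_power_difference_term_le:
  assumes T: "norm T \<le> \<rho>" and "k \<le> n"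
  shows "norm (power_difference_term \<alpha> n k T) \<le> triangular_majorant \<alpha> \<rho> n k"
proof -
  have \<rho>: "0 \<le> \<rho>" using T norm_ge_zero order_trans by blast
  have "norm (Cop (T ^ (k + 1))) \<le> 2 * \<rho> ^ (k + 1)"
    using norm_Cop_le[of "T ^ (k + 1)"] norm_power_bop_le'[OF T, of "k + 1"] by linarith
  then have "norm (power_difference_term \<alpha> n k T) \<le> cmod (\<alpha> (n + 2)) * (\<rho> ^ (n - k) * (2 * \<rho> ^ (k + 1)))"
    unfolding power_difference_term_def using \<rho>
    by (intro norm_scaleC_mult_le norm_Lop_power_le T) auto
  also have "\<rho> ^ (n - k) * (2 * \<rho> ^ (k + 1)) = 2 * \<rho> * (\<rho> ^ (n - k) * \<rho> ^ k)"
    by simp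
  also have "\<rho> ^ (n - k) * \<rho> ^ k = \<rho> ^ n"
    using \<open>k \<le> n\<close> by (simp add: power_add[symmetric])
  also have "cmod (\<alpha> (n + 2)) * (2 * \<rho> * \<rho> ^ n) \<le> triangular_majorant \<alpha> \<rho> n k"
    unfolding triangular_majorant_def using \<rho>
    by (simp add: mult_right_mono mult_le_cancel_right1)
  finally show ?thesis .
qed

lemma diff_pser_split:
  fixes T :: "'a::complex_banach bop"
  assumes T: "norm T \<le> \<rho>" and \<rho>: "ereal \<rho> < conv_radius \<alpha>"
  shows "diff_pser \<alpha> T = (\<Sum>n. leading_term \<alpha> n T) + (\<Sum>n. \<Sum>p\<le>n. commutator_term \<alpha> n p T)"
    and "diff_pser \<alpha> T = (\<Sum>n. leading_term \<alpha> n T) - (\<Sum>n. \<Sum>k\<le>n. power_difference_term \<alpha> n k T)"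
proof -
  have \<rho>0: "0 \<le> \<rho>" using T norm_ge_zero order_trans by blast
  note sB = summable_triangular_majorant[OF \<rho>0 \<rho>]
  have com: "summable (\<lambda>n. \<Sum>p\<le>n. commutator_term \<alpha> n p T)"
    and pow: "summable (\<lambda>n. \<Sum>k\<le>n. power_difference_term \<alpha> n k T)"
    by (rule summable_triangular(1)[OF _ sB], rule norm_commutator_term_le norm_power_difference_term_le, rule T, assumption)+
  note sc = summable_leading_term[OF T \<rho>]
  have one: "diff_power (Suc 0) T = 1"
    by (simp add: diff_power_def power_dq_Suc)
  \<comment> \<open>The terms with \<open>n = 0\<close> and \<open>n = 1\<close> of the defining series are \<open>0\<close> and the first leading term.\<close>
  have "diff_pser \<alpha> T = (\<Sum>n. \<alpha> (n + 2) *\<^sub>C diff_power (n + 2) T) + (\<Sum>n<2. \<alpha> n *\<^sub>C diff_power n T)"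
    unfolding diff_pser_def
    by (rule suminf_split_initial_segment[OF sums_summable[OF sums_diff_pser[OF T \<rho>]]])
  also have "(\<Sum>n<2. \<alpha> n *\<^sub>C diff_power n T) = leading_term \<alpha> 0 T"
    by (simp add: numeral_2_eq_2 one leading_term_def) (simp add: diff_power_def)
  finally have tail: "diff_pser \<alpha> T = (\<Sum>n. \<alpha> (n + 2) *\<^sub>C diff_power (n + 2) T) + leading_term \<alpha> 0 T" .
  have sc': "(\<Sum>n. leading_term \<alpha> n T) = (\<Sum>n. leading_term \<alpha> (Suc n) T) + leading_term \<alpha> 0 T"
    using suminf_split_head[OF sc] by simp
  have sc_Suc: "summable (\<lambda>n. leading_term \<alpha> (Suc n) T)"
    using sc by (subst summable_Suc_iff)
  have real_of_nat: "real m *\<^sub>R x = of_nat m *\<^sub>C x" for m and x :: "'a bop bop"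
    by (simp add: scaleC_of_nat)
  have c: "\<alpha> (n + 2) *\<^sub>C diff_power (n + 2) T = leading_term \<alpha> (Suc n) T + (\<Sum>p\<le>n. commutator_term \<alpha> n p T)" for n
    using power_dq_commutator[OF Rop_Lop_commute, of n T]
    by (simp add: diff_power_def leading_term_def commutator_term_def scaleC_add_right scaleC.sum_right
        real_of_nat scaleC_scaleC mult.commute[of "\<alpha> _"] del: of_nat_Suc of_nat_add of_nat_diff)
  have d: "\<alpha> (n + 2) *\<^sub>C diff_power (n + 2) T = leading_term \<alpha> (Suc n) T - (\<Sum>k\<le>n. power_difference_term \<alpha> n k T)" for n
    using power_dq_power_differences[OF Rop_Lop_commute, of n T]
    by (simp add: diff_power_def leading_term_def power_difference_term_def scaleC.diff_right scaleC.sum_right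
        real_of_nat scaleC_scaleC mult.commute[of "\<alpha> _"] Cop_def Lop_power[of T "Suc _"] Rop_power[of T "Suc _"]
        del: of_nat_Suc of_nat_add of_nat_diff power_Suc)
  show "diff_pser \<alpha> T = (\<Sum>n. leading_term \<alpha> n T) + (\<Sum>n. \<Sum>p\<le>n. commutator_term \<alpha> n p T)"
    unfolding tail sc' c suminf_add[OF sc_Suc com, symmetric] by simp
  show "diff_pser \<alpha> T = (\<Sum>n. leading_term \<alpha> n T) - (\<Sum>n. \<Sum>k\<le>n. power_difference_term \<alpha> n k T)"
    unfolding tail sc' d suminf_diff[OF sc_Suc pow, symmetric] by simp
qed

section \<open>Differentiable families of operators\<close>

lemma summable_norm_shift:
  assumes "0 \<le> \<rho>" "ereal \<rho> < conv_radius \<alpha>"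
  shows "summable (\<lambda>n. cmod (\<alpha> (n + k)) * \<rho> ^ n)"
proof -
  obtain K :: real where K: "\<rho> < K" "ereal K < conv_radius \<alpha>"
    using ereal_dense2[OF assms(2)] by (metis ereal_less_eq(3) less_ereal.simps(1) not_le ereal_less(2))
  have "summable (\<lambda>n. norm (\<alpha> n * of_real K ^ n))"
    by (rule abs_summable_in_conv_radius) (use K assms(1) in auto)
  then have "summable (\<lambda>n. norm (\<alpha> (n + k) * of_real K ^ (n + k)) / K ^ k)"
    by (intro summable_divide) (rule summable_ignore_initial_segment)
  moreover have "norm (\<alpha> (n + k) * of_real K ^ (n + k)) / K ^ k = cmod (\<alpha> (n + k)) * K ^ n" for n
    using K assms(1) by (simp add: norm_mult norm_power power_add)
  ultimately have "summable (\<lambda>n. cmod (\<alpha> (n + k)) * K ^ n)" by simp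
  then show ?thesis
    by (rule summable_comparison_test'[of _ 0])
      (use K assms(1) in \<open>auto simp: abs_mult intro!: mult_left_mono power_mono\<close>)
qed

lemma SUP_norm_finite:
  assumes "(SUP x\<in>D. ennreal (norm (f x))) < \<infinity>"
  obtains m where "0 \<le> m" "\<And>x. x \<in> D \<Longrightarrow> norm (f x) \<le> m"
proof
  show "0 \<le> enn2real (SUP x\<in>D. ennreal (norm (f x)))" by simp
  fix x assume "x \<in> D"
  then have "ennreal (norm (f x)) \<le> (SUP x\<in>D. ennreal (norm (f x)))" by (rule SUP_upper)
  then have "enn2real (ennreal (norm (f x))) \<le> enn2real (SUP x\<in>D. ennreal (norm (f x)))"
    by (rule enn2real_mono) (use assms in \<open>simp add: less_top\<close>)
  then show "norm (f x) \<le> enn2real (SUP x\<in>D. ennreal (norm (f x)))" by simp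
qed

text \<open>
  The hypotheses shared by all expansions. The radius \<open>\<rho>\<close> is an arbitrary bound, since the expansion in
  powers of \<open>Cop\<close> wants the supremum of the norms while the others work with any bound below the
  radius of convergence.
\<close>

locale differentiable_family =
  fixes \<alpha> :: "nat \<Rightarrow> complex" and D :: "'x::real_normed_vector set"
    and \<T> :: "'x \<Rightarrow> 'g::complex_banach bop" and F :: "'x \<Rightarrow> 'g bop" and \<rho> :: real
  assumes open_D: "open D" and diff_\<T>: "\<And>x. x \<in> D \<Longrightarrow> \<T> differentiable (at x)"
    and \<rho>: "0 \<le> \<rho>" "ereal \<rho> < conv_radius \<alpha>" and norm_\<T>: "\<And>x. x \<in> D \<Longrightarrow> norm (\<T> x) \<le> \<rho>"
    and F_sums: "\<And>x. x \<in> D \<Longrightarrow> (\<lambda>n. \<alpha> n *\<^sub>C \<T> x ^ n) sums F x"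
begin

abbreviation \<tau> where "\<tau> x \<equiv> frechet_diff \<T> x"

lemma abs_unif_convergent_power_series: "abs_unif_convergent_on D (\<lambda>n x. \<alpha> n *\<^sub>C \<T> x ^ n)"
proof (rule abs_unif_convergent_onI)
  show "norm (\<alpha> n *\<^sub>C \<T> x ^ n) \<le> cmod (\<alpha> n) * \<rho> ^ n" if "x \<in> D" for n x
    unfolding norm_scaleC by (intro mult_left_mono norm_power_bop_le' norm_\<T> that) simp
  show "summable (\<lambda>n. cmod (\<alpha> n) * \<rho> ^ n)"
    using summable_norm_shift[OF \<rho>, of 0] by simp
qed (use \<rho> in simp)

lemma has_derivative_F:
  assumes x: "x \<in> D"
  shows "(F has_derivative blinfun_apply (diff_pser \<alpha> (\<T> x) \<odot> \<tau> x)) (at x)"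
proof -
  have "((\<lambda>x. \<Sum>n. \<alpha> n *\<^sub>C \<T> x ^ n) has_derivative
      (\<lambda>h. bop_apply (diff_pser \<alpha> (\<T> x)) (blinfun_apply (\<tau> x) h))) (at x)"
    by (rule has_derivative_compose[OF frechet_diff_has_derivative[OF diff_\<T>[OF x]]
          has_derivative_power_series_bop[OF norm_\<T>[OF x] \<rho>(2)]])
  then have "((\<lambda>x. \<Sum>n. \<alpha> n *\<^sub>C \<T> x ^ n) has_derivative blinfun_apply (diff_pser \<alpha> (\<T> x) \<odot> \<tau> x)) (at x)"
    by (simp add: bop_comp_apply[abs_def])
  then show ?thesis
    by (rule has_derivative_transform_within_open[OF _ open_D x]) (use F_sums sums_unique in metis)
qed

lemma differentiable_F: "x \<in> D \<Longrightarrow> F differentiable (at x)"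
  using has_derivative_F unfolding differentiable_def by blast

lemma frechet_diff_F: "x \<in> D \<Longrightarrow> frechet_diff F x = diff_pser \<alpha> (\<T> x) \<odot> \<tau> x"
  by (rule frechet_diff_eqI[OF has_derivative_F])

lemma frechet_diff_F_apply:
  "x \<in> D \<Longrightarrow> blinfun_apply (frechet_diff F x) h = bop_apply (diff_pser \<alpha> (\<T> x)) (blinfun_apply (\<tau> x) h)"
  by (simp add: frechet_diff_F bop_comp_apply)

text \<open>How bounds on coefficient operators pass to the series that occur in the differential.\<close>

lemma abs_unif_convergent_bop_comp:
  assumes A: "\<And>n x. x \<in> D \<Longrightarrow> norm (A n x) \<le> K n" "summable K" "\<And>n. 0 \<le> K n"
    and m: "0 \<le> m" "\<And>x. x \<in> D \<Longrightarrow> norm (\<tau> x) \<le> m"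
  shows "abs_unif_convergent_on D (\<lambda>n x. A n x \<odot> \<tau> x)"
proof (rule abs_unif_convergent_onI)
  show "norm (A n x \<odot> \<tau> x) \<le> K n * m" if "x \<in> D" for n x
    by (rule order_trans[OF norm_bop_comp_le mult_mono]) (use A m that in auto)
qed (use A m in \<open>auto intro: summable_mult2\<close>)

lemma abs_unif_convergent_apply:
  assumes A: "\<And>n x. x \<in> D \<Longrightarrow> norm (A n x) \<le> K n" "summable K" "\<And>n. 0 \<le> K n"
    and m: "0 \<le> m" "\<And>x. x \<in> D \<Longrightarrow> norm (\<tau> x) \<le> m" and L: "L > 0"
  shows "abs_unif_convergent_on (D \<times> ball 0 L) (\<lambda>n (x, h). bop_apply (A n x) (blinfun_apply (\<tau> x) h))"
proof (rule abs_unif_convergent_onI)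
  fix n and u :: "'x \<times> 'x" assume "u \<in> D \<times> ball 0 L"
  then obtain x h where u: "u = (x, h)" "x \<in> D" "norm h \<le> L" by (cases u) auto
  have "norm (bop_apply (A n x) (blinfun_apply (\<tau> x) h)) \<le> norm (A n x) * (norm (\<tau> x) * norm h)"
    by (rule order_trans[OF norm_bop_apply_le mult_left_mono[OF norm_blinfun]]) simp
  also have "\<dots> \<le> K n * (m * L)"
    using u A m L by (intro mult_mono) auto
  finally show "norm (case u of (x, h) \<Rightarrow> bop_apply (A n x) (blinfun_apply (\<tau> x) h)) \<le> K n * (m * L)"
    by (simp add: u)
qed (use A m L in \<open>auto intro: summable_mult2\<close>)

lemma termwise_differentiation:
  "(\<forall>x\<in>D. (\<lambda>n. \<alpha> n *\<^sub>C (frechet_diff (\<lambda>T. T ^ n) (\<T> x) o\<^sub>L \<tau> x)) sums frechet_diff F x) \<and>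
   (continuous_on D \<tau> \<longrightarrow> continuous_on D (frechet_diff F)) \<and>
   ((SUP x\<in>D. ennreal (norm (\<tau> x))) < \<infinity> \<longrightarrow>
     abs_unif_convergent_on D (\<lambda>n x. \<alpha> n *\<^sub>C (frechet_diff (\<lambda>T. T ^ n) (\<T> x) o\<^sub>L \<tau> x)))"
proof (intro conjI ballI impI)
  have eq: "\<alpha> n *\<^sub>C (frechet_diff (\<lambda>T. T ^ n) (\<T> x) o\<^sub>L \<tau> x) = (\<alpha> n *\<^sub>C diff_power n (\<T> x)) \<odot> \<tau> x" for n x
    unfolding frechet_diff_power bop_comp_scaleC by (simp add: bop_comp_def)
  show "(\<lambda>n. \<alpha> n *\<^sub>C (frechet_diff (\<lambda>T. T ^ n) (\<T> x) o\<^sub>L \<tau> x)) sums frechet_diff F x" if x: "x \<in> D" for x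
    unfolding eq frechet_diff_F[OF x]
    by (intro bounded_linear.sums[OF bop_comp.bounded_linear_left] sums_diff_pser[OF norm_\<T>[OF x] \<rho>(2)])
  show "continuous_on D (frechet_diff F)" if \<tau>: "continuous_on D \<tau>"
  proof -
    have "continuous_on D \<T>"
      by (intro continuous_at_imp_continuous_on ballI differentiable_imp_continuous_within diff_\<T>)
    then have "continuous_on D (\<lambda>x. diff_pser \<alpha> (\<T> x))"
      by (rule continuous_on_compose2[OF continuous_on_diff_pser[OF \<rho>]]) (use norm_\<T> in auto)
    then have "continuous_on D (\<lambda>x. diff_pser \<alpha> (\<T> x) \<odot> \<tau> x)"
      using \<tau> by (rule bop_comp.continuous_on)
    then show ?thesis
      by (subst continuous_on_cong[OF refl frechet_diff_F]) auto
  qed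
  assume M: "(SUP x\<in>D. ennreal (norm (\<tau> x))) < \<infinity>"
  obtain m where m: "0 \<le> m" "\<And>x. x \<in> D \<Longrightarrow> norm (\<tau> x) \<le> m" using SUP_norm_finite[OF M] by blast
  show "abs_unif_convergent_on D (\<lambda>n x. \<alpha> n *\<^sub>C (frechet_diff (\<lambda>T. T ^ n) (\<T> x) o\<^sub>L \<tau> x))"
    unfolding eq
  proof (rule abs_unif_convergent_bop_comp[OF _ summable_norm_deriv[OF \<rho>] _ m])
    show "norm (\<alpha> n *\<^sub>C diff_power n (\<T> x)) \<le> cmod (\<alpha> n) * (real n * \<rho> ^ (n - 1))" if "x \<in> D" for n x
      unfolding norm_scaleC by (intro mult_left_mono norm_diff_power_le norm_\<T> that) simp
  qed (use \<rho> in auto)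
qed

lemma commutator_power_expansion:
  assumes "ereal (3 * \<rho>) < conv_radius \<alpha>"
  shows "(\<forall>x\<in>D. (\<lambda>p. (1 / fact (Suc p)) *\<^sub>R ((pser_deriv \<alpha> (Suc p) (Rop (\<T> x)) * Cop (\<T> x) ^ p) \<odot> \<tau> x))
            sums frechet_diff F x) \<and>
     (\<forall>x\<in>D. \<forall>h. (\<lambda>p. (1 / fact (Suc p)) *\<^sub>R
            (pser_deriv \<alpha> (Suc p) (\<T> x) * bop_apply (Cop (\<T> x) ^ p) (blinfun_apply (\<tau> x) h)))
            sums blinfun_apply (frechet_diff F x) h) \<and>
     ((SUP x\<in>D. ennreal (norm (\<tau> x))) < \<infinity> \<longrightarrow>
        abs_unif_convergent_on D (\<lambda>p x. (1 / fact (Suc p)) *\<^sub>R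
               ((pser_deriv \<alpha> (Suc p) (Rop (\<T> x)) * Cop (\<T> x) ^ p) \<odot> \<tau> x)) \<and>
        (\<forall>L>0. abs_unif_convergent_on (D \<times> ball 0 L) (\<lambda>p (x, h). (1 / fact (Suc p)) *\<^sub>R
               (pser_deriv \<alpha> (Suc p) (\<T> x) * bop_apply (Cop (\<T> x) ^ p) (blinfun_apply (\<tau> x) h)))))"
proof (rule binomial_expansion[OF \<rho>(1) assms])
  fix K :: "nat \<Rightarrow> real"
  assume K: "summable K" "\<And>p. 0 \<le> K p"
    "\<And>(T :: 'g bop) p. norm T \<le> \<rho> \<Longrightarrow> norm (binomial_term \<alpha> p T) \<le> K p"
    "\<And>T :: 'g bop. norm T \<le> \<rho> \<Longrightarrow> (\<lambda>p. binomial_term \<alpha> p T) sums diff_pser \<alpha> T"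
    "\<And>(T :: 'g bop) p h. norm T \<le> \<rho> \<Longrightarrow> bop_apply (binomial_term \<alpha> p T) h =
       (1 / fact (Suc p)) *\<^sub>R (pser_deriv \<alpha> (Suc p) T * bop_apply (Cop T ^ p) h)"
  have eq: "(1 / fact (Suc p)) *\<^sub>R ((pser_deriv \<alpha> (Suc p) (Rop (\<T> x)) * Cop (\<T> x) ^ p) \<odot> \<tau> x)
      = binomial_term \<alpha> p (\<T> x) \<odot> \<tau> x" for p x
    by (simp only: binomial_term_def bop_comp.scaleR_left)
  have abs2: "abs_unif_convergent_on (D \<times> ball 0 L) (\<lambda>p (x, h). (1 / fact (Suc p)) *\<^sub>R
               (pser_deriv \<alpha> (Suc p) (\<T> x) * bop_apply (Cop (\<T> x) ^ p) (blinfun_apply (\<tau> x) h)))"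
    if L: "L > 0" and m: "0 \<le> m" "\<And>x. x \<in> D \<Longrightarrow> norm (\<tau> x) \<le> m" for L m
  proof -
    have "abs_unif_convergent_on (D \<times> ball 0 L)
        (\<lambda>p (x, h). bop_apply (binomial_term \<alpha> p (\<T> x)) (blinfun_apply (\<tau> x) h))"
      by (rule abs_unif_convergent_apply[OF K(3)[OF norm_\<T>] K(1,2) m L])
    then show ?thesis
      by (rule abs_unif_convergent_cong[THEN iffD1, rotated]) (use norm_\<T> K(5) in \<open>auto simp del: fact_Suc\<close>)
  qed
  show ?thesis
  proof (intro conjI ballI allI impI)
    fix x assume x: "x \<in> D"
    show "(\<lambda>p. (1 / fact (Suc p)) *\<^sub>R ((pser_deriv \<alpha> (Suc p) (Rop (\<T> x)) * Cop (\<T> x) ^ p) \<odot> \<tau> x))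
            sums frechet_diff F x"
      unfolding eq frechet_diff_F[OF x]
      by (intro bounded_linear.sums[OF bop_comp.bounded_linear_left] K(4) norm_\<T> x)
    show "(\<lambda>p. (1 / fact (Suc p)) *\<^sub>R
            (pser_deriv \<alpha> (Suc p) (\<T> x) * bop_apply (Cop (\<T> x) ^ p) (blinfun_apply (\<tau> x) h)))
            sums blinfun_apply (frechet_diff F x) h" for h
      unfolding K(5)[OF norm_\<T>[OF x], symmetric] frechet_diff_F_apply[OF x]
      by (intro bounded_linear.sums[OF bop_apply.bounded_linear_left] K(4) norm_\<T> x)
  next
    assume M: "(SUP x\<in>D. ennreal (norm (\<tau> x))) < \<infinity>"
    obtain m where m: "0 \<le> m" "\<And>x. x \<in> D \<Longrightarrow> norm (\<tau> x) \<le> m" using SUP_norm_finite[OF M] by blast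
    show "abs_unif_convergent_on D (\<lambda>p x. (1 / fact (Suc p)) *\<^sub>R
               ((pser_deriv \<alpha> (Suc p) (Rop (\<T> x)) * Cop (\<T> x) ^ p) \<odot> \<tau> x))"
      unfolding eq by (rule abs_unif_convergent_bop_comp[OF K(3)[OF norm_\<T>] K(1,2) m])
    show "abs_unif_convergent_on (D \<times> ball 0 L) (\<lambda>p (x, h). (1 / fact (Suc p)) *\<^sub>R
               (pser_deriv \<alpha> (Suc p) (\<T> x) * bop_apply (Cop (\<T> x) ^ p) (blinfun_apply (\<tau> x) h)))" if "0 < L" for L
      by (rule abs2[OF that m])
  qed
qed

lemma leading_term_apply:
  "bop_apply (leading_term \<alpha> n T) k = (of_nat (n + 1) * \<alpha> (n + 1)) *\<^sub>C (k * T ^ (n + 1 - 1))"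
  by (simp add: leading_term_def bop_apply_simps Lop_power_apply)

lemma commutator_term_apply:
  "bop_apply (commutator_term \<alpha> n p T) k =
     (of_nat (n + 2 - p - 1) * \<alpha> (n + 2)) *\<^sub>C (T ^ p * commutator T k * T ^ (n + 2 - (2 + p)))"
proof -
  have "T * (k * T ^ m) - k * T ^ m * T = (T * k - k * T) * T ^ m" for m
    by (simp add: left_diff_distrib mult.assoc power_commutes)
  then show ?thesis
    by (simp add: commutator_term_def bop_apply_simps bop_apply_linear Rop_power_apply Lop_power_apply
        Rop_apply Lop_apply commutator_def mult.assoc numeral_2_eq_2 del: of_nat_diff)
qed

lemma commutator_expansion:
  "let s = (\<lambda>n x h. (of_nat n * \<alpha> n) *\<^sub>C (blinfun_apply (\<tau> x) h * \<T> x ^ (n - 1)));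
       c = (\<lambda>n p x h. (of_nat (n - p - 1) * \<alpha> n) *\<^sub>C
              (\<T> x ^ p * commutator (\<T> x) (blinfun_apply (\<tau> x) h) * \<T> x ^ (n - (2 + p))))
   in (\<forall>x\<in>D. \<forall>h.
         summable (\<lambda>n. s (n + 1) x h) \<and>
         summable (\<lambda>n. \<Sum>p = 0..n. c (n + 2) p x h) \<and>
         (\<forall>p. summable (\<lambda>n. c (n + (p + 2)) p x h)) \<and>
         summable (\<lambda>p. \<Sum>n. c (n + (p + 2)) p x h) \<and>
         blinfun_apply (frechet_diff F x) h
           = (\<Sum>n. s (n + 1) x h) + (\<Sum>n. \<Sum>p = 0..n. c (n + 2) p x h) \<and>
         blinfun_apply (frechet_diff F x) h
           = (\<Sum>n. s (n + 1) x h) + (\<Sum>p. \<Sum>n. c (n + (p + 2)) p x h)) \<and>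
      ((SUP x\<in>D. ennreal (norm (\<tau> x))) < \<infinity> \<longrightarrow> (\<forall>L>0.
         abs_unif_convergent_on (D \<times> ball 0 L) (\<lambda>n (x, h). s (n + 1) x h) \<and>
         abs_unif_convergent_on (D \<times> ball 0 L) (\<lambda>n (x, h). \<Sum>p = 0..n. c (n + 2) p x h) \<and>
         (\<forall>p. abs_unif_convergent_on (D \<times> ball 0 L) (\<lambda>n (x, h). c (n + (p + 2)) p x h)) \<and>
         abs_unif_convergent_on (D \<times> ball 0 L) (\<lambda>p (x, h). \<Sum>n. c (n + (p + 2)) p x h)))"
proof -
  let ?B = "triangular_majorant \<alpha> \<rho>"
  note sB = summable_triangular_majorant[OF \<rho>]
  note le = norm_commutator_term_le[OF norm_\<T>]
  have c2: "bop_apply (commutator_term \<alpha> (n + p) p T) k =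
     (of_nat (n + (p + 2) - p - 1) * \<alpha> (n + (p + 2))) *\<^sub>C (T ^ p * commutator T k * T ^ (n + (p + 2) - (2 + p)))"
    for n p and T k :: "'g bop"
    unfolding commutator_term_apply by (simp only: add.assoc)
  have row: "summable (\<lambda>n. commutator_term \<alpha> (n + p) p (\<T> x))" if "x \<in> D" for p x
    by (rule summable_norm_cancel[OF summable_triangular(2)[OF le[OF that] sB]])
  have row_apply: "(\<Sum>n. bop_apply (commutator_term \<alpha> (n + p) p (\<T> x)) k) =
      bop_apply (\<Sum>n. commutator_term \<alpha> (n + p) p (\<T> x)) k" if "x \<in> D" for p x k
    by (rule bounded_linear.suminf[OF bop_apply.bounded_linear_left row[OF that], symmetric])
  have pointwise: "summable (\<lambda>n. bop_apply (leading_term \<alpha> n (\<T> x)) k) \<and>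
      summable (\<lambda>n. \<Sum>p = 0..n. bop_apply (commutator_term \<alpha> n p (\<T> x)) k) \<and>
      (\<forall>p. summable (\<lambda>n. bop_apply (commutator_term \<alpha> (n + p) p (\<T> x)) k)) \<and>
      summable (\<lambda>p. \<Sum>n. bop_apply (commutator_term \<alpha> (n + p) p (\<T> x)) k) \<and>
      y = (\<Sum>n. bop_apply (leading_term \<alpha> n (\<T> x)) k) +
        (\<Sum>n. \<Sum>p = 0..n. bop_apply (commutator_term \<alpha> n p (\<T> x)) k) \<and>
      y = (\<Sum>n. bop_apply (leading_term \<alpha> n (\<T> x)) k) +
        (\<Sum>p. \<Sum>n. bop_apply (commutator_term \<alpha> (n + p) p (\<T> x)) k)"
    if x: "x \<in> D" and y: "y = bop_apply (diff_pser \<alpha> (\<T> x)) k" for x y k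
  proof -
    note ev = bop_apply.bounded_linear_left[of k]
    note sc = summable_leading_term[OF norm_\<T>[OF x] \<rho>(2)]
    note col = summable_triangular(1)[OF le[OF x] sB]
    note tot = summable_triangular(4)[OF le[OF x] sB]
    have col_apply: "(\<Sum>p = 0..n. bop_apply (commutator_term \<alpha> n p (\<T> x)) k) =
        bop_apply (\<Sum>p\<le>n. commutator_term \<alpha> n p (\<T> x)) k" for n
      by (simp add: bop_apply.sum_left atLeast0AtMost)
    have 1: "bop_apply (diff_pser \<alpha> (\<T> x)) k = (\<Sum>n. bop_apply (leading_term \<alpha> n (\<T> x)) k) +
        bop_apply (\<Sum>n. \<Sum>p\<le>n. commutator_term \<alpha> n p (\<T> x)) k"
      unfolding diff_pser_split(1)[OF norm_\<T>[OF x] \<rho>(2)]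
      by (simp add: bop_apply_simps bounded_linear.suminf[OF ev sc])
    have 2: "bop_apply (\<Sum>n. \<Sum>p\<le>n. commutator_term \<alpha> n p (\<T> x)) k =
        (\<Sum>n. \<Sum>p = 0..n. bop_apply (commutator_term \<alpha> n p (\<T> x)) k)"
      unfolding col_apply by (rule bounded_linear.suminf[OF ev col])
    have 3: "bop_apply (\<Sum>n. \<Sum>p\<le>n. commutator_term \<alpha> n p (\<T> x)) k =
        (\<Sum>p. \<Sum>n. bop_apply (commutator_term \<alpha> (n + p) p (\<T> x)) k)"
      unfolding row_apply[OF x] by (rule sums_unique[OF bounded_linear.sums[OF ev tot]])
    show ?thesis
      using bounded_linear.summable[OF ev sc] bounded_linear.summable[OF ev col]
        bounded_linear.summable[OF ev row[OF x]] sums_summable[OF bounded_linear.sums[OF ev tot]] y 1 2 3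
      unfolding col_apply row_apply[OF x]
      by simp
  qed
  have uniform: "abs_unif_convergent_on (D \<times> ball 0 L)
        (\<lambda>n (x, h). bop_apply (leading_term \<alpha> n (\<T> x)) (blinfun_apply (\<tau> x) h)) \<and>
      abs_unif_convergent_on (D \<times> ball 0 L)
        (\<lambda>n (x, h). \<Sum>p = 0..n. bop_apply (commutator_term \<alpha> n p (\<T> x)) (blinfun_apply (\<tau> x) h)) \<and>
      (\<forall>p. abs_unif_convergent_on (D \<times> ball 0 L)
        (\<lambda>n (x, h). bop_apply (commutator_term \<alpha> (n + p) p (\<T> x)) (blinfun_apply (\<tau> x) h))) \<and>
      abs_unif_convergent_on (D \<times> ball 0 L)
        (\<lambda>p (x, h). \<Sum>n. bop_apply (commutator_term \<alpha> (n + p) p (\<T> x)) (blinfun_apply (\<tau> x) h))"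
    if L: "L > 0" and M: "(SUP x\<in>D. ennreal (norm (\<tau> x))) < \<infinity>" for L
  proof -
    obtain m where m: "0 \<le> m" "\<And>x. x \<in> D \<Longrightarrow> norm (\<tau> x) \<le> m" using SUP_norm_finite[OF M] by blast
    have B0: "0 \<le> ?B n p" for n p using \<rho>(1) by (simp add: triangular_majorant_def)
    have "abs_unif_convergent_on (D \<times> ball 0 L)
        (\<lambda>n (x, h). bop_apply (\<Sum>p\<le>n. commutator_term \<alpha> n p (\<T> x)) (blinfun_apply (\<tau> x) h))"
      by (rule abs_unif_convergent_apply[OF _ sB _ m L])
        (auto intro!: sum_nonneg B0 order_trans[OF norm_sum sum_mono] le)
    moreover have "abs_unif_convergent_on (D \<times> ball 0 L)
        (\<lambda>n (x, h). bop_apply (commutator_term \<alpha> (n + p) p (\<T> x)) (blinfun_apply (\<tau> x) h))" for p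
    proof (rule abs_unif_convergent_apply[OF _ _ _ m L, of _ "\<lambda>n. ?B (n + p) p"])
      show "summable (\<lambda>n. ?B (n + p) p)"
        using norm_suminf_triangular_le(3)[of ?B ?B p, OF _ sB] B0 by simp
    qed (use le B0 in auto)
    moreover have "abs_unif_convergent_on (D \<times> ball 0 L)
        (\<lambda>p (x, h). bop_apply (\<Sum>n. commutator_term \<alpha> (n + p) p (\<T> x)) (blinfun_apply (\<tau> x) h))"
    proof (rule abs_unif_convergent_apply[OF _ _ _ m L])
      show "norm (\<Sum>n. commutator_term \<alpha> (n + p) p (\<T> x)) \<le> (\<Sum>n. norm (?B (n + p) p))" if "x \<in> D" for p x
        by (rule norm_suminf_triangular_le(1)[OF le[OF that] sB])
      show "summable (\<lambda>p. \<Sum>n. norm (?B (n + p) p))" "0 \<le> (\<Sum>n. norm (?B (n + p) p))" for p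
        using norm_suminf_triangular_le(2)[of ?B ?B, OF _ sB] norm_suminf_triangular_le(3)[of ?B ?B p, OF _ sB] B0
        by (auto intro!: suminf_nonneg)
    qed
    moreover have "abs_unif_convergent_on (D \<times> ball 0 L)
        (\<lambda>n (x, h). bop_apply (leading_term \<alpha> n (\<T> x)) (blinfun_apply (\<tau> x) h))"
      using \<rho>(1) by (intro abs_unif_convergent_apply[OF norm_leading_term_le[OF norm_\<T>, where \<alpha> = \<alpha>] summable_diffs_norm(1)[OF \<rho>] _ m L]) auto
    moreover have "(\<Sum>p = 0..n. bop_apply (commutator_term \<alpha> n p (\<T> x)) k) =
        bop_apply (\<Sum>p\<le>n. commutator_term \<alpha> n p (\<T> x)) k" for n x k
      by (simp add: bop_apply.sum_left atLeast0AtMost)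
    moreover have "abs_unif_convergent_on (D \<times> ball 0 L) (\<lambda>p (x, h).
          \<Sum>n. bop_apply (commutator_term \<alpha> (n + p) p (\<T> x)) (blinfun_apply (\<tau> x) h)) \<longleftrightarrow>
        abs_unif_convergent_on (D \<times> ball 0 L) (\<lambda>p (x, h).
          bop_apply (\<Sum>n. commutator_term \<alpha> (n + p) p (\<T> x)) (blinfun_apply (\<tau> x) h))"
      by (rule abs_unif_convergent_cong) (auto simp: row_apply)
    ultimately show ?thesis by simp
  qed
  show ?thesis
    unfolding Let_def c2[symmetric] commutator_term_apply[symmetric] leading_term_apply[symmetric]
    by (rule conjI, rule ballI, rule allI, rule pointwise, assumption, erule frechet_diff_F_apply)
      (rule impI, rule allI, rule impI, rule uniform)
qed

lemma power_difference_expansion: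
  "let s = (\<lambda>n x. (of_nat n * \<alpha> n) *\<^sub>C (Lop (\<T> x) ^ (n - 1) \<odot> \<tau> x));
       a = (\<lambda>k n x. \<alpha> n *\<^sub>C Lop (\<T> x) ^ (n - k));
       b = (\<lambda>k x. ((\<Sum>n. a k (n + k) x) * Cop (\<T> x ^ (k - 1))) \<odot> \<tau> x)
   in (\<forall>x\<in>D.
         summable (\<lambda>n. s (n + 1) x) \<and>
         (\<forall>k\<ge>2. summable (\<lambda>n. a k (n + k) x)) \<and>
         summable (\<lambda>k. b (k + 2) x) \<and>
         frechet_diff F x = (\<Sum>n. s (n + 1) x) - (\<Sum>k. b (k + 2) x)) \<and>
      ((SUP x\<in>D. ennreal (norm (\<tau> x))) < \<infinity> \<longrightarrow>
         abs_unif_convergent_on D (\<lambda>n x. s (n + 1) x) \<and>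
         (\<forall>k\<ge>2. abs_unif_convergent_on D (\<lambda>n x. a k (n + k) x)) \<and>
         abs_unif_convergent_on D (\<lambda>k x. b (k + 2) x))"
proof -
  let ?B = "triangular_majorant \<alpha> \<rho>"
  note sB = summable_triangular_majorant[OF \<rho>]
  note le = norm_power_difference_term_le[OF norm_\<T>]
  have B0: "0 \<le> ?B n p" for n p using \<rho>(1) by (simp add: triangular_majorant_def)
  have s_eq: "(of_nat (n + 1) * \<alpha> (n + 1)) *\<^sub>C (Lop (\<T> x) ^ (n + 1 - 1) \<odot> \<tau> x) = leading_term \<alpha> n (\<T> x) \<odot> \<tau> x" for n x
    by (simp add: leading_term_def bop_comp_scaleC)
  have a_le: "norm (\<alpha> (n + k) *\<^sub>C Lop (\<T> x) ^ (n + k - k)) \<le> cmod (\<alpha> (n + k)) * \<rho> ^ n" if "x \<in> D" for n k x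
    using norm_Lop_power_le[OF norm_\<T>[OF that], of n] by (simp add: norm_scaleC mult_left_mono)
  have a_sum: "summable (\<lambda>n. \<alpha> (n + k) *\<^sub>C Lop (\<T> x) ^ (n + k - k))" if "x \<in> D" for k x
    by (rule summable_comparison_test'[OF summable_norm_shift[OF \<rho>], of 0]) (rule a_le[OF that])
  have b_eq: "((\<Sum>n. \<alpha> (n + (k + 2)) *\<^sub>C Lop (\<T> x) ^ (n + (k + 2) - (k + 2))) * Cop (\<T> x ^ (k + 2 - 1))) \<odot> \<tau> x
      = (\<Sum>n. power_difference_term \<alpha> (n + k) k (\<T> x)) \<odot> \<tau> x" if "x \<in> D" for k x
  proof -
    have "(\<Sum>n. \<alpha> (n + (k + 2)) *\<^sub>C Lop (\<T> x) ^ (n + (k + 2) - (k + 2))) * Cop (\<T> x ^ (k + 2 - 1))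
        = (\<Sum>n. (\<alpha> (n + (k + 2)) *\<^sub>C Lop (\<T> x) ^ (n + (k + 2) - (k + 2))) * Cop (\<T> x ^ (k + 2 - 1)))"
      by (rule bounded_linear.suminf[OF bounded_linear_mult_left a_sum[OF that]])
    also have "\<dots> = (\<Sum>n. power_difference_term \<alpha> (n + k) k (\<T> x))"
      by (simp add: power_difference_term_def scaleC_mult_left add.assoc)
    finally show ?thesis by simp
  qed
  have b_sums: "(\<lambda>k. (\<Sum>n. power_difference_term \<alpha> (n + k) k (\<T> x)) \<odot> \<tau> x) sums
      ((\<Sum>n. \<Sum>k\<le>n. power_difference_term \<alpha> n k (\<T> x)) \<odot> \<tau> x)" if "x \<in> D" for x
    by (rule bounded_linear.sums[OF bop_comp.bounded_linear_left summable_triangular(4)[OF le[OF that] sB]])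
  have s_sums: "(\<lambda>n. leading_term \<alpha> n (\<T> x) \<odot> \<tau> x) sums ((\<Sum>n. leading_term \<alpha> n (\<T> x)) \<odot> \<tau> x)" if "x \<in> D" for x
    by (rule bounded_linear.sums[OF bop_comp.bounded_linear_left summable_sums[OF summable_leading_term[OF norm_\<T>[OF that] \<rho>(2)]]])
  show ?thesis
    unfolding Let_def s_eq
  proof (intro conjI ballI allI impI)
    fix x assume x: "x \<in> D"
    show "summable (\<lambda>n. leading_term \<alpha> n (\<T> x) \<odot> \<tau> x)"
      by (rule sums_summable[OF s_sums[OF x]])
    show "summable (\<lambda>n. \<alpha> (n + k) *\<^sub>C Lop (\<T> x) ^ (n + k - k))" for k
      by (rule a_sum[OF x])
    show "summable (\<lambda>k. ((\<Sum>n. \<alpha> (n + (k + 2)) *\<^sub>C Lop (\<T> x) ^ (n + (k + 2) - (k + 2))) * Cop (\<T> x ^ (k + 2 - 1))) \<odot> \<tau> x)"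
      unfolding b_eq[OF x] by (rule sums_summable[OF b_sums[OF x]])
    show "frechet_diff F x = (\<Sum>n. leading_term \<alpha> n (\<T> x) \<odot> \<tau> x) -
        (\<Sum>k. ((\<Sum>n. \<alpha> (n + (k + 2)) *\<^sub>C Lop (\<T> x) ^ (n + (k + 2) - (k + 2))) * Cop (\<T> x ^ (k + 2 - 1))) \<odot> \<tau> x)"
      unfolding b_eq[OF x] sums_unique[OF b_sums[OF x], symmetric] sums_unique[OF s_sums[OF x], symmetric]
        frechet_diff_F[OF x] diff_pser_split(2)[OF norm_\<T>[OF x] \<rho>(2)]
      by (rule bop_comp.diff_left)
  next
    assume M: "(SUP x\<in>D. ennreal (norm (\<tau> x))) < \<infinity>"
    obtain m where m: "0 \<le> m" "\<And>x. x \<in> D \<Longrightarrow> norm (\<tau> x) \<le> m" using SUP_norm_finite[OF M] by blast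
    show "abs_unif_convergent_on D (\<lambda>n x. leading_term \<alpha> n (\<T> x) \<odot> \<tau> x)"
      using \<rho>(1) by (intro abs_unif_convergent_bop_comp[OF norm_leading_term_le[OF norm_\<T>, where \<alpha> = \<alpha>] summable_diffs_norm(1)[OF \<rho>] _ m]) auto
    show "abs_unif_convergent_on D (\<lambda>n x. \<alpha> (n + k) *\<^sub>C Lop (\<T> x) ^ (n + k - k))" for k
      by (rule abs_unif_convergent_onI[OF a_le summable_norm_shift[OF \<rho>]]) (use \<rho>(1) in auto)
    have "abs_unif_convergent_on D (\<lambda>k x. (\<Sum>n. power_difference_term \<alpha> (n + k) k (\<T> x)) \<odot> \<tau> x)"
    proof (rule abs_unif_convergent_bop_comp[OF _ _ _ m])
      show "norm (\<Sum>n. power_difference_term \<alpha> (n + k) k (\<T> x)) \<le> (\<Sum>n. norm (?B (n + k) k))" if "x \<in> D" for k x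
        by (rule norm_suminf_triangular_le(1)[OF le[OF that] sB])
      show "summable (\<lambda>k. \<Sum>n. norm (?B (n + k) k))" "0 \<le> (\<Sum>n. norm (?B (n + k) k))" for k
        using norm_suminf_triangular_le(2)[of ?B ?B, OF _ sB] norm_suminf_triangular_le(3)[of ?B ?B k, OF _ sB] B0
        by (auto intro!: suminf_nonneg)
    qed
    then show "abs_unif_convergent_on D (\<lambda>k x. ((\<Sum>n. \<alpha> (n + (k + 2)) *\<^sub>C Lop (\<T> x) ^ (n + (k + 2) - (k + 2))) * Cop (\<T> x ^ (k + 2 - 1))) \<odot> \<tau> x)"
      by (rule abs_unif_convergent_cong[THEN iffD1, rotated]) (simp only: b_eq)
  qed
qed

end

section \<open>Admissible maps\<close>

lemma admissible_map_family:
  fixes \<T> :: "'x::real_normed_vector \<Rightarrow> 'g::complex_banach bop"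
  assumes U: "open U" and g: "\<forall>z\<in>U. (\<lambda>n. \<alpha> n * z ^ n) sums g z"
    and R: "0 < conv_radius \<alpha>" and \<T>: "admissible_map U (conv_radius \<alpha>) D \<T>"
  obtains r where "0 < r" "differentiable_family \<alpha> D \<T> (\<lambda>x. functional_calculus U g (\<T> x)) r"
proof -
  have D: "open D" and diff: "\<And>x. x \<in> D \<Longrightarrow> \<T> differentiable (at x)"
    and spec: "\<And>x. x \<in> D \<Longrightarrow> spectrum (\<T> x) \<subseteq> U"
    and "\<exists>r. 0 < r \<and> ereal r < conv_radius \<alpha> \<and> \<T> ` D \<subseteq> ball 0 r"
    using \<T> unfolding admissible_map_def by simp_all
  then obtain r where r: "0 < r" "ereal r < conv_radius \<alpha>" "\<T> ` D \<subseteq> ball 0 r"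
    by (elim exE conjE)
  have sums: "(\<lambda>n. \<alpha> n *\<^sub>C T ^ n) sums functional_calculus U g T" if "spectrum T \<subseteq> U" for T :: "'g bop"
    by (rule sums_functional_calculus[OF spectral_contour_exists[OF compact_spectrum U that] R U g[rule_format]])
  have "norm (\<T> x) \<le> r" if "x \<in> D" for x
    using r(3) that by (auto simp: image_subset_iff less_imp_le)
  then have "differentiable_family \<alpha> D \<T> (\<lambda>x. functional_calculus U g (\<T> x)) r"
    by unfold_locales (use D diff r(1,2) sums[OF spec] in auto)
  with r(1) show ?thesis by (rule that)
qed

lemma (in differentiable_family) SUP_norm_le: "(SUP x\<in>D. ennreal (norm (\<T> x))) \<le> ennreal \<rho>"
  by (rule SUP_least) (simp add: norm_\<T> ennreal_leI)

text \<open>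
  The condition on the supremum of the norms carries over to a radius \<open>\<sigma>\<close>, because the supremum itself bounds
  all norms.
\<close>

lemma (in differentiable_family) sharp_radius:
  assumes "enn2ereal (SUP x\<in>D. ennreal (norm (\<T> x))) < conv_radius \<alpha> / 3"
  obtains \<sigma> where "differentiable_family \<alpha> D \<T> F \<sigma>" "ereal (3 * \<sigma>) < conv_radius \<alpha>"
proof -
  define s where "s = (SUP x\<in>D. ennreal (norm (\<T> x)))"
  define \<sigma> where "\<sigma> = enn2real s"
  have fin: "s < top"
    using SUP_norm_le unfolding s_def by (rule le_less_trans) simp
  have s: "s = ennreal \<sigma>" and \<sigma>0: "0 \<le> \<sigma>"
    using fin by (simp_all add: \<sigma>_def)
  have "ereal \<sigma> < conv_radius \<alpha> / 3"
    using assms unfolding s_def[symmetric] s by (simp add: \<sigma>0)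
  then have 3: "ereal (3 * \<sigma>) < conv_radius \<alpha>"
    by (cases "conv_radius \<alpha>") (auto simp: numeral_eq_ereal)
  have le: "norm (\<T> x) \<le> \<sigma>" if "x \<in> D" for x
  proof -
    have "ennreal (norm (\<T> x)) \<le> s" unfolding s_def using that by (rule SUP_upper)
    then show ?thesis unfolding s using \<sigma>0 by (simp add: ennreal_le_iff)
  qed
  have "ereal \<sigma> < conv_radius \<alpha>"
    using le_less_trans[OF _ 3, of "ereal \<sigma>"] \<sigma>0 by simp
  then have "differentiable_family \<alpha> D \<T> F \<sigma>"
    by unfold_locales (use open_D diff_\<T> F_sums \<sigma>0 le in auto)
  then show ?thesis using 3 by (rule that)
qed

lemma vector_derivative_frechet_diff:
  assumes "f differentiable (at t)"
  shows "vector_derivative f (at t) = blinfun_apply (frechet_diff f t) 1"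
    and "norm (frechet_diff f t) = norm (vector_derivative f (at t))"
proof -
  let ?A = "frechet_diff f t"
  have A: "blinfun_apply ?A h = h *\<^sub>R blinfun_apply ?A 1" for h
    by (simp flip: blinfun.scaleR_right)
  have "(f has_vector_derivative blinfun_apply ?A 1) (at t)"
    unfolding has_vector_derivative_def A[symmetric] by (rule frechet_diff_has_derivative[OF assms])
  then show eq: "vector_derivative f (at t) = blinfun_apply ?A 1"
    by (rule vector_derivative_at)
  have "norm ?A \<le> norm (blinfun_apply ?A 1)"
  proof (rule norm_blinfun_bound)
    show "norm (blinfun_apply ?A h) \<le> norm (blinfun_apply ?A 1) * norm h" for h
      using arg_cong[OF A[of h], of norm] by (simp add: mult.commute)
  qed simp
  then show "norm ?A = norm (vector_derivative f (at t))"
    unfolding eq using norm_blinfun[of ?A 1] by simp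
qed

theorem corollary3p1:
  fixes U\<^sub>0 :: "complex set" and g :: "complex \<Rightarrow> complex" and \<alpha> :: "nat \<Rightarrow> complex" and R :: ereal
    and D :: "'x::banach set" and \<T> :: "'x \<Rightarrow> 'g::complex_banach bop"
    and F :: "'x \<Rightarrow> 'g bop" and r\<^sub>t M :: ennreal
  assumes U\<^sub>0: "open U\<^sub>0" "0 \<in> U\<^sub>0"
    and g: "g analytic_on U\<^sub>0" "\<forall>z\<in>U\<^sub>0. (\<lambda>n. \<alpha> n * z ^ n) sums g z"
    and R: "R = conv_radius \<alpha>" "0 < R"
    and \<T>: "admissible_map U\<^sub>0 R D \<T>"
    and F: "F = (\<lambda>x. functional_calculus U\<^sub>0 g (\<T> x))"
    and r\<^sub>t: "r\<^sub>t = (SUP x\<in>D. ennreal (norm (\<T> x)))"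
    and M: "M = (SUP x\<in>D. ennreal (norm (frechet_diff \<T> x)))"
  shows
    "(\<comment> \<open>(1)\<close>
     (\<forall>x\<in>D. (\<lambda>n. \<alpha> n *\<^sub>C \<T> x ^ n) sums F x)
     \<and> abs_unif_convergent_on D (\<lambda>n x. \<alpha> n *\<^sub>C \<T> x ^ n)) \<and>
     (\<comment> \<open>(2)\<close>
     r\<^sub>t < \<infinity>) \<and>
     (\<comment> \<open>(2a)\<close>
     0 < r\<^sub>t \<and> enn2ereal r\<^sub>t < R \<longrightarrow>
       (\<forall>x\<in>D. F differentiable (at x)) \<and>
       (\<forall>x\<in>D. (\<lambda>n. \<alpha> n *\<^sub>C (frechet_diff (\<lambda>T. T ^ n) (\<T> x) o\<^sub>L frechet_diff \<T> x))
                 sums frechet_diff F x) \<and>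
       (continuous_on D (frechet_diff \<T>) \<longrightarrow> continuous_on D (frechet_diff F)) \<and>
       (M < \<infinity> \<longrightarrow> abs_unif_convergent_on D
          (\<lambda>n x. \<alpha> n *\<^sub>C (frechet_diff (\<lambda>T. T ^ n) (\<T> x) o\<^sub>L frechet_diff \<T> x)))) \<and>
     (\<comment> \<open>(2b)\<close>
     0 < r\<^sub>t \<and> enn2ereal r\<^sub>t < R / 3 \<longrightarrow>
       (\<forall>x\<in>D. (\<lambda>p. (1 / fact (Suc p)) *\<^sub>R
                  ((pser_deriv \<alpha> (Suc p) (Rop (\<T> x)) * Cop (\<T> x) ^ p) \<odot> frechet_diff \<T> x))
                 sums frechet_diff F x) \<and>
       (\<forall>x\<in>D. \<forall>h. (\<lambda>p. (1 / fact (Suc p)) *\<^sub>R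
                  (pser_deriv \<alpha> (Suc p) (\<T> x)
                     * bop_apply (Cop (\<T> x) ^ p) (blinfun_apply (frechet_diff \<T> x) h)))
                 sums blinfun_apply (frechet_diff F x) h) \<and>
       (M < \<infinity> \<longrightarrow>
          abs_unif_convergent_on D
            (\<lambda>p x. (1 / fact (Suc p)) *\<^sub>R
               ((pser_deriv \<alpha> (Suc p) (Rop (\<T> x)) * Cop (\<T> x) ^ p) \<odot> frechet_diff \<T> x)) \<and>
          (\<forall>L>0. abs_unif_convergent_on (D \<times> ball 0 L)
            (\<lambda>p (x, h). (1 / fact (Suc p)) *\<^sub>R
               (pser_deriv \<alpha> (Suc p) (\<T> x)
                  * bop_apply (Cop (\<T> x) ^ p) (blinfun_apply (frechet_diff \<T> x) h)))))) \<and>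
     (\<comment> \<open>(2c)\<close>
     0 < r\<^sub>t \<and> enn2ereal r\<^sub>t < R \<longrightarrow>
       (let s = (\<lambda>n x h. (of_nat n * \<alpha> n) *\<^sub>C
                   (blinfun_apply (frechet_diff \<T> x) h * \<T> x ^ (n - 1)));
            c = (\<lambda>n p x h. (of_nat (n - p - 1) * \<alpha> n) *\<^sub>C
                   (\<T> x ^ p * commutator (\<T> x) (blinfun_apply (frechet_diff \<T> x) h)
                      * \<T> x ^ (n - (2 + p))))
        in
         (\<forall>x\<in>D. \<forall>h.
            summable (\<lambda>n. s (n + 1) x h) \<and>
            summable (\<lambda>n. \<Sum>p = 0..n. c (n + 2) p x h) \<and>
            (\<forall>p. summable (\<lambda>n. c (n + (p + 2)) p x h)) \<and>
            summable (\<lambda>p. \<Sum>n. c (n + (p + 2)) p x h) \<and>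
            blinfun_apply (frechet_diff F x) h
              = (\<Sum>n. s (n + 1) x h) + (\<Sum>n. \<Sum>p = 0..n. c (n + 2) p x h) \<and>
            blinfun_apply (frechet_diff F x) h
              = (\<Sum>n. s (n + 1) x h) + (\<Sum>p. \<Sum>n. c (n + (p + 2)) p x h)) \<and>
         (M < \<infinity> \<longrightarrow> (\<forall>L>0.
            abs_unif_convergent_on (D \<times> ball 0 L) (\<lambda>n (x, h). s (n + 1) x h) \<and>
            abs_unif_convergent_on (D \<times> ball 0 L) (\<lambda>n (x, h). \<Sum>p = 0..n. c (n + 2) p x h) \<and>
            (\<forall>p. abs_unif_convergent_on (D \<times> ball 0 L) (\<lambda>n (x, h). c (n + (p + 2)) p x h)) \<and>
            abs_unif_convergent_on (D \<times> ball 0 L) (\<lambda>p (x, h). \<Sum>n. c (n + (p + 2)) p x h))))) \<and>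
     (\<comment> \<open>(2d)\<close>
     0 < r\<^sub>t \<and> enn2ereal r\<^sub>t < R \<longrightarrow>
       (let s = (\<lambda>n x. (of_nat n * \<alpha> n) *\<^sub>C (Lop (\<T> x) ^ (n - 1) \<odot> frechet_diff \<T> x));
            a = (\<lambda>k n x. \<alpha> n *\<^sub>C Lop (\<T> x) ^ (n - k));
            b = (\<lambda>k x. ((\<Sum>n. a k (n + k) x) * Cop (\<T> x ^ (k - 1))) \<odot> frechet_diff \<T> x)
        in
         (\<forall>x\<in>D.
            summable (\<lambda>n. s (n + 1) x) \<and>
            (\<forall>k\<ge>2. summable (\<lambda>n. a k (n + k) x)) \<and>
            summable (\<lambda>k. b (k + 2) x) \<and>
            frechet_diff F x = (\<Sum>n. s (n + 1) x) - (\<Sum>k. b (k + 2) x)) \<and>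
         (M < \<infinity> \<longrightarrow>
            abs_unif_convergent_on D (\<lambda>n x. s (n + 1) x) \<and>
            (\<forall>k\<ge>2. abs_unif_convergent_on D (\<lambda>n x. a k (n + k) x)) \<and>
            abs_unif_convergent_on D (\<lambda>k x. b (k + 2) x)))) \<and>
     (\<comment> \<open>(2e), the case \<open>X = \<real>\<close>\<close>
     \<forall>(I :: real set) (S :: real \<Rightarrow> 'g bop) (FS :: real \<Rightarrow> 'g bop) (\<rho> :: ennreal).
       admissible_map U\<^sub>0 R I S \<and>
       FS = (\<lambda>t. functional_calculus U\<^sub>0 g (S t)) \<and>
       \<rho> = (SUP t\<in>I. ennreal (norm (S t))) \<and>
       0 < \<rho> \<and> enn2ereal \<rho> < R / 3 \<longrightarrow>
         (\<forall>t\<in>I. FS differentiable (at t) \<and>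
            (\<lambda>p. (1 / fact (Suc p)) *\<^sub>R
               (pser_deriv \<alpha> (Suc p) (S t)
                  * bop_apply (Cop (S t) ^ p) (vector_derivative S (at t))))
              sums vector_derivative FS (at t)) \<and>
         ((SUP t\<in>I. ennreal (norm (vector_derivative S (at t)))) < \<infinity> \<longrightarrow>
            abs_unif_convergent_on I
              (\<lambda>p t. (1 / fact (Suc p)) *\<^sub>R
                 (pser_deriv \<alpha> (Suc p) (S t)
                    * bop_apply (Cop (S t) ^ p) (vector_derivative S (at t))))))"
proof -
  note U = U\<^sub>0(1) and g = g(2) and R0 = R(2)[unfolded R(1)]
  obtain r where r: "0 < r" "differentiable_family \<alpha> D \<T> F r"
    using admissible_map_family[OF U g R0 \<T>[unfolded R(1)]] F by blast
  interpret A: differentiable_family \<alpha> D \<T> F r by (rule r(2))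
  have fin: "r\<^sub>t < \<infinity>"
    unfolding r\<^sub>t using A.SUP_norm_le by (rule le_less_trans) simp
  have b: "(\<forall>x\<in>D. (\<lambda>p. (1 / fact (Suc p)) *\<^sub>R
                  ((pser_deriv \<alpha> (Suc p) (Rop (\<T> x)) * Cop (\<T> x) ^ p) \<odot> frechet_diff \<T> x))
                 sums frechet_diff F x) \<and>
       (\<forall>x\<in>D. \<forall>h. (\<lambda>p. (1 / fact (Suc p)) *\<^sub>R
                  (pser_deriv \<alpha> (Suc p) (\<T> x)
                     * bop_apply (Cop (\<T> x) ^ p) (blinfun_apply (frechet_diff \<T> x) h)))
                 sums blinfun_apply (frechet_diff F x) h) \<and>
       (M < \<infinity> \<longrightarrow>
          abs_unif_convergent_on D
            (\<lambda>p x. (1 / fact (Suc p)) *\<^sub>R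
               ((pser_deriv \<alpha> (Suc p) (Rop (\<T> x)) * Cop (\<T> x) ^ p) \<odot> frechet_diff \<T> x)) \<and>
          (\<forall>L>0. abs_unif_convergent_on (D \<times> ball 0 L)
            (\<lambda>p (x, h). (1 / fact (Suc p)) *\<^sub>R
               (pser_deriv \<alpha> (Suc p) (\<T> x)
                  * bop_apply (Cop (\<T> x) ^ p) (blinfun_apply (frechet_diff \<T> x) h)))))"
    if small: "enn2ereal r\<^sub>t < R / 3"
  proof -
    obtain \<sigma> where \<sigma>: "differentiable_family \<alpha> D \<T> F \<sigma>" "ereal (3 * \<sigma>) < conv_radius \<alpha>"
      using A.sharp_radius[OF small[unfolded r\<^sub>t R(1)]] by blast
    show ?thesis
      unfolding M by (rule differentiable_family.commutator_power_expansion[OF \<sigma>])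
  qed
  have e: "(\<forall>t\<in>I. FS differentiable (at t) \<and>
            (\<lambda>p. (1 / fact (Suc p)) *\<^sub>R
               (pser_deriv \<alpha> (Suc p) (S t)
                  * bop_apply (Cop (S t) ^ p) (vector_derivative S (at t))))
              sums vector_derivative FS (at t)) \<and>
         ((SUP t\<in>I. ennreal (norm (vector_derivative S (at t)))) < \<infinity> \<longrightarrow>
            abs_unif_convergent_on I
              (\<lambda>p t. (1 / fact (Suc p)) *\<^sub>R
                 (pser_deriv \<alpha> (Suc p) (S t)
                    * bop_apply (Cop (S t) ^ p) (vector_derivative S (at t)))))"
    if S: "admissible_map U\<^sub>0 R I S" and FS: "FS = (\<lambda>t. functional_calculus U\<^sub>0 g (S t))"
      and \<rho>: "\<rho> = (SUP t\<in>I. ennreal (norm (S t)))" and small: "enn2ereal \<rho> < R / 3"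
    for I :: "real set" and S FS :: "real \<Rightarrow> 'g bop" and \<rho> :: ennreal
  proof -
    obtain r' where "differentiable_family \<alpha> I S FS r'"
      using admissible_map_family[OF U g R0 S[unfolded R(1)]] FS by blast
    from differentiable_family.sharp_radius[OF this small[unfolded \<rho> R(1)]]
    obtain \<sigma> where \<sigma>: "differentiable_family \<alpha> I S FS \<sigma>" "ereal (3 * \<sigma>) < conv_radius \<alpha>" by blast
    interpret B: differentiable_family \<alpha> I S FS \<sigma> by (rule \<sigma>(1))
    note exp = B.commutator_power_expansion[OF \<sigma>(2)]
    note vS = vector_derivative_frechet_diff[OF B.diff_\<T>]
    note vFS = vector_derivative_frechet_diff(1)[OF B.differentiable_F]
    show ?thesis
    proof (intro conjI ballI impI)
      fix t assume t: "t \<in> I"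
      show "FS differentiable (at t)" by (rule B.differentiable_F[OF t])
      show "(\<lambda>p. (1 / fact (Suc p)) *\<^sub>R
               (pser_deriv \<alpha> (Suc p) (S t) * bop_apply (Cop (S t) ^ p) (vector_derivative S (at t))))
              sums vector_derivative FS (at t)"
        unfolding vS(1)[OF t] vFS[OF t] using exp t by blast
    next
      assume "(SUP t\<in>I. ennreal (norm (vector_derivative S (at t)))) < \<infinity>"
      then have "(SUP t\<in>I. ennreal (norm (frechet_diff S t))) < \<infinity>"
        by (simp only: vS(2) cong: SUP_cong)
      then have "abs_unif_convergent_on (I \<times> ball 0 2) (\<lambda>p (t, h). (1 / fact (Suc p)) *\<^sub>R
               (pser_deriv \<alpha> (Suc p) (S t) * bop_apply (Cop (S t) ^ p) (blinfun_apply (frechet_diff S t) h)))"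
        using exp zero_less_numeral by blast
      \<comment> \<open>The differential determines the derivative through its value at \<open>1\<close>, a point of the ball.\<close>
      from abs_unif_convergent_compose[OF this, of I "\<lambda>t. (t, 1)"]
      have "abs_unif_convergent_on I (\<lambda>p t. (1 / fact (Suc p)) *\<^sub>R
               (pser_deriv \<alpha> (Suc p) (S t) * bop_apply (Cop (S t) ^ p) (blinfun_apply (frechet_diff S t) 1)))"
        by simp
      then show "abs_unif_convergent_on I (\<lambda>p t. (1 / fact (Suc p)) *\<^sub>R
                 (pser_deriv \<alpha> (Suc p) (S t) * bop_apply (Cop (S t) ^ p) (vector_derivative S (at t))))"
        by (rule abs_unif_convergent_cong[THEN iffD1, rotated]) (simp only: vS(1))
    qed
  qed
  show ?thesis
    by (intro conjI, rule ballI, rule A.F_sums, assumption, rule A.abs_unif_convergent_power_series, rule fin,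
        rule impI, rule conjI, rule ballI, erule A.differentiable_F, rule A.termwise_differentiation[folded M],
        rule impI, rule b, erule conjunct2,
        rule impI, rule A.commutator_expansion[folded M],
        rule impI, rule A.power_difference_expansion[folded M],
        intro allI impI, elim conjE, rule e, assumption+)
qed

end
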